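(* Let $n\ge 1$, $\theta\in(0,2]$, $p=p_\theta:=1+\theta/n$, and $T_*\in(0,\infty)$. Then there exists $\epsilon>0$ such that if $\varphi\in \mathfrak L^{1,\infty}_{\rm ul}(\log\mathfrak L)^{n/\theta}$ satisfies $$|||\varphi|||_{1,n/\theta;T^{1/\theta}}\le \epsilon\quad\text{for some } T\in(0,T_*],$$ then problem (P) possesses a solution $u\in C((0,T):\mathfrak L^{1,\infty}_{\rm ul}(\log\mathfrak L)^{n/\theta})\cap L^\infty_{\rm loc}((0,T):L^\infty)$ in $\mathbb R^n\times(0,T)$ satisfying $$\sup_{t\in(0,T)}|||u(t)|||_{1,n/\theta;T^{1/\theta}}+\sup_{t\in(0,T)} t^{\frac n\theta}\Big[\log\Big(e+\frac1t\Big)\Big]^{\frac n\theta}\|u(t)\|_{L^\infty}<\infty .$$ Furthermore, $$\lim_{t\to+0}\|u(t)-S_\theta(t)\varphi\|_{\mathfrak L^{1,\infty}_{\rm ul}(\log\mathfrak L)^{\gamma}}=0\quad\text{for every }\gamma\in[0,n/\theta),$$ and $u(t)\to\varphi$ as $t\to+0$ in the sense of distributions.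
   Context: Problem (P) is the Cauchy problem $\partial_t u+(-\Delta)^{\theta/2}u=|u|^{p-1}u$ in $\mathbb R^n\times(0,\infty)$, $u(x,0)=\varphi(x)$. Let $G_\theta$ be the fundamental solution of $\partial_t v+(-\Delta)^{\theta/2}v=0$ in $\mathbb R^n\times(0,\infty)$ and $(S_\theta(t)\varphi)(x)=\int_{\mathbb R^n}G_\theta(x-y,t)\varphi(y)\,dy$. Setting $F_p(s)=|s|^{p-1}s$, a measurable, a.e. finite function $u$ on $\mathbb R^n\times(0,T)$ is a solution of (P) in $\mathbb R^n\times(0,T)$ if for a.a. $(x,t)\in\mathbb R^n\times(0,T)$: $y\mapsto G_\theta(x-y,t)\varphi(y)$ is integrable on $\mathbb R^n$, $(y,s)\mapsto G_\theta(x-y,t-s)F_p(u(y,s))$ is integrable on $\mathbb R^n\times(0,t)$, and $u(x,t)=[S_\theta(t)\varphi](x)+\int_0^t[S_\theta(t-s)F_p(u(s))](x)\,ds$. For $q\in[1,\infty)$, $\alpha\ge0$ and $f\in L^1_{\rm loc}(\mathbb R^n)$, $\|f\|_{\mathfrak L^{q,\infty}(\log\mathfrak L)^\alpha}:=\sup_{s>0}\{[\log(e+1/s)]^\alpha\sup_{|E|=s}\int_E|f|^q\,dx\}^{1/q}$ (sup over Lebesgue measurable $E$ with $|E|=s$); for $q=\infty$ it is $\|f\|_{L^\infty}$. For $\rho>0$, $|||f|||_{q,\alpha;\rho}:=\sup_{z\in\mathbb R^n}\|f\chi_{B(z,\rho)}\|_{\mathfrak L^{q,\infty}(\log\mathfrak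 L)^\alpha}$, and $\mathfrak L^{q,\infty}_{\rm ul}(\log\mathfrak L)^\alpha$ is the space of $f\in L^1_{\rm loc}$ with $\|f\|_{\mathfrak L^{q,\infty}_{\rm ul}(\log\mathfrak L)^\alpha}:=|||f|||_{q,\alpha;1}<\infty$. *)

theory Defs
  imports "HOL-Analysis.Analysis" "HOL-Probability.Essential_Supremum"
begin

text \<open>Fundamental solution of d/dt v + (-Delta)^(theta/2) v = 0, as inverse Fourier transform
  of exp(-t |xi|^theta):  G(x,t) = (2 pi)^(-n) int exp(i x.xi) exp(-t|xi|^theta) dxi
  (the imaginary part vanishes by symmetry, so the cosine is used).\<close>
definition frac_heat_kernel :: "real \<Rightarrow> 'a::euclidean_space \<Rightarrow> real \<Rightarrow> real" where
  "frac_heat_kernel \<theta> x t =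
     (2 * pi) powr (- real DIM('a)) *
     (\<integral>\<xi>. cos (x \<bullet> \<xi>) * exp (- t * norm \<xi> powr \<theta>) \<partial>lebesgue)"

definition frac_semigroup :: "real \<Rightarrow> real \<Rightarrow> ('a::euclidean_space \<Rightarrow> real) \<Rightarrow> 'a \<Rightarrow> real" where
  "frac_semigroup \<theta> t \<phi> x = (\<integral>y. frac_heat_kernel \<theta> (x - y) t * \<phi> y \<partial>lebesgue)"

definition Fp :: "real \<Rightarrow> real \<Rightarrow> real" where
  "Fp p s = \<bar>s\<bar> powr (p - 1) * s"

definition enn_root :: "real \<Rightarrow> ennreal \<Rightarrow> ennreal" where
  "enn_root q x = (if x = \<infinity> then \<infinity> else ennreal (enn2real x powr (1 / q)))"

definition LlogL_norm :: "real \<Rightarrow> real \<Rightarrow> ('a::euclidean_space \<Rightarrow> real) \<Rightarrow> ennreal" where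
  "LlogL_norm q \<alpha> f =
     (SUP s\<in>{0<..}. enn_root q
        (ennreal (ln (exp 1 + 1 / s) powr \<alpha>) *
         (SUP E\<in>{E \<in> sets lebesgue. emeasure lebesgue E = ennreal s}.
            (\<integral>\<^sup>+ x\<in>E. ennreal (\<bar>f x\<bar> powr q) \<partial>lebesgue))))"

definition triple_norm :: "real \<Rightarrow> real \<Rightarrow> real \<Rightarrow> ('a::euclidean_space \<Rightarrow> real) \<Rightarrow> ennreal" where
  "triple_norm q \<alpha> \<rho> f = (SUP z. LlogL_norm q \<alpha> (\<lambda>x. f x * indicator (ball z \<rho>) x))"

definition ul_norm :: "real \<Rightarrow> real \<Rightarrow> ('a::euclidean_space \<Rightarrow> real) \<Rightarrow> ennreal" where
  "ul_norm q \<alpha> f = triple_norm q \<alpha> 1 f"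

definition locally_integrable :: "('a::euclidean_space \<Rightarrow> real) \<Rightarrow> bool" where
  "locally_integrable f \<longleftrightarrow> f \<in> borel_measurable lebesgue \<and>
     (\<forall>K. compact K \<longrightarrow> set_integrable lebesgue K f)"

definition ul_space :: "real \<Rightarrow> real \<Rightarrow> ('a::euclidean_space \<Rightarrow> real) set" where
  "ul_space q \<alpha> = {f. locally_integrable f \<and> ul_norm q \<alpha> f < \<infinity>}"

definition Linf_norm :: "('a::euclidean_space \<Rightarrow> real) \<Rightarrow> ereal" where
  "Linf_norm f = esssup lebesgue (\<lambda>x. ereal \<bar>f x\<bar>)"

definition is_solution ::
  "real \<Rightarrow> real \<Rightarrow> ('a::euclidean_space \<Rightarrow> real) \<Rightarrow> real \<Rightarrow> ('a \<Rightarrow> real \<Rightarrow> real) \<Rightarrow> bool" where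
  "is_solution \<theta> p \<phi> T u \<longleftrightarrow>
     (\<lambda>(x, t). u x t) \<in> borel_measurable (restrict_space lebesgue (UNIV \<times> {0<..<T})) \<and>
     (AE z in (lebesgue :: ('a \<times> real) measure). z \<in> UNIV \<times> {0<..<T} \<longrightarrow>
        (case z of (x, t) \<Rightarrow>
          integrable lebesgue (\<lambda>y. frac_heat_kernel \<theta> (x - y) t * \<phi> y) \<and>
          set_integrable (lebesgue :: ('a \<times> real) measure) (UNIV \<times> {0<..<t})
             (\<lambda>(y, s). frac_heat_kernel \<theta> (x - y) (t - s) * Fp p (u y s)) \<and>
          u x t = frac_semigroup \<theta> t \<phi> x +
             (LINT s:{0<..<t}|lebesgue. frac_semigroup \<theta> (t - s) (\<lambda>y. Fp p (u y s)) x)))"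

definition dir_deriv :: "'a::euclidean_space \<Rightarrow> ('a \<Rightarrow> real) \<Rightarrow> 'a \<Rightarrow> real" where
  "dir_deriv v f x = (THE D. ((\<lambda>h. f (x + h *\<^sub>R v)) has_real_derivative D) (at 0))"

fun iter_pd :: "'a::euclidean_space list \<Rightarrow> ('a \<Rightarrow> real) \<Rightarrow> 'a \<Rightarrow> real" where
  "iter_pd [] f = f"
| "iter_pd (v # vs) f = dir_deriv v (iter_pd vs f)"

definition smooth_fun :: "('a::euclidean_space \<Rightarrow> real) \<Rightarrow> bool" where
  "smooth_fun f \<longleftrightarrow> (\<forall>vs. set vs \<subseteq> Basis \<longrightarrow>
      continuous_on UNIV (iter_pd vs f) \<and>
      (\<forall>v\<in>Basis. \<forall>x. ((\<lambda>h. iter_pd vs f (x + h *\<^sub>R v)) has_real_derivative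
                          iter_pd (v # vs) f x) (at 0)))"

definition test_fun :: "('a::euclidean_space \<Rightarrow> real) \<Rightarrow> bool" where
  "test_fun \<psi> \<longleftrightarrow> smooth_fun \<psi> \<and> compact (closure {x. \<psi> x \<noteq> 0})"

end

theory Submission
  imports Defs "HOL-Probability.Characteristic_Functions" "HOL-Probability.Sinc_Integral"
begin

text \<open>The symbol \<open>exp (- |\<xi>|\<^sup>\<theta>)\<close> is a pointwise limit of nonnegative combinations of Gaussians. Hence the
  kernel is nonnegative and radially decreasing, and its increments in time are dominated by the kernel at a
  comparable time; no further decay of the kernel is needed. With \<open>N = n / \<theta>\<close> and \<open>L(s) = log (e + 1/s)\<close>, data
  of norm \<open>K\<close> satisfy \<open>|S(t)\<phi>| \<le> C K (t L(t))\<^bsup>-N\<^esup>\<close>. If \<open>u(s)\<close> obeys the norm bound and this supremum bound with a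
  constant \<open>K\<close>, then the mass of \<open>|u(s)|\<^bsup>p\<^esup>\<close> on balls of radius \<open>T\<^bsup>1/\<theta>\<^esup>\<close> is at most \<open>C K\<^bsup>p\<^esup> s\<^bsup>-1\<^esup> L(s)\<^bsup>-N-1\<^esup>\<close>, which
  is integrable at \<open>s = 0\<close> with integral of order \<open>L(t)\<^bsup>-N\<^esup>\<close>. The Duhamel term therefore satisfies the same two
  bounds with constant \<open>C K\<^bsup>p\<^esup>\<close>, and Picard iteration converges, at every point, for small \<open>K\<close>. The bound
  \<open>L(t)\<^bsup>-N\<^esup>\<close> on the mass of the Duhamel term also gives both statements about the limit \<open>t \<rightarrow> 0\<close>.\<close>

section \<open>Integration on Euclidean space\<close>

lemma abs_integral_le_nn_integral:
  fixes f :: "'a \<Rightarrow> real"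
  shows "ennreal \<bar>integral\<^sup>L M f\<bar> \<le> (\<integral>\<^sup>+x. ennreal \<bar>f x\<bar> \<partial>M)"
  using integral_norm_bound_ennreal[of M f] by (cases "integrable M f") (auto simp: not_integrable_integral_eq)

lemma nn_integral_lborel_affine:
  fixes t :: "'a::euclidean_space"
  assumes [measurable]: "f \<in> borel_measurable borel" and c: "c \<noteq> 0"
  shows "(\<integral>\<^sup>+x. f x \<partial>lborel) = ennreal (\<bar>c\<bar> ^ DIM('a)) * (\<integral>\<^sup>+x. f (t + c *\<^sub>R x) \<partial>lborel)"
  by (subst lborel_affine[OF c, of t])
     (simp add: nn_integral_density nn_integral_distr nn_integral_cmult)

lemma nn_integral_lborel_translate:
  fixes t :: "'a::euclidean_space"
  assumes [measurable]: "f \<in> borel_measurable borel"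
  shows "(\<integral>\<^sup>+x. f (t + x) \<partial>lborel) = (\<integral>\<^sup>+x. f x \<partial>lborel)"
  using nn_integral_lborel_affine[of f 1 t] by simp

lemma nn_integral_lborel_reflect:
  fixes t :: "'a::euclidean_space"
  assumes [measurable]: "f \<in> borel_measurable borel"
  shows "(\<integral>\<^sup>+x. f (t - x) \<partial>lborel) = (\<integral>\<^sup>+x. f x \<partial>lborel)"
  using nn_integral_lborel_affine[of f "-1" t] by simp

lemma has_bochner_integral_lborel_affine:
  fixes f :: "'a::euclidean_space \<Rightarrow> real"
  assumes f: "has_bochner_integral lborel f I" and c: "c \<noteq> 0"
  shows "has_bochner_integral lborel (\<lambda>x. f (t + c *\<^sub>R x)) (I / \<bar>c\<bar> ^ DIM('a))"
proof -
  have [measurable]: "f \<in> borel_measurable borel"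
    using f by (auto simp: has_bochner_integral_iff)
  have int: "integrable lborel (\<lambda>x. f (t + c *\<^sub>R x))"
    using f c nn_integral_lborel_affine[of "\<lambda>x. ennreal (norm (f x))" c t]
    unfolding has_bochner_integral_iff integrable_iff_bounded by (auto simp: ennreal_mult_less_top)
  have "I = \<bar>c\<bar> ^ DIM('a) * (\<integral>x. f (t + c *\<^sub>R x) \<partial>lborel)"
    unfolding has_bochner_integral_integral_eq[OF f, symmetric]
    by (subst lborel_affine[OF c, of t]) (simp add: integral_density integral_distr)
  with int c show ?thesis
    by (simp add: has_bochner_integral_iff)
qed

lemma integral_lborel_affine:
  fixes f :: "'a::euclidean_space \<Rightarrow> real"
  assumes "integrable lborel f" "c \<noteq> 0"
  shows "(\<integral>x. f (t + c *\<^sub>R x) \<partial>lborel) = (\<integral>x. f x \<partial>lborel) / \<bar>c\<bar> ^ DIM('a)"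
  using has_bochner_integral_lborel_affine[OF has_bochner_integral_integrable] assms
  by (auto simp: has_bochner_integral_iff)

lemma has_bochner_integral_lborel_prod_Basis:
  fixes f :: "'a::euclidean_space \<Rightarrow> real \<Rightarrow> 'b::{real_normed_field, banach, second_countable_topology}"
  assumes f: "\<And>b. b \<in> Basis \<Longrightarrow> has_bochner_integral lborel (f b) (I b)"
  shows "has_bochner_integral lborel (\<lambda>x::'a. \<Prod>b\<in>Basis. f b (x \<bullet> b)) (\<Prod>b\<in>Basis. I b)"
proof -
  interpret product_sigma_finite "\<lambda>_::'a. lborel :: real measure" ..
  have int: "integrable lborel (f b)" "integral\<^sup>L lborel (f b) = I b" if "b \<in> Basis" for b
    using f[OF that] by (auto simp: has_bochner_integral_iff)
  have [measurable]: "f b \<in> borel_measurable borel" if "b \<in> Basis" for b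
    using int(1)[OF that] by (auto dest: borel_measurable_integrable)
  have [measurable]: "(\<lambda>x::'a. \<Prod>b\<in>Basis. f b (x \<bullet> b)) \<in> borel_measurable borel"
    by measurable
  have coordinates: "(\<Prod>b\<in>Basis. f b ((\<Sum>i\<in>Basis. g i *\<^sub>R i) \<bullet> b)) = (\<Prod>b\<in>Basis. f b (g b))" for g
    by (intro prod.cong) auto
  show ?thesis
    unfolding has_bochner_integral_iff
    by (subst (1 2) lborel_eq)
       (simp add: integrable_distr_eq integral_distr coordinates product_integrable_prod product_integral_prod int)
qed

section \<open>The cosine transform\<close>

definition cos_transform :: "('a::euclidean_space \<Rightarrow> real) \<Rightarrow> 'a \<Rightarrow> real" where
  "cos_transform f x = (\<integral>\<xi>. cos (x \<bullet> \<xi>) * f \<xi> \<partial>lborel)"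

lemma borel_measurable_cos_transform [measurable]:
  assumes [measurable]: "f \<in> borel_measurable borel"
  shows "cos_transform f \<in> borel_measurable borel"
  unfolding cos_transform_def by measurable

lemma integrable_cos_mult:
  fixes f :: "'a::euclidean_space \<Rightarrow> real"
  assumes "integrable lborel f"
  shows "integrable lborel (\<lambda>\<xi>. cos (x \<bullet> \<xi>) * f \<xi>)"
  by (rule Bochner_Integration.integrable_bound[OF assms])
     (use assms in \<open>auto simp: abs_mult intro!: mult_left_le_one_le\<close>)

lemma cos_transform_add:
  assumes "integrable lborel f" "integrable lborel g"
  shows "cos_transform (\<lambda>\<xi>. f \<xi> + g \<xi>) x = cos_transform f x + cos_transform g x"
  using assms by (simp add: cos_transform_def distrib_left integrable_cos_mult)

lemma cos_transform_cmult: "cos_transform (\<lambda>\<xi>. c * f \<xi>) x = c * cos_transform f x"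
  unfolding cos_transform_def mult.left_commute[of "cos _" c] by (rule integral_mult_right_zero)

lemma cos_transform_dilate:
  fixes x :: "'a::euclidean_space"
  assumes f: "integrable lborel f" and c: "0 < c"
  shows "cos_transform (\<lambda>\<xi>. f (c *\<^sub>R \<xi>)) x = cos_transform f ((1 / c) *\<^sub>R x) / c ^ DIM('a)"
  using integral_lborel_affine[OF integrable_cos_mult[OF f, of "(1 / c) *\<^sub>R x"], of c 0] c
  by (simp add: cos_transform_def)

lemma cos_transform_tendsto:
  fixes f :: "nat \<Rightarrow> 'a::euclidean_space \<Rightarrow> real"
  assumes [measurable]: "\<And>k. f k \<in> borel_measurable borel" "g \<in> borel_measurable borel"
    and w: "integrable lborel w" "\<And>k \<xi>. \<bar>f k \<xi>\<bar> \<le> w \<xi>" and lim: "\<And>\<xi>. (\<lambda>k. f k \<xi>) \<longlonglongrightarrow> g \<xi>"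
  shows "(\<lambda>k. cos_transform (f k) x) \<longlonglongrightarrow> cos_transform g x"
  unfolding cos_transform_def
proof (rule integral_dominated_convergence)
  show "AE \<xi> in lborel. (\<lambda>k. cos (x \<bullet> \<xi>) * f k \<xi>) \<longlonglongrightarrow> cos (x \<bullet> \<xi>) * g \<xi>"
    by (intro AE_I2 tendsto_mult_left lim)
  have "\<bar>cos (x \<bullet> \<xi>)\<bar> * \<bar>f k \<xi>\<bar> \<le> 1 * w \<xi>" for k \<xi>
    by (intro mult_mono w) auto
  then show "AE \<xi> in lborel. norm (cos (x \<bullet> \<xi>) * f k \<xi>) \<le> w \<xi>" for k
    by (simp add: abs_mult)
qed (use w in auto)

lemma has_bochner_integral_gaussian_Fourier_real:
  assumes s: "0 < s"
  shows "has_bochner_integral lborel (\<lambda>y::real. iexp (a * y) * complex_of_real (exp (- s * y\<^sup>2)))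
    (complex_of_real (sqrt (pi / s) * exp (- a\<^sup>2 / (4 * s))))"
proof -
  define c where "c = sqrt (2 * s)"
  have c: "0 < c" "c \<noteq> 0" "c\<^sup>2 = 2 * s" using s by (auto simp: c_def)
  let ?g = "\<lambda>y. iexp ((a / c) * y) * complex_of_real (std_normal_density y)"
  have "integrable lborel ?g"
    by (rule Bochner_Integration.integrable_bound[OF integrable_normal_density]) (auto simp: norm_mult)
  moreover have "integral\<^sup>L lborel ?g = char std_normal_distribution (a / c)"
    unfolding char_def
    by (subst integral_density) (auto simp: normal_density_nonneg scaleR_conv_of_real mult.commute)
  ultimately have "has_bochner_integral lborel ?g (complex_of_real (exp (- ((a / c)\<^sup>2) / 2)))"
    by (simp add: has_bochner_integral_iff char_std_normal_distribution)
  then have "has_bochner_integral lborel (\<lambda>y. complex_of_real (sqrt (2 * pi)) * ?g (0 + c * y))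
      (complex_of_real (sqrt (2 * pi)) * (complex_of_real (exp (- ((a / c)\<^sup>2) / 2)) /\<^sub>R \<bar>c\<bar>))"
    unfolding lborel_has_bochner_integral_real_affine_iff[OF c(2), of ?g _ 0]
    by (intro has_bochner_integral_mult_right) auto
  moreover have "complex_of_real (sqrt (2 * pi)) * ?g (0 + c * y)
      = iexp (a * y) * complex_of_real (exp (- s * y\<^sup>2))" for y
    using c by (simp add: normal_density_def power_mult_distrib)
  moreover have "complex_of_real (sqrt (2 * pi)) * (complex_of_real (exp (- ((a / c)\<^sup>2) / 2)) /\<^sub>R \<bar>c\<bar>)
      = complex_of_real (sqrt (pi / s) * exp (- a\<^sup>2 / (4 * s)))"
  proof -
    have "sqrt (2 * pi) / c = sqrt (pi / s)" by (simp add: c_def flip: real_sqrt_divide)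
    moreover have "- ((a / c)\<^sup>2) / 2 = - a\<^sup>2 / (4 * s)" using c by (simp add: power_divide)
    moreover have "complex_of_real (sqrt (2 * pi)) * (complex_of_real (exp (- ((a / c)\<^sup>2) / 2)) /\<^sub>R \<bar>c\<bar>)
        = complex_of_real (sqrt (2 * pi) / c * exp (- ((a / c)\<^sup>2) / 2))"
      using c by (simp add: scaleR_conv_of_real field_simps)
    ultimately show ?thesis by simp
  qed
  ultimately show ?thesis by (simp only:)
qed

lemma power2_norm_eq_sum_Basis: "(norm x)\<^sup>2 = (\<Sum>b\<in>Basis. (x \<bullet> b)\<^sup>2)" for x :: "'a::euclidean_space"
  by (subst power2_norm_eq_inner, subst euclidean_inner) (simp add: power2_eq_square)

lemma has_bochner_integral_cos_gaussian:
  fixes x :: "'a::euclidean_space"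
  assumes s: "0 < s"
  shows "has_bochner_integral lborel (\<lambda>\<xi>::'a. cos (x \<bullet> \<xi>) * exp (- s * (norm \<xi>)\<^sup>2))
    (sqrt (pi / s) ^ DIM('a) * exp (- (norm x)\<^sup>2 / (4 * s)))"
proof -
  let ?f = "\<lambda>b y. iexp ((x \<bullet> b) * y) * complex_of_real (exp (- s * y\<^sup>2))"
  let ?I = "\<lambda>b. complex_of_real (sqrt (pi / s) * exp (- (x \<bullet> b)\<^sup>2 / (4 * s)))"
  have "(\<Prod>b\<in>Basis. ?f b (\<xi> \<bullet> b)) = iexp (x \<bullet> \<xi>) * complex_of_real (exp (- s * (norm \<xi>)\<^sup>2))" for \<xi> :: 'a
  proof -
    have "(\<Prod>b\<in>Basis. iexp ((x \<bullet> b) * (\<xi> \<bullet> b))) = iexp (x \<bullet> \<xi>)"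
      by (subst euclidean_inner[of x \<xi>]) (simp add: exp_sum[symmetric] sum_distrib_left)
    moreover have "(\<Prod>b\<in>Basis. complex_of_real (exp (- s * (\<xi> \<bullet> b)\<^sup>2))) = complex_of_real (exp (- s * (norm \<xi>)\<^sup>2))"
      by (simp add: power2_norm_eq_sum_Basis exp_sum[symmetric] sum_distrib_left sum_negf flip: of_real_prod)
    ultimately show ?thesis by (simp add: prod.distrib)
  qed
  moreover have "(\<Prod>b\<in>Basis. ?I b) = complex_of_real (sqrt (pi / s) ^ DIM('a) * exp (- (norm x)\<^sup>2 / (4 * s)))"
    by (simp add: power2_norm_eq_sum_Basis prod.distrib exp_sum[symmetric] sum_negf sum_divide_distrib
        flip: of_real_prod)
  moreover have "has_bochner_integral lborel (\<lambda>\<xi>::'a. \<Prod>b\<in>Basis. ?f b (\<xi> \<bullet> b)) (\<Prod>b\<in>Basis. ?I b)"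
    by (intro has_bochner_integral_lborel_prod_Basis has_bochner_integral_gaussian_Fourier_real s)
  ultimately have "has_bochner_integral lborel (\<lambda>\<xi>::'a. Re (iexp (x \<bullet> \<xi>) * complex_of_real (exp (- s * (norm \<xi>)\<^sup>2))))
      (Re (complex_of_real (sqrt (pi / s) ^ DIM('a) * exp (- (norm x)\<^sup>2 / (4 * s)))))"
    by (intro has_bochner_integral_Re) (simp only:)
  then show ?thesis by (simp add: Re_exp)
qed

lemma cos_transform_gaussian:
  fixes x :: "'a::euclidean_space"
  assumes "0 < s"
  shows "cos_transform (\<lambda>\<xi>. exp (- s * (norm \<xi>)\<^sup>2)) x = sqrt (pi / s) ^ DIM('a) * exp (- (norm x)\<^sup>2 / (4 * s))"
  using has_bochner_integral_cos_gaussian[OF assms, of x] by (simp add: cos_transform_def has_bochner_integral_iff)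

lemma integrable_gaussian: "0 < s \<Longrightarrow> integrable lborel (\<lambda>\<xi>::'a::euclidean_space. exp (- s * (norm \<xi>)\<^sup>2))"
  using has_bochner_integral_cos_gaussian[of s "0::'a"] by (simp add: has_bochner_integral_iff)

lemma integral_gaussian:
  "0 < s \<Longrightarrow> (\<integral>\<xi>. exp (- s * (norm (\<xi>::'a::euclidean_space))\<^sup>2) \<partial>lborel) = sqrt (pi / s) ^ DIM('a)"
  using has_bochner_integral_cos_gaussian[of s "0::'a"] by (simp add: has_bochner_integral_iff)

text \<open>Pairing the transform with a Gaussian of width of order \<open>1 / \<epsilon>\<close> averages \<open>f\<close> over the scale \<open>\<epsilon>\<close>.\<close>

lemma cos_transform_gaussian_pairing:
  fixes f :: "'a::euclidean_space \<Rightarrow> real"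
  assumes f: "integrable lborel f" and \<epsilon>: "0 < \<epsilon>"
  shows "has_bochner_integral lborel (\<lambda>x. cos_transform f x * exp (- (\<epsilon>\<^sup>2 / 4) * (norm x)\<^sup>2))
    ((2 * sqrt pi) ^ DIM('a) * (\<integral>\<eta>. f (\<epsilon> *\<^sub>R \<eta>) * exp (- (norm \<eta>)\<^sup>2) \<partial>lborel))"
proof -
  have [measurable]: "f \<in> borel_measurable borel" using f by simp
  define \<delta> where "\<delta> = \<epsilon>\<^sup>2 / 4"
  have \<delta>: "0 < \<delta>" using \<epsilon> by (simp add: \<delta>_def)
  let ?F = "\<lambda>(x::'a) \<xi>. cos (x \<bullet> \<xi>) * (f \<xi> * exp (- \<delta> * (norm x)\<^sup>2))"
  have "integrable (lborel \<Otimes>\<^sub>M lborel) (\<lambda>(x::'a, \<xi>). exp (- \<delta> * (norm x)\<^sup>2) * f \<xi>)"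
    by (rule lborel_pair.Fubini_integrable)
       (use f integrable_gaussian[OF \<delta>] in \<open>auto simp: abs_mult intro!: integrable_mult_left\<close>)
  then have int: "integrable (lborel \<Otimes>\<^sub>M lborel) (\<lambda>(x, \<xi>). ?F x \<xi>)"
    by (rule Bochner_Integration.integrable_bound)
       (auto simp: abs_mult mult.commute[of "exp _"] split_beta' intro!: AE_I2 mult_left_le_one_le)
  have over_\<xi>: "(\<integral>\<xi>. ?F x \<xi> \<partial>lborel) = cos_transform f x * exp (- \<delta> * (norm x)\<^sup>2)" for x
    by (simp add: cos_transform_def mult.assoc[symmetric])
  have over_x: "(\<integral>x. ?F x \<xi> \<partial>lborel) = sqrt (pi / \<delta>) ^ DIM('a) * (f \<xi> * exp (- (norm \<xi>)\<^sup>2 / (4 * \<delta>)))" for \<xi>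
    using cos_transform_cmult[of "f \<xi>" "\<lambda>x. exp (- \<delta> * (norm x)\<^sup>2)" \<xi>]
    unfolding cos_transform_gaussian[OF \<delta>] by (simp add: cos_transform_def inner_commute mult_ac)
  have int_\<xi>: "integrable lborel (\<lambda>\<xi>. sqrt (pi / \<delta>) ^ DIM('a) * (f \<xi> * exp (- (norm \<xi>)\<^sup>2 / (4 * \<delta>))))"
    using lborel_pair.integrable_snd[OF int] unfolding over_x .
  have "(\<integral>x. cos_transform f x * exp (- \<delta> * (norm x)\<^sup>2) \<partial>lborel)
      = (\<integral>\<xi>. sqrt (pi / \<delta>) ^ DIM('a) * (f \<xi> * exp (- (norm \<xi>)\<^sup>2 / (4 * \<delta>))) \<partial>lborel)"
    using lborel_pair.Fubini_integral[OF int] unfolding over_\<xi> over_x by simp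
  also have "\<dots> = \<epsilon> ^ DIM('a) * (\<integral>\<eta>. sqrt (pi / \<delta>) ^ DIM('a) * (f (\<epsilon> *\<^sub>R \<eta>) * exp (- (norm (\<epsilon> *\<^sub>R \<eta>))\<^sup>2 / (4 * \<delta>))) \<partial>lborel)"
    using integral_lborel_affine[OF int_\<xi>, of \<epsilon> 0] \<epsilon> by simp
  also have "\<dots> = (2 * sqrt pi) ^ DIM('a) * (\<integral>\<eta>. f (\<epsilon> *\<^sub>R \<eta>) * exp (- (norm \<eta>)\<^sup>2) \<partial>lborel)"
    using \<epsilon> by (simp add: \<delta>_def power_mult_distrib real_sqrt_divide real_sqrt_mult power_divide)
  finally show ?thesis
    using lborel_pair.integrable_fst[OF int] unfolding over_\<xi> by (simp add: has_bochner_integral_iff \<delta>_def)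
qed

lemma gaussian_average_tendsto:
  fixes f :: "'a::euclidean_space \<Rightarrow> real"
  assumes [measurable]: "f \<in> borel_measurable borel" and f: "isCont f 0" "\<And>\<xi>. \<bar>f \<xi>\<bar> \<le> B" and \<epsilon>: "\<epsilon> \<longlonglongrightarrow> 0"
  shows "(\<lambda>k::nat. \<integral>\<eta>. f (\<epsilon> k *\<^sub>R \<eta>) * exp (- (norm \<eta>)\<^sup>2) \<partial>lborel) \<longlonglongrightarrow> f 0 * sqrt pi ^ DIM('a)"
proof -
  have "(\<lambda>k. \<integral>\<eta>. f (\<epsilon> k *\<^sub>R \<eta>) * exp (- (norm \<eta>)\<^sup>2) \<partial>lborel) \<longlonglongrightarrow> (\<integral>\<eta>. f 0 * exp (- 1 * (norm (\<eta>::'a))\<^sup>2) \<partial>lborel)"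
  proof (rule integral_dominated_convergence)
    show "integrable lborel (\<lambda>\<eta>::'a. B * exp (- 1 * (norm \<eta>)\<^sup>2))"
      by (intro integrable_mult_right integrable_gaussian) simp
    show "AE \<eta> in lborel. norm (f (\<epsilon> k *\<^sub>R \<eta>) * exp (- (norm \<eta>)\<^sup>2)) \<le> B * exp (- 1 * (norm \<eta>)\<^sup>2)" for k
      using f(2) by (auto simp: abs_mult intro!: AE_I2 mult_right_mono)
    have "(\<lambda>k. f (\<epsilon> k *\<^sub>R \<eta>)) \<longlonglongrightarrow> f 0" for \<eta>
      using tendsto_scaleR[OF \<epsilon> tendsto_const[of \<eta>]] by (intro isCont_tendsto_compose[OF f(1)]) simp
    then show "AE \<eta> in lborel. (\<lambda>k. f (\<epsilon> k *\<^sub>R \<eta>) * exp (- (norm \<eta>)\<^sup>2)) \<longlonglongrightarrow> f 0 * exp (- 1 * (norm \<eta>)\<^sup>2)"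
      by (auto intro!: AE_I2 tendsto_mult_right)
  qed measurable
  also have "(\<integral>\<eta>. f 0 * exp (- 1 * (norm (\<eta>::'a))\<^sup>2) \<partial>lborel) = f 0 * sqrt pi ^ DIM('a)"
    using integral_gaussian[of 1, where 'a = 'a] by simp
  finally show ?thesis .
qed

lemma cos_transform_inversion_at_0:
  fixes f :: "'a::euclidean_space \<Rightarrow> real"
  assumes f: "integrable lborel f" "isCont f 0" and bound: "\<And>\<xi>. \<bar>f \<xi>\<bar> \<le> B"
    and nonneg: "\<And>x. 0 \<le> cos_transform f x"
  shows "has_bochner_integral lborel (cos_transform f) ((2 * pi) ^ DIM('a) * f 0)"
proof -
  have f_borel[measurable]: "f \<in> borel_measurable borel" using f by simp
  define \<epsilon> where "\<epsilon> k = 1 / real (Suc k)" for k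
  have \<epsilon>: "0 < \<epsilon> k" "\<epsilon> \<longlonglongrightarrow> 0" for k
    using LIMSEQ_Suc[OF lim_1_over_n] by (simp_all add: \<epsilon>_def[abs_def])
  have \<epsilon>_antimono: "\<epsilon> k \<le> \<epsilon> m" if "m \<le> k" for m k
    using that by (simp add: \<epsilon>_def frac_le)
  let ?g = "\<lambda>k x. cos_transform f x * exp (- ((\<epsilon> k)\<^sup>2 / 4) * (norm x)\<^sup>2)"
  note g = cos_transform_gaussian_pairing[OF f(1) \<epsilon>(1), unfolded has_bochner_integral_iff]
  have mono: "AE x in lborel. mono (\<lambda>k. ?g k x)"
    using nonneg less_imp_le[OF \<epsilon>(1)] \<epsilon>_antimono
    by (intro AE_I2 monoI mult_left_mono) (auto intro!: mult_right_mono power_mono)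
  have lim: "AE x in lborel. (\<lambda>k. ?g k x) \<longlonglongrightarrow> cos_transform f x"
  proof (rule AE_I2)
    fix x
    have "(\<lambda>k. ?g k x) \<longlonglongrightarrow> cos_transform f x * exp (- (0\<^sup>2 / 4) * (norm x)\<^sup>2)"
      by (intro tendsto_intros \<epsilon>(2)) simp
    then show "(\<lambda>k. ?g k x) \<longlonglongrightarrow> cos_transform f x" by simp
  qed
  have "(\<lambda>k. integral\<^sup>L lborel (?g k)) \<longlonglongrightarrow> (2 * sqrt pi) ^ DIM('a) * (f 0 * sqrt pi ^ DIM('a))"
    unfolding g[THEN conjunct2] by (rule tendsto_mult_left[OF gaussian_average_tendsto[OF f_borel f(2) bound \<epsilon>(2)]])
  also have "(2 * sqrt pi) ^ DIM('a) * (f 0 * sqrt pi ^ DIM('a)) = (2 * sqrt pi * sqrt pi) ^ DIM('a) * f 0"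
    by (simp only: power_mult_distrib mult_ac)
  also have "2 * sqrt pi * sqrt pi = 2 * pi" by simp
  finally have lim_integral: "(\<lambda>k. integral\<^sup>L lborel (?g k)) \<longlonglongrightarrow> (2 * pi) ^ DIM('a) * f 0" .
  show ?thesis
    using integrable_monotone_convergence[OF g[THEN conjunct1] mono lim lim_integral]
      integral_monotone_convergence[OF g[THEN conjunct1] mono lim lim_integral]
    by (simp add: has_bochner_integral_iff)
qed

section \<open>Mixtures of exponentials\<close>

inductive exponential_mixture :: "(real \<Rightarrow> real) \<Rightarrow> bool" where
  exp: "0 \<le> s \<Longrightarrow> exponential_mixture (\<lambda>l. exp (- s * l))"
| add: "exponential_mixture f \<Longrightarrow> exponential_mixture g \<Longrightarrow> exponential_mixture (\<lambda>l. f l + g l)"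
| cmult: "0 \<le> c \<Longrightarrow> exponential_mixture f \<Longrightarrow> exponential_mixture (\<lambda>l. c * f l)"
| lim: "(\<And>k::nat. exponential_mixture (f k)) \<Longrightarrow> (\<And>k. f k 0 \<le> B) \<Longrightarrow>
    (\<And>l. 0 \<le> l \<Longrightarrow> (\<lambda>k. f k l) \<longlonglongrightarrow> g l) \<Longrightarrow> exponential_mixture g"

lemma exponential_mixture_bounds:
  assumes "exponential_mixture f" "0 \<le> l"
  shows "0 \<le> f l \<and> f l \<le> f 0"
  using assms
proof (induction rule: exponential_mixture.induct)
  case (lim f B g)
  have "0 \<le> g l" using lim by (intro LIMSEQ_le_const[of "\<lambda>k. f k l"]) auto
  moreover have "g l \<le> g 0" using lim by (intro LIMSEQ_le[of "\<lambda>k. f k l" _ "\<lambda>k. f k 0"]) auto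
  ultimately show ?case ..
qed (auto intro: mult_left_mono add_mono add_nonneg_nonneg)

lemma exponential_mixture_mult:
  assumes f: "exponential_mixture f" and g: "exponential_mixture g"
  shows "exponential_mixture (\<lambda>l. f l * g l)"
  using f
proof (induction rule: exponential_mixture.induct)
  case (exp s)
  show ?case using g
  proof (induction rule: exponential_mixture.induct)
    case (exp r)
    have "(\<lambda>l. exp (- s * l) * exp (- r * l)) = (\<lambda>l. exp (- (s + r) * l))"
      by (simp add: algebra_simps flip: exp_add)
    then show ?case
      using exponential_mixture.exp[of "s + r"] \<open>0 \<le> s\<close> exp by simp
  next
    case (lim f B g)
    show ?case
      by (rule exponential_mixture.lim[of "\<lambda>k l. exp (- s * l) * f k l" B])
         (use lim.IH lim.hyps(2,3) in \<open>auto intro: tendsto_mult_left\<close>)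
  qed (simp_all add: distrib_left mult.left_commute exponential_mixture.add exponential_mixture.cmult)
next
  case (lim f B h)
  show ?case
  proof (rule exponential_mixture.lim[of "\<lambda>k l. f k l * g l" "B * g 0"])
    show "f k 0 * g 0 \<le> B * g 0" for k
      using lim.hyps(2)[of k] exponential_mixture_bounds[OF g, of 0] by (intro mult_right_mono) auto
  qed (use lim.IH lim.hyps(3) in \<open>auto intro: tendsto_mult_right\<close>)
qed (simp_all add: distrib_right mult.assoc exponential_mixture.add exponential_mixture.cmult)

lemma exponential_mixture_power: "exponential_mixture f \<Longrightarrow> exponential_mixture (\<lambda>l. f l ^ m)"
  using exponential_mixture.exp[of 0] by (induction m) (auto intro: exponential_mixture_mult)

lemma exponential_mixture_power_series:
  assumes f: "exponential_mixture f" and a: "\<And>j. 0 \<le> a j"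
    and sums: "\<And>l. 0 \<le> l \<Longrightarrow> (\<lambda>j. a j * f l ^ j) sums g l"
  shows "exponential_mixture g"
proof (rule exponential_mixture.lim)
  show "exponential_mixture (\<lambda>l. \<Sum>j<J. a j * f l ^ j)" for J
  proof (induction J)
    case 0
    then show ?case using exponential_mixture.cmult[OF order_refl exponential_mixture.exp[of 0]] by simp
  next
    case (Suc J)
    then show ?case by (simp add: exponential_mixture.add exponential_mixture.cmult exponential_mixture_power a f)
  qed
  show "(\<Sum>j<J. a j * f 0 ^ j) \<le> g 0" for J
    unfolding sums_unique[OF sums[OF order_refl]]
    using sums[of 0] a exponential_mixture_bounds[OF f, of 0] by (intro sum_le_suminf) (auto simp: sums_iff)
  show "(\<lambda>J. \<Sum>j<J. a j * f l ^ j) \<longlonglongrightarrow> g l" if "0 \<le> l" for l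
    using sums[OF that] by (simp add: sums_def)
qed

lemma exponential_mixture_exp:
  assumes "exponential_mixture f"
  shows "exponential_mixture (\<lambda>l. exp (f l))"
  by (rule exponential_mixture_power_series[OF assms, of "\<lambda>j. 1 / fact j"])
     (use exp_converges[of "f _"] in \<open>auto simp: divide_inverse mult.commute\<close>)

lemma minus_gbinomial_mult_neg_one_power_nonneg:
  fixes \<alpha> :: real
  assumes "0 \<le> \<alpha>" "\<alpha> \<le> 1" "0 < j"
  shows "0 \<le> - ((\<alpha> gchoose j) * (- 1) ^ j)"
proof -
  obtain m where j: "j = Suc m" using assms(3) gr0_implies_Suc by blast
  have "(\<alpha> gchoose j) * (- 1) ^ j = pochhammer (- \<alpha>) j / fact j"
    by (simp add: gbinomial_pochhammer)
  also have "pochhammer (- \<alpha>) j = - (\<alpha> * pochhammer (1 - \<alpha>) m)"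
    by (simp add: j pochhammer_rec algebra_simps)
  finally have "- ((\<alpha> gchoose j) * (- 1) ^ j) = \<alpha> * pochhammer (1 - \<alpha>) m / fact j"
    by simp
  moreover have "0 \<le> pochhammer (1 - \<alpha>) m"
    using assms by (auto simp: pochhammer_prod intro!: prod_nonneg)
  ultimately show ?thesis using assms by simp
qed

lemma exponential_mixture_one_minus_powr:
  assumes f: "exponential_mixture f" "f 0 < 1" and \<alpha>: "0 \<le> \<alpha>" "\<alpha> \<le> 1"
  shows "exponential_mixture (\<lambda>l. 1 - (1 - f l) powr \<alpha>)"
proof (rule exponential_mixture_power_series[OF f(1)])
  define a where "a j = (if j = 0 then 0 else - ((\<alpha> gchoose j) * (- 1) ^ j))" for j :: nat
  show "0 \<le> a j" for j
    using minus_gbinomial_mult_neg_one_power_nonneg[OF \<alpha>, of j] by (auto simp: a_def)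
  show "(\<lambda>j. a j * f l ^ j) sums (1 - (1 - f l) powr \<alpha>)" if "0 \<le> l" for l
  proof -
    have "0 \<le> f l" "f l < 1" using exponential_mixture_bounds[OF f(1) that] f(2) by auto
    then have "(\<lambda>j. (\<alpha> gchoose j) * (- f l) ^ j) sums (1 + - f l) powr \<alpha>"
      by (intro gen_binomial_real) auto
    from sums_diff[OF sums_single[of 0 "\<lambda>_. 1::real"] this]
    have "(\<lambda>j. (if j = 0 then 1 else 0) - (\<alpha> gchoose j) * (- f l) ^ j) sums (1 - (1 - f l) powr \<alpha>)"
      by simp
    moreover have "(if j = 0 then 1 else 0) - (\<alpha> gchoose j) * (- f l) ^ j = a j * f l ^ j" for j
      by (auto simp: a_def power_minus[of "f l"])
    ultimately show ?thesis by simp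
  qed
qed

text \<open>\<open>l\<^sup>\<alpha>\<close> is the limit of \<open>((1 - exp (- h (l + h))) / h)\<^sup>\<alpha>\<close> as \<open>h \<rightarrow> 0\<close>, and \<open>1 - (1 - z)\<^sup>\<alpha>\<close> is a power
  series in \<open>z\<close> with nonnegative coefficients. The extra \<open>h\<close> keeps \<open>z = exp (- h (l + h))\<close> below 1 at \<open>l = 0\<close>.\<close>

lemma exponential_mixture_exp_minus_quotient_powr:
  assumes h: "0 < h" and \<alpha>: "0 < \<alpha>" "\<alpha> \<le> 1"
  shows "exponential_mixture (\<lambda>l. exp (- (((1 - exp (- h * (l + h))) / h) powr \<alpha>)))"
proof -
  define c where "c = (1 / h) powr \<alpha>"
  let ?m = "\<lambda>l. c * (1 - (1 - exp (- h\<^sup>2) * exp (- h * l)) powr \<alpha>)"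
  have "exponential_mixture (\<lambda>l. exp (- h\<^sup>2) * exp (- h * l))"
    using h by (intro exponential_mixture.intros) auto
  then have "exponential_mixture (\<lambda>l. 1 - (1 - exp (- h\<^sup>2) * exp (- h * l)) powr \<alpha>)"
    using h \<alpha> by (intro exponential_mixture_one_minus_powr) auto
  from exponential_mixture.cmult[OF _ exponential_mixture_exp[OF exponential_mixture.cmult[OF _ this]],
      of "exp (- c)" c]
  have "exponential_mixture (\<lambda>l. exp (- c) * exp (?m l))" by (simp add: c_def)
  moreover have "exp (- c) * exp (?m l) = exp (- (((1 - exp (- h * (l + h))) / h) powr \<alpha>))" for l
  proof -
    have "exp (- h\<^sup>2) * exp (- h * l) = exp (- h * (l + h))"
      by (simp add: power2_eq_square algebra_simps flip: exp_add)
    moreover have "((1 - exp (- h * (l + h))) / h) powr \<alpha> = c * (1 - exp (- h * (l + h))) powr \<alpha>"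
      by (simp add: c_def flip: powr_mult)
    ultimately show ?thesis by (simp add: algebra_simps flip: exp_add)
  qed
  ultimately show ?thesis by simp
qed

lemma exponential_mixture_exp_minus_powr:
  assumes \<alpha>: "0 < \<alpha>" "\<alpha> \<le> 1"
  shows "exponential_mixture (\<lambda>l. exp (- (l powr \<alpha>)))"
proof (rule exponential_mixture.lim)
  let ?d = "\<lambda>h l. (1 - exp (- h * (l + h))) / h"
  let ?h = "\<lambda>k. 1 / real (Suc k)"
  show "exponential_mixture (\<lambda>l. exp (- (?d (?h k) l powr \<alpha>)))" for k
    by (rule exponential_mixture_exp_minus_quotient_powr[OF _ \<alpha>]) simp
  show "exp (- (?d (?h k) 0 powr \<alpha>)) \<le> 1" for k by simp
  show "(\<lambda>k. exp (- (?d (?h k) l powr \<alpha>))) \<longlonglongrightarrow> exp (- (l powr \<alpha>))" if l: "0 \<le> l" for l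
  proof -
    have "((\<lambda>h. 1 - exp (- h * (l + h))) has_real_derivative l) (at 0)"
      by (auto intro!: derivative_eq_intros)
    then have "((\<lambda>h. ?d h l) \<longlongrightarrow> l) (at 0)"
      by (simp add: has_field_derivative_iff)
    moreover have "filterlim ?h (at 0) sequentially"
      using LIMSEQ_Suc[OF lim_1_over_n] by (simp add: filterlim_at)
    ultimately have "(\<lambda>k. ?d (?h k) l) \<longlonglongrightarrow> l" by (rule filterlim_compose)
    then show ?thesis
      using l \<alpha> by (intro tendsto_intros tendsto_powr')
        (auto intro!: always_eventually divide_nonneg_pos mult_nonneg_nonneg)
  qed
qed

section \<open>Radially decreasing functions and their dilations\<close>

text \<open>The second condition is inherited from Gaussians. For a self-similar kernel it controls the increments in
  time by the kernel itself, in place of a bound on the time derivative.\<close>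

definition radial_cone :: "('a::euclidean_space \<Rightarrow> real) \<Rightarrow> bool" where
  "radial_cone K \<longleftrightarrow> (\<forall>x y. norm x \<le> norm y \<longrightarrow> 0 \<le> K y \<and> K y \<le> K x) \<and>
     (\<forall>x q. 1 \<le> q \<longrightarrow> K x - K (q *\<^sub>R x) \<le> 2 * (q\<^sup>2 - 1) * K ((1 / sqrt 2) *\<^sub>R x))"

lemma radial_cone_nonneg: "radial_cone K \<Longrightarrow> 0 \<le> K x"
  unfolding radial_cone_def by blast

lemma radial_cone_antimono: "radial_cone K \<Longrightarrow> norm x \<le> norm y \<Longrightarrow> K y \<le> K x"
  unfolding radial_cone_def by blast

lemma radial_cone_dilate:
  "radial_cone K \<Longrightarrow> 1 \<le> q \<Longrightarrow> K x - K (q *\<^sub>R x) \<le> 2 * (q\<^sup>2 - 1) * K ((1 / sqrt 2) *\<^sub>R x)"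
  unfolding radial_cone_def by blast

lemma radial_cone_gaussian:
  assumes "0 < s"
  shows "radial_cone (\<lambda>x::'a::euclidean_space. exp (- (norm x)\<^sup>2 / (4 * s)))"
  unfolding radial_cone_def
proof (intro conjI allI impI)
  fix x y :: 'a assume "norm x \<le> norm y"
  then have "(norm x)\<^sup>2 \<le> (norm y)\<^sup>2" by (intro power_mono) auto
  then show "exp (- (norm y)\<^sup>2 / (4 * s)) \<le> exp (- (norm x)\<^sup>2 / (4 * s))"
    using assms by (simp add: divide_right_mono)
next
  fix x :: 'a and q :: real assume q: "1 \<le> q"
  define a where "a = (norm x)\<^sup>2 / (4 * s)"
  define h where "h = q\<^sup>2 - 1"
  have a: "0 \<le> a" and h: "0 \<le> h" using assms q by (auto simp: a_def h_def)
  have "exp (- a) - exp (- (q\<^sup>2 * a)) = exp (- a) * (1 - exp (- (h * a)))"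
    by (simp add: h_def algebra_simps flip: exp_add)
  also have "\<dots> \<le> exp (- a) * (h * a)"
    using exp_ge_add_one_self[of "- (h * a)"] by (intro mult_left_mono) auto
  also have "\<dots> = 2 * h * ((a / 2 * exp (- (a / 2))) * exp (- (a / 2)))"
    by (simp add: field_simps flip: exp_add)
  also have "\<dots> \<le> 2 * h * (1 * exp (- (a / 2)))"
  proof (intro mult_left_mono mult_right_mono)
    show "a / 2 * exp (- (a / 2)) \<le> 1"
      using exp_ge_add_one_self[of "a / 2"] by (simp add: exp_minus field_simps)
  qed (use h in auto)
  finally show "exp (- (norm x)\<^sup>2 / (4 * s)) - exp (- (norm (q *\<^sub>R x))\<^sup>2 / (4 * s))
      \<le> 2 * (q\<^sup>2 - 1) * exp (- (norm ((1 / sqrt 2) *\<^sub>R x))\<^sup>2 / (4 * s))"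
    by (simp add: a_def h_def power_mult_distrib power_divide mult.commute)
qed auto

lemma radial_cone_add:
  assumes "radial_cone K" "radial_cone K'"
  shows "radial_cone (\<lambda>x. K x + K' x)"
proof -
  have "K x + K' x - (K (q *\<^sub>R x) + K' (q *\<^sub>R x))
      \<le> 2 * (q\<^sup>2 - 1) * (K ((1 / sqrt 2) *\<^sub>R x) + K' ((1 / sqrt 2) *\<^sub>R x))"
    if "1 \<le> q" for q x
    using radial_cone_dilate[OF assms(1) that, of x] radial_cone_dilate[OF assms(2) that, of x]
    by (simp add: distrib_left)
  then show ?thesis
    using assms by (auto simp: radial_cone_def intro: add_mono)
qed

lemma radial_cone_cmult:
  assumes "radial_cone K" "0 \<le> c"
  shows "radial_cone (\<lambda>x. c * K x)"
proof -
  have "c * K x - c * K (q *\<^sub>R x) \<le> 2 * (q\<^sup>2 - 1) * (c * K ((1 / sqrt 2) *\<^sub>R x))" if "1 \<le> q" for q x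
    using mult_left_mono[OF radial_cone_dilate[OF assms(1) that, of x] assms(2)] by (simp add: algebra_simps)
  then show ?thesis
    using assms by (auto simp: radial_cone_def intro!: mult_left_mono)
qed

lemma radial_cone_lim:
  fixes K :: "nat \<Rightarrow> 'a::euclidean_space \<Rightarrow> real"
  assumes K: "\<And>k. radial_cone (K k)" and lim: "\<And>x. (\<lambda>k. K k x) \<longlonglongrightarrow> K' x"
  shows "radial_cone K'"
  unfolding radial_cone_def
proof (intro conjI allI impI)
  fix x y :: 'a assume xy: "norm x \<le> norm y"
  show "0 \<le> K' y" by (intro LIMSEQ_le_const[OF lim] exI allI impI radial_cone_nonneg[OF K])
  show "K' y \<le> K' x" by (intro LIMSEQ_le[OF lim lim] exI allI impI radial_cone_antimono[OF K] xy)
next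
  fix x :: 'a and q :: real assume "1 \<le> q"
  then show "K' x - K' (q *\<^sub>R x) \<le> 2 * (q\<^sup>2 - 1) * K' ((1 / sqrt 2) *\<^sub>R x)"
    by (intro LIMSEQ_le[OF tendsto_diff[OF lim lim] tendsto_mult_left[OF lim]] exI allI impI
        radial_cone_dilate[OF K])
qed

lemma borel_measurable_exponential_mixture_norm:
  assumes "exponential_mixture f"
  shows "(\<lambda>\<xi>::'a::euclidean_space. f ((norm \<xi>)\<^sup>2)) \<in> borel_measurable borel"
  using assms
proof (induction rule: exponential_mixture.induct)
  case (lim f B g)
  show ?case
    by (rule borel_measurable_LIMSEQ_real[of _ "\<lambda>k \<xi>. f k ((norm \<xi>)\<^sup>2)"]) (simp_all add: lim)
qed simp_all

lemma integrable_exponential_mixture_gaussian: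
  assumes f: "exponential_mixture f" and \<delta>: "0 < \<delta>"
  shows "integrable lborel (\<lambda>\<xi>::'a::euclidean_space. f ((norm \<xi>)\<^sup>2) * exp (- \<delta> * (norm \<xi>)\<^sup>2))"
proof (rule Bochner_Integration.integrable_bound)
  show "integrable lborel (\<lambda>\<xi>::'a. f 0 * exp (- \<delta> * (norm \<xi>)\<^sup>2))"
    by (intro integrable_mult_right integrable_gaussian \<delta>)
  show "AE \<xi>::'a in lborel. norm (f ((norm \<xi>)\<^sup>2) * exp (- \<delta> * (norm \<xi>)\<^sup>2)) \<le> norm (f 0 * exp (- \<delta> * (norm \<xi>)\<^sup>2))"
  proof (rule AE_I2)
    fix \<xi> :: 'a
    have "\<bar>f ((norm \<xi>)\<^sup>2)\<bar> \<le> \<bar>f 0\<bar>"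
      using exponential_mixture_bounds[OF f, of "(norm \<xi>)\<^sup>2"] by simp
    then show "norm (f ((norm \<xi>)\<^sup>2) * exp (- \<delta> * (norm \<xi>)\<^sup>2)) \<le> norm (f 0 * exp (- \<delta> * (norm \<xi>)\<^sup>2))"
      by (simp add: abs_mult mult_right_mono)
  qed
qed (use borel_measurable_exponential_mixture_norm[OF f] in measurable)

lemma cos_transform_exponential_mixture_gaussian_tendsto:
  fixes x :: "'a::euclidean_space"
  assumes f: "\<And>k::nat. exponential_mixture (f k)" "\<And>k. f k 0 \<le> B" "\<And>l. 0 \<le> l \<Longrightarrow> (\<lambda>k. f k l) \<longlonglongrightarrow> g l" and \<delta>: "0 < \<delta>"
  shows "(\<lambda>k. cos_transform (\<lambda>\<xi>. f k ((norm \<xi>)\<^sup>2) * exp (- \<delta> * (norm \<xi>)\<^sup>2)) x)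
    \<longlonglongrightarrow> cos_transform (\<lambda>\<xi>. g ((norm \<xi>)\<^sup>2) * exp (- \<delta> * (norm \<xi>)\<^sup>2)) x"
proof (rule cos_transform_tendsto)
  have [measurable]: "(\<lambda>\<xi>::'a. f k ((norm \<xi>)\<^sup>2)) \<in> borel_measurable borel"
    "(\<lambda>\<xi>::'a. g ((norm \<xi>)\<^sup>2)) \<in> borel_measurable borel" for k
    using f exponential_mixture.lim[of f B g] by (auto intro: borel_measurable_exponential_mixture_norm)
  show "(\<lambda>\<xi>::'a. f k ((norm \<xi>)\<^sup>2) * exp (- \<delta> * (norm \<xi>)\<^sup>2)) \<in> borel_measurable borel"
    "(\<lambda>\<xi>::'a. g ((norm \<xi>)\<^sup>2) * exp (- \<delta> * (norm \<xi>)\<^sup>2)) \<in> borel_measurable borel" for k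
    by measurable
  show "integrable lborel (\<lambda>\<xi>::'a. B * exp (- \<delta> * (norm \<xi>)\<^sup>2))"
    by (intro integrable_mult_right integrable_gaussian \<delta>)
  have "0 \<le> f k l \<and> f k l \<le> B" if "0 \<le> l" for k l
    using exponential_mixture_bounds[OF f(1) that, of k] f(2)[of k] by auto
  then show "\<bar>f k ((norm \<xi>)\<^sup>2) * exp (- \<delta> * (norm \<xi>)\<^sup>2)\<bar> \<le> B * exp (- \<delta> * (norm \<xi>)\<^sup>2)" for k and \<xi> :: 'a
    by (auto simp: abs_mult intro!: mult_right_mono)
qed (use f(3) in \<open>auto intro: tendsto_mult_right\<close>)

lemma radial_cone_cos_transform_exponential_mixture_gaussian:
  assumes f: "exponential_mixture f" and \<delta>: "0 < \<delta>"
  shows "radial_cone (cos_transform (\<lambda>\<xi>::'a::euclidean_space. f ((norm \<xi>)\<^sup>2) * exp (- \<delta> * (norm \<xi>)\<^sup>2)))"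
  using f
proof (induction rule: exponential_mixture.induct)
  case (exp s)
  then have s: "0 < s + \<delta>" using \<delta> by simp
  have product: "exp (- s * (norm \<xi>)\<^sup>2) * exp (- \<delta> * (norm \<xi>)\<^sup>2) = exp (- (s + \<delta>) * (norm \<xi>)\<^sup>2)" for \<xi> :: 'a
    by (simp add: algebra_simps flip: exp_add)
  show ?case
    unfolding product cos_transform_gaussian[OF s, abs_def]
    using s by (intro radial_cone_cmult radial_cone_gaussian) auto
next
  case (add f g)
  have "cos_transform (\<lambda>\<xi>::'a. (f ((norm \<xi>)\<^sup>2) + g ((norm \<xi>)\<^sup>2)) * exp (- \<delta> * (norm \<xi>)\<^sup>2)) =
    (\<lambda>x. cos_transform (\<lambda>\<xi>. f ((norm \<xi>)\<^sup>2) * exp (- \<delta> * (norm \<xi>)\<^sup>2)) x +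
         cos_transform (\<lambda>\<xi>. g ((norm \<xi>)\<^sup>2) * exp (- \<delta> * (norm \<xi>)\<^sup>2)) x)"
    unfolding distrib_right
    by (intro ext cos_transform_add integrable_exponential_mixture_gaussian add \<delta>)
  then show ?case using add by (simp add: radial_cone_add)
next
  case (cmult c f)
  have "cos_transform (\<lambda>\<xi>::'a. c * f ((norm \<xi>)\<^sup>2) * exp (- \<delta> * (norm \<xi>)\<^sup>2)) =
    (\<lambda>x. c * cos_transform (\<lambda>\<xi>. f ((norm \<xi>)\<^sup>2) * exp (- \<delta> * (norm \<xi>)\<^sup>2)) x)"
    unfolding mult.assoc by (intro ext cos_transform_cmult)
  then show ?case using cmult by (simp add: radial_cone_cmult)
next
  case (lim f B g)
  show ?case
    by (rule radial_cone_lim[OF lim.IH cos_transform_exponential_mixture_gaussian_tendsto[OF lim.hyps \<delta>]])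
qed

section \<open>The fractional heat kernel at time one\<close>

lemma power_div_fact_le_exp:
  fixes x :: real
  assumes "0 \<le> x"
  shows "x ^ m / fact m \<le> exp x"
proof -
  have "(\<Sum>j\<in>{m}. x ^ j /\<^sub>R fact j) \<le> (\<Sum>j. x ^ j /\<^sub>R fact j)"
    using assms by (intro sum_le_suminf summable_exp_generic) auto
  then show ?thesis by (simp add: exp_def divide_inverse mult.commute)
qed

lemma integrable_exp_abs_powr:
  fixes c \<theta> :: real
  assumes c: "0 < c" and \<theta>: "0 < \<theta>"
  shows "integrable lborel (\<lambda>y::real. exp (- c * \<bar>y\<bar> powr \<theta>))"
proof -
  obtain m :: nat where m: "2 \<le> real m * \<theta>"
    using reals_Archimedean3[OF \<theta>] by (meson less_imp_le)
  define C where "C = 1 + fact m / c ^ m"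
  have C: "1 \<le> C" "fact m / c ^ m \<le> C" using c by (auto simp: C_def)
  have decay: "exp (- c * \<bar>y\<bar> powr \<theta>) \<le> C * (2 * inverse (1 + y\<^sup>2))" for y
  proof (cases "\<bar>y\<bar> \<le> 1")
    case True
    then have "1 + y\<^sup>2 \<le> 2" by (simp add: abs_square_le_1)
    then have "1 \<le> 2 * inverse (1 + y\<^sup>2)" by (simp add: field_simps add_pos_nonneg)
    moreover have "exp (- c * \<bar>y\<bar> powr \<theta>) \<le> 1" using c by simp
    ultimately show ?thesis using C(1) mult_mono[of 1 C 1 "2 * inverse (1 + y\<^sup>2)"] by linarith
  next
    case False
    define v where "v = c * \<bar>y\<bar> powr \<theta>"
    have y: "1 < \<bar>y\<bar>" and v: "0 < v" using False c by (auto simp: v_def)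
    have "exp (- v) \<le> fact m / v ^ m"
      using power_div_fact_le_exp[of v m] v by (simp add: exp_minus field_simps)
    also have "v ^ m = c ^ m * \<bar>y\<bar> powr (\<theta> * m)"
      using y by (simp add: v_def power_mult_distrib powr_powr flip: powr_realpow)
    also have "fact m / (c ^ m * \<bar>y\<bar> powr (\<theta> * m)) \<le> fact m / (c ^ m * \<bar>y\<bar> powr 2)"
      using y c m by (intro divide_left_mono mult_left_mono powr_mono) (auto simp: mult.commute)
    also have "\<dots> \<le> C * inverse (y\<^sup>2)"
      using mult_right_mono[OF C(2), of "inverse (y\<^sup>2)"] y by (simp add: divide_inverse mult.assoc)
    also have "inverse (y\<^sup>2) \<le> 2 * inverse (1 + y\<^sup>2)"
    proof -
      have "1 < y\<^sup>2" using one_less_power[OF y, of 2] by simp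
      then have "1 / y\<^sup>2 \<le> 2 / (1 + y\<^sup>2)" by (subst frac_le_eq) (auto simp: divide_le_0_iff)
      then show ?thesis by (simp add: divide_inverse)
    qed
    finally show ?thesis using C(1) by (simp add: v_def mult_left_mono)
  qed
  show ?thesis
  proof (rule Bochner_Integration.integrable_bound)
    show "integrable lborel (\<lambda>y. C * (2 * inverse (1 + y\<^sup>2)))"
      using integrable_inverse_1_plus_square by (simp add: set_integrable_def)
  qed (use decay in \<open>auto intro!: order_trans[OF _ abs_ge_self]\<close>)
qed

lemma integrable_exp_norm_powr:
  assumes "0 < \<theta>" and "0 < t"
  shows "integrable lborel (\<lambda>\<xi>::'a::euclidean_space. exp (- t * norm \<xi> powr \<theta>))"
proof -
  let ?c = "t / DIM('a)"
  have "integrable lborel (\<lambda>\<xi>::'a. \<Prod>b\<in>Basis. exp (- ?c * \<bar>\<xi> \<bullet> b\<bar> powr \<theta>))"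
    using has_bochner_integral_lborel_prod_Basis[OF
          has_bochner_integral_integrable[OF integrable_exp_abs_powr[of ?c \<theta>]]]
      assms by (auto simp: has_bochner_integral_iff)
  then show ?thesis
  proof (rule Bochner_Integration.integrable_bound)
    have "(\<Sum>b\<in>Basis. ?c * \<bar>\<xi> \<bullet> b\<bar> powr \<theta>) \<le> t * norm \<xi> powr \<theta>" for \<xi> :: 'a
    proof -
      have "(\<Sum>b\<in>Basis. ?c * \<bar>\<xi> \<bullet> b\<bar> powr \<theta>) \<le> (\<Sum>b\<in>(Basis::'a set). ?c * norm \<xi> powr \<theta>)"
        using assms by (intro sum_mono mult_left_mono powr_mono2 Basis_le_norm) auto
      then show ?thesis by simp
    qed
    then have "exp (- t * norm \<xi> powr \<theta>) \<le> (\<Prod>b\<in>Basis. exp (- ?c * \<bar>\<xi> \<bullet> b\<bar> powr \<theta>))" for \<xi> :: 'a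
      by (simp add: exp_sum[symmetric] sum_negf)
    then show "AE \<xi>::'a in lborel. norm (exp (- t * norm \<xi> powr \<theta>)) \<le> norm (\<Prod>b\<in>Basis. exp (- ?c * \<bar>\<xi> \<bullet> b\<bar> powr \<theta>))"
      by (simp add: prod_nonneg)
  qed measurable
qed

lemma frac_heat_kernel_eq_cos_transform:
  fixes x :: "'a::euclidean_space"
  shows "frac_heat_kernel \<theta> x t = cos_transform (\<lambda>\<xi>. exp (- t * norm \<xi> powr \<theta>)) x / (2 * pi) ^ DIM('a)"
proof -
  have "(2 * pi) powr (- real DIM('a)) = 1 / (2 * pi) ^ DIM('a)"
    by (simp add: powr_minus_divide powr_realpow)
  then show ?thesis
    unfolding frac_heat_kernel_def cos_transform_def by (subst integral_completion) auto
qed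

lemma borel_measurable_frac_heat_kernel [measurable (raw)]:
  fixes f :: "'b \<Rightarrow> 'a::euclidean_space"
  assumes [measurable]: "f \<in> borel_measurable M" "g \<in> borel_measurable M"
  shows "(\<lambda>x. frac_heat_kernel \<theta> (f x) (g x)) \<in> borel_measurable M"
  unfolding frac_heat_kernel_eq_cos_transform cos_transform_def by measurable

lemma radial_cone_cos_transform_exp_norm_powr:
  assumes \<theta>: "0 < \<theta>" "\<theta> \<le> 2"
  shows "radial_cone (cos_transform (\<lambda>\<xi>::'a::euclidean_space. exp (- 1 * norm \<xi> powr \<theta>)))"
proof -
  let ?f = "\<lambda>l. exp (- (l powr (\<theta> / 2)))"
  let ?\<delta> = "\<lambda>k. 1 / real (Suc k)"
  have f: "exponential_mixture ?f"
    using \<theta> by (intro exponential_mixture_exp_minus_powr) auto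
  have symbol: "?f ((norm \<xi>)\<^sup>2) = exp (- 1 * norm \<xi> powr \<theta>)" for \<xi> :: 'a
  proof (cases "\<xi> = 0")
    case False
    then have "((norm \<xi>)\<^sup>2) powr (\<theta> / 2) = norm \<xi> powr \<theta>"
      by (simp add: powr_powr flip: powr_numeral)
    then show ?thesis by simp
  qed simp
  show ?thesis
  proof (rule radial_cone_lim)
    show "radial_cone (cos_transform (\<lambda>\<xi>::'a. exp (- 1 * norm \<xi> powr \<theta>) * exp (- ?\<delta> k * (norm \<xi>)\<^sup>2)))" for k
      unfolding symbol[symmetric]
      by (rule radial_cone_cos_transform_exponential_mixture_gaussian[OF f]) simp
    show "(\<lambda>k. cos_transform (\<lambda>\<xi>. exp (- 1 * norm \<xi> powr \<theta>) * exp (- ?\<delta> k * (norm \<xi>)\<^sup>2)) x)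
        \<longlonglongrightarrow> cos_transform (\<lambda>\<xi>. exp (- 1 * norm \<xi> powr \<theta>)) x" for x :: 'a
    proof (rule cos_transform_tendsto)
      show "integrable lborel (\<lambda>\<xi>::'a. exp (- 1 * norm \<xi> powr \<theta>))"
        using \<theta> by (intro integrable_exp_norm_powr) auto
      show "\<bar>exp (- 1 * norm \<xi> powr \<theta>) * exp (- ?\<delta> k * (norm \<xi>)\<^sup>2)\<bar> \<le> exp (- 1 * norm \<xi> powr \<theta>)" for k and \<xi> :: 'a
        by (simp add: abs_mult)
      show "(\<lambda>k. exp (- 1 * norm \<xi> powr \<theta>) * exp (- ?\<delta> k * (norm \<xi>)\<^sup>2)) \<longlonglongrightarrow> exp (- 1 * norm \<xi> powr \<theta>)" for \<xi> :: 'a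
      proof -
        have "(\<lambda>k. exp (- 1 * norm \<xi> powr \<theta>) * exp (- ?\<delta> k * (norm \<xi>)\<^sup>2))
            \<longlonglongrightarrow> exp (- 1 * norm \<xi> powr \<theta>) * exp (- 0 * (norm \<xi>)\<^sup>2)"
          by (intro tendsto_intros LIMSEQ_Suc[OF lim_1_over_n])
        then show ?thesis by simp
      qed
    qed measurable
  qed
qed

lemma radial_cone_frac_heat_kernel:
  assumes "0 < \<theta>" "\<theta> \<le> 2"
  shows "radial_cone (\<lambda>x::'a::euclidean_space. frac_heat_kernel \<theta> x 1)"
  using radial_cone_cmult[OF radial_cone_cos_transform_exp_norm_powr[OF assms, where 'a = 'a],
      of "1 / (2 * pi) ^ DIM('a)"]
  by (simp add: frac_heat_kernel_eq_cos_transform)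

lemma has_bochner_integral_frac_heat_kernel:
  assumes \<theta>: "0 < \<theta>" "\<theta> \<le> 2"
  shows "has_bochner_integral lborel (\<lambda>x::'a::euclidean_space. frac_heat_kernel \<theta> x 1) 1"
proof -
  let ?f = "\<lambda>\<xi>::'a. exp (- 1 * norm \<xi> powr \<theta>)"
  have "has_bochner_integral lborel (cos_transform ?f) ((2 * pi) ^ DIM('a) * ?f 0)"
  proof (rule cos_transform_inversion_at_0)
    show "integrable lborel ?f" using \<theta> by (intro integrable_exp_norm_powr) auto
    have "(?f \<longlongrightarrow> ?f 0) (at 0)"
      using \<theta> by (intro tendsto_intros tendsto_powr') (auto intro!: always_eventually tendsto_norm_zero)
    then show "isCont ?f 0" by (simp add: isCont_def)
    show "0 \<le> cos_transform ?f x" for x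
      by (rule radial_cone_nonneg[OF radial_cone_cos_transform_exp_norm_powr[OF \<theta>]])
    show "\<bar>?f \<xi>\<bar> \<le> 1" for \<xi> by simp
  qed
  from has_bochner_integral_mult_right[OF this, of "1 / (2 * pi) ^ DIM('a)"]
  show ?thesis by (simp add: frac_heat_kernel_eq_cos_transform)
qed

section \<open>The fractional heat kernel at all times\<close>

text \<open>The ratio \<open>N = n / \<theta>\<close> is the exponent of the logarithm in the norms and of the decay in time.\<close>

locale fractional_heat =
  fixes \<theta> N :: real and space_type :: "'a::euclidean_space itself"
  assumes theta: "0 < \<theta>" "\<theta> \<le> 2" and N_eq: "N = real DIM('a) / \<theta>"
begin

abbreviation G :: "'a \<Rightarrow> real \<Rightarrow> real" where "G \<equiv> frac_heat_kernel \<theta>"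

lemma N_pos: "0 < N"
  using theta by (simp add: N_eq)

lemma powr_inverse_theta_power: "0 < t \<Longrightarrow> (t powr (1 / \<theta>)) ^ DIM('a) = t powr N"
  by (simp add: N_eq powr_powr flip: powr_realpow)

lemma powr_inverse_theta_mono: "0 < s \<Longrightarrow> s \<le> t \<Longrightarrow> s powr (1 / \<theta>) \<le> t powr (1 / \<theta>)"
  using theta by (intro powr_mono2) auto

lemma G_scaling:
  assumes t: "0 < t"
  shows "G x t = t powr (- N) * G ((1 / t powr (1 / \<theta>)) *\<^sub>R x) 1"
proof -
  define \<tau> where "\<tau> = t powr (1 / \<theta>)"
  have \<tau>: "0 < \<tau>" "\<tau> powr \<theta> = t" using t theta by (auto simp: \<tau>_def powr_powr)
  have "exp (- t * norm \<xi> powr \<theta>) = exp (- 1 * norm (\<tau> *\<^sub>R \<xi>) powr \<theta>)" for \<xi> :: 'a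
    using \<tau> by (simp add: powr_mult)
  then have "cos_transform (\<lambda>\<xi>. exp (- t * norm \<xi> powr \<theta>)) x
      = cos_transform (\<lambda>\<xi>. exp (- 1 * norm \<xi> powr \<theta>)) ((1 / \<tau>) *\<^sub>R x) / \<tau> ^ DIM('a)"
    using cos_transform_dilate[OF integrable_exp_norm_powr[OF theta(1) zero_less_one] \<tau>(1), of x] by simp
  then show ?thesis
    using powr_inverse_theta_power[OF t]
    by (simp add: frac_heat_kernel_eq_cos_transform \<tau>_def powr_minus_divide)
qed

lemma G_nonneg: "0 < t \<Longrightarrow> 0 \<le> G x t"
  by (subst G_scaling)
     (auto intro!: mult_nonneg_nonneg radial_cone_nonneg[OF radial_cone_frac_heat_kernel[OF theta]])

lemma G_antimono: "0 < t \<Longrightarrow> norm x \<le> norm y \<Longrightarrow> G y t \<le> G x t"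
  by (subst (1 2) G_scaling)
     (auto intro!: mult_left_mono radial_cone_antimono[OF radial_cone_frac_heat_kernel[OF theta]] divide_right_mono)

lemma G_le: "0 < t \<Longrightarrow> G x t \<le> G 0 1 * t powr (- N)"
  using G_antimono[of t 0 x] by (simp add: G_scaling[of t 0] mult.commute)

lemma has_bochner_integral_G:
  assumes t: "0 < t"
  shows "has_bochner_integral lborel (\<lambda>x. G x t) 1"
proof -
  define c where "c = 1 / t powr (1 / \<theta>)"
  have c: "0 < c" using t by (simp add: c_def)
  have cN: "c ^ DIM('a) = t powr (- N)"
    using powr_inverse_theta_power[OF t] by (simp add: c_def power_divide powr_minus_divide)
  have "has_bochner_integral lborel (\<lambda>x. t powr (- N) * G (0 + c *\<^sub>R x) 1) (t powr (- N) * (1 / \<bar>c\<bar> ^ DIM('a)))"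
    using c theta by (intro has_bochner_integral_mult_right has_bochner_integral_lborel_affine
        has_bochner_integral_frac_heat_kernel) auto
  moreover have "t powr (- N) * (1 / \<bar>c\<bar> ^ DIM('a)) = 1" using c t cN by simp
  ultimately show ?thesis by (simp add: G_scaling[OF t] c_def)
qed

lemma nn_integral_G: "0 < t \<Longrightarrow> (\<integral>\<^sup>+x. ennreal (G x t) \<partial>lborel) = 1"
  using has_bochner_integral_G[of t]
  by (subst nn_integral_eq_integral) (auto simp: has_bochner_integral_iff G_nonneg)

lemma nn_integral_G_multc: "0 < t \<Longrightarrow> (\<integral>\<^sup>+x. ennreal (G x t) * c \<partial>lborel) = c"
  by (subst nn_integral_multc) (auto simp: nn_integral_G)

definition time_modulus :: "real \<Rightarrow> real" where
  "time_modulus r = 2 * (r powr (2 / \<theta>) - 1) * 2 powr (\<theta> * N / 2) + (1 - r powr (- N))"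

lemma time_modulus_mono: "1 \<le> r \<Longrightarrow> r \<le> q \<Longrightarrow> time_modulus r \<le> time_modulus q"
  unfolding time_modulus_def using theta N_pos
  by (intro add_mono mult_left_mono mult_right_mono diff_mono powr_mono2 powr_mono2') auto

lemma time_modulus_nonneg: "1 \<le> r \<Longrightarrow> 0 \<le> time_modulus r"
  using time_modulus_mono[of 1 r] by (simp add: time_modulus_def)

lemma time_modulus_tendsto_0:
  assumes "(f \<longlongrightarrow> 1) F"
  shows "((\<lambda>x. time_modulus (f x)) \<longlongrightarrow> 0) F"
proof -
  have "isCont time_modulus 1" unfolding time_modulus_def by (intro continuous_intros) auto
  from isCont_tendsto_compose[OF this assms] show ?thesis by (simp add: time_modulus_def)
qed

text \<open>Write \<open>G(x,s) - G(x,t)\<close> with \<open>P = G(\<cdot>,1)\<close>, \<open>y = s\<^bsup>-1/\<theta>\<^esup>x\<close> and \<open>q = (s/t)\<^bsup>1/\<theta>\<^esup>\<close> as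
  \<open>s\<^bsup>-N\<^esup>(P(y) - P(qy)) - (t\<^bsup>-N\<^esup> - s\<^bsup>-N\<^esup>)P(qy)\<close>.\<close>

lemma G_time_increment:
  assumes t: "0 < t" "t \<le> s"
  shows "\<bar>G x s - G x t\<bar> \<le> time_modulus (s / t) * (G x (2 powr (\<theta> / 2) * s) + G x t)"
proof -
  have s: "0 < s" and r: "1 \<le> s / t" using t by auto
  define c y q where "c = 2 powr (\<theta> / 2)" and "y = (1 / s powr (1 / \<theta>)) *\<^sub>R x" and "q = (s / t) powr (1 / \<theta>)"
  define a b where "a = 2 * (q\<^sup>2 - 1) * 2 powr (\<theta> * N / 2)" and "b = 1 - (s / t) powr (- N)"
  have q: "1 \<le> q" using r theta by (auto simp: q_def intro: ge_one_powr_ge_zero)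
  have "q\<^sup>2 = (s / t) powr (2 / \<theta>)" by (simp add: q_def power2_eq_square flip: powr_add)
  then have modulus: "time_modulus (s / t) = a + b" by (simp add: time_modulus_def a_def b_def)
  have a: "0 \<le> a" using q by (simp add: a_def)
  have b: "0 \<le> b" using r N_pos powr_mono2'[of "- N" 1 "s / t"] by (simp add: b_def)
  have G_s: "G x s = s powr (- N) * G y 1" using G_scaling[OF s] by (simp add: y_def)
  have G_t: "G x t = t powr (- N) * G (q *\<^sub>R y) 1"
    using G_scaling[OF t(1)] t s by (simp add: y_def q_def powr_divide)
  have "(c * s) powr (1 / \<theta>) = sqrt 2 * s powr (1 / \<theta>)"
    using s theta by (simp add: c_def powr_mult powr_powr powr_half_sqrt)
  moreover have "(c * s) powr (- N) = 1 / 2 powr (\<theta> * N / 2) * s powr (- N)"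
    by (simp add: c_def powr_mult powr_powr powr_minus_divide mult.commute)
  ultimately have G_cs: "2 powr (\<theta> * N / 2) * G x (c * s) = s powr (- N) * G ((1 / sqrt 2) *\<^sub>R y) 1"
    using G_scaling[of "c * s" x] s by (simp add: c_def y_def)
  have "0 \<le> G y 1 - G (q *\<^sub>R y) 1"
    using G_antimono[of 1 y "q *\<^sub>R y"] q by (simp add: mult_le_cancel_right1)
  then have increment_nonneg: "0 \<le> s powr (- N) * (G y 1 - G (q *\<^sub>R y) 1)" by simp
  have "s powr (- N) * (G y 1 - G (q *\<^sub>R y) 1) \<le> s powr (- N) * (2 * (q\<^sup>2 - 1) * G ((1 / sqrt 2) *\<^sub>R y) 1)"
    by (intro mult_left_mono radial_cone_dilate[OF radial_cone_frac_heat_kernel[OF theta] q]) simp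
  also have "\<dots> = 2 * (q\<^sup>2 - 1) * (2 powr (\<theta> * N / 2) * G x (c * s))"
    unfolding G_cs by simp
  finally have increment_le: "s powr (- N) * (G y 1 - G (q *\<^sub>R y) 1) \<le> a * G x (c * s)"
    by (simp add: a_def mult_ac)
  have "b * G x t = (t powr (- N) - s powr (- N)) * G (q *\<^sub>R y) 1"
    using t s by (simp add: b_def G_t powr_divide powr_minus field_simps)
  then have split: "G x s - G x t = s powr (- N) * (G y 1 - G (q *\<^sub>R y) 1) - b * G x t"
    by (simp add: G_s G_t algebra_simps)
  have g: "0 \<le> G x (c * s)" "0 \<le> G x t" using s t by (auto intro!: G_nonneg simp: c_def)
  then have "\<bar>G x s - G x t\<bar> \<le> a * G x (c * s) + b * G x t"
    using increment_nonneg increment_le mult_nonneg_nonneg[OF b g(2)] unfolding split by linarith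
  also have "\<dots> \<le> (a + b) * (G x (c * s) + G x t)"
    using a b g by (simp add: algebra_simps)
  finally show ?thesis by (simp add: modulus c_def)
qed

end

section \<open>Mass on balls\<close>

abbreviation mass :: "('a::euclidean_space \<Rightarrow> real) \<Rightarrow> 'a set \<Rightarrow> ennreal" where
  "mass f E \<equiv> (\<integral>\<^sup>+x\<in>E. ennreal \<bar>f x\<bar> \<partial>lborel)"

definition local_mass_le :: "real \<Rightarrow> ('a::euclidean_space \<Rightarrow> real) \<Rightarrow> ennreal \<Rightarrow> bool" where
  "local_mass_le r f M \<longleftrightarrow> (\<forall>z. mass f (ball z r) \<le> M)"

lemma sets_borel_ball [measurable]: "ball c r \<in> sets borel"
  by (rule borel_open) simp

lemma borel_measurable_indicator_ball [measurable (raw)]: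
  fixes f g :: "'b \<Rightarrow> 'a::euclidean_space"
  assumes [measurable]: "f \<in> borel_measurable M" "g \<in> borel_measurable M"
  shows "(\<lambda>x. indicator (ball (f x) r) (g x) :: ennreal) \<in> borel_measurable M"
  unfolding indicator_def mem_ball by measurable

lemma mass_subset: "E \<subseteq> F \<Longrightarrow> mass f E \<le> mass f F"
  by (intro nn_integral_mono) (auto simp: indicator_def)

lemma local_mass_leD: "local_mass_le r f M \<Longrightarrow> mass f (E \<inter> ball z r) \<le> M"
  unfolding local_mass_le_def using mass_subset[of "E \<inter> ball z r" "ball z r" f] by (auto intro: order_trans)

lemma local_mass_le_smaller_radius: "local_mass_le r f M \<Longrightarrow> r' \<le> r \<Longrightarrow> local_mass_le r' f M"
  unfolding local_mass_le_def using mass_subset[OF subset_ball] by (blast intro: order_trans)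

lemma local_mass_le_cmult:
  fixes f g :: "'a::euclidean_space \<Rightarrow> real"
  assumes [measurable]: "f \<in> borel_measurable borel" and f: "local_mass_le r f (ennreal M)"
    and c: "0 \<le> c" "\<And>x. \<bar>g x\<bar> \<le> c * \<bar>f x\<bar>"
  shows "local_mass_le r g (ennreal (c * M))"
  unfolding local_mass_le_def
proof
  fix z
  have "mass g (ball z r) \<le> (\<integral>\<^sup>+x. ennreal c * (ennreal \<bar>f x\<bar> * indicator (ball z r) x) \<partial>lborel)"
    using c by (intro nn_integral_mono) (auto simp: indicator_def ennreal_mult[symmetric] intro!: ennreal_leI)
  also have "\<dots> = ennreal c * mass f (ball z r)" by (rule nn_integral_cmult) measurable
  also have "\<dots> \<le> ennreal c * ennreal M" using f by (intro mult_left_mono) (auto simp: local_mass_le_def)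
  finally show "mass g (ball z r) \<le> ennreal (c * M)" using c(1) by (simp add: ennreal_mult')
qed

lemma sets_borel_vimage_plus [measurable]: "E \<in> sets borel \<Longrightarrow> (+) w -` E \<in> sets borel"
  for w :: "'a::euclidean_space"
  by (rule measurable_sets_borel[of _ borel]) auto

lemma emeasure_lborel_vimage_plus: "E \<in> sets borel \<Longrightarrow> emeasure lborel ((+) w -` E) = emeasure lborel E"
  for w :: "'a::euclidean_space"
  using emeasure_distr[of "(+) w" lborel borel E] by (simp add: lborel_distr_plus)

lemma vimage_plus_ball: "(+) w -` ball z r = ball (z - w) r"
  for w :: "'a::euclidean_space"
  by (auto simp: dist_norm algebra_simps)

lemma mass_translate:
  fixes f :: "'a::euclidean_space \<Rightarrow> real"
  assumes [measurable]: "f \<in> borel_measurable borel" "E \<in> sets borel"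
  shows "mass (\<lambda>x. f (x - w)) E = mass f ((+) w -` E)"
proof -
  have "mass (\<lambda>x. f (x - w)) E = (\<integral>\<^sup>+x. ennreal \<bar>f (w + x - w)\<bar> * indicator E (w + x) \<partial>lborel)"
    by (rule nn_integral_lborel_translate[symmetric]) measurable
  then show ?thesis by (simp add: indicator_vimage)
qed

lemma mass_reflect:
  fixes f :: "'a::euclidean_space \<Rightarrow> real"
  assumes [measurable]: "f \<in> borel_measurable borel"
  shows "(\<integral>\<^sup>+w\<in>ball c r. ennreal \<bar>f (x - w)\<bar> \<partial>lborel) = mass f (ball (x - c) r)"
proof -
  have "(\<integral>\<^sup>+w\<in>ball c r. ennreal \<bar>f (x - w)\<bar> \<partial>lborel)
      = (\<integral>\<^sup>+w. ennreal \<bar>f (x - (x - w))\<bar> * indicator (ball c r) (x - w) \<partial>lborel)"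
    by (rule nn_integral_lborel_reflect[symmetric]) measurable
  moreover have "indicator (ball c r) (x - w) = (indicator (ball (x - c) r) w :: ennreal)" for w
    by (auto simp: indicator_def dist_norm norm_minus_commute algebra_simps)
  ultimately show ?thesis by simp
qed

definition covering_number :: "'a::euclidean_space itself \<Rightarrow> real \<Rightarrow> real \<Rightarrow> nat" where
  "covering_number t R r =
    (LEAST m. \<exists>C::'a set. finite C \<and> card C = m \<and> ball 0 R \<subseteq> (\<Union>c\<in>C. ball c r))"

lemma covering_number_cover:
  fixes z :: "'a::euclidean_space"
  assumes r: "0 < r"
  obtains C where "finite C" "card C = covering_number TYPE('a) R r" "ball z R \<subseteq> (\<Union>c\<in>C. ball c r)"
proof -
  have "cball (0::'a) R \<subseteq> (\<Union>c\<in>cball 0 R. ball c r)" using r by auto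
  from compactE_image[OF compact_cball _ this]
  obtain D :: "'a set" where "finite D" "cball 0 R \<subseteq> (\<Union>c\<in>D. ball c r)" by (metis open_ball)
  then have "\<exists>m. \<exists>C::'a set. finite C \<and> card C = m \<and> ball 0 R \<subseteq> (\<Union>c\<in>C. ball c r)"
    using ball_subset_cball by blast
  from LeastI_ex[OF this] obtain C :: "'a set"
    where C: "finite C" "card C = covering_number TYPE('a) R r" "ball 0 R \<subseteq> (\<Union>c\<in>C. ball c r)"
    unfolding covering_number_def by blast
  show ?thesis
  proof
    show "finite ((+) z ` C)" using C by simp
    show "card ((+) z ` C) = covering_number TYPE('a) R r" using C by (simp add: card_image)
    show "ball z R \<subseteq> (\<Union>c\<in>(+) z ` C. ball c r)"
    proof
      fix x assume "x \<in> ball z R"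
      then have "x - z \<in> ball 0 R" by (simp add: dist_norm norm_minus_commute)
      then obtain c where "c \<in> C" "x - z \<in> ball c r" using C(3) by blast
      then show "x \<in> (\<Union>c\<in>(+) z ` C. ball c r)"
        by (intro UN_I[of "z + c"]) (auto simp: dist_norm algebra_simps)
    qed
  qed
qed

lemma mass_ball_le_covering_number:
  fixes f :: "'a::euclidean_space \<Rightarrow> real"
  assumes [measurable]: "f \<in> borel_measurable borel" "E \<in> sets borel"
    and r: "0 < r" and M: "\<And>z'. mass f (E \<inter> ball z' r) \<le> M"
  shows "mass f (E \<inter> ball z R) \<le> of_nat (covering_number TYPE('a) R r) * M"
proof -
  obtain C where C: "finite C" "card C = covering_number TYPE('a) R r" "ball z R \<subseteq> (\<Union>c\<in>C. ball c r)"
    by (rule covering_number_cover[OF r, of R z])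
  have "mass f (E \<inter> ball z R) \<le> (\<integral>\<^sup>+x. (\<Sum>c\<in>C. ennreal \<bar>f x\<bar> * indicator (E \<inter> ball c r) x) \<partial>lborel)"
  proof (rule nn_integral_mono)
    fix x
    show "ennreal \<bar>f x\<bar> * indicator (E \<inter> ball z R) x \<le> (\<Sum>c\<in>C. ennreal \<bar>f x\<bar> * indicator (E \<inter> ball c r) x)"
    proof (cases "x \<in> E \<inter> ball z R")
      case True
      then obtain c where c: "c \<in> C" "x \<in> E \<inter> ball c r" using C(3) by blast
      then have "ennreal \<bar>f x\<bar> = ennreal \<bar>f x\<bar> * indicator (E \<inter> ball c r) x" by simp
      also have "\<dots> \<le> (\<Sum>c\<in>C. ennreal \<bar>f x\<bar> * indicator (E \<inter> ball c r) x)"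
        using c(1) C(1) by (intro member_le_sum) auto
      finally show ?thesis using True by simp
    qed simp
  qed
  also have "\<dots> = (\<Sum>c\<in>C. mass f (E \<inter> ball c r))"
    by (rule nn_integral_sum) measurable
  also have "\<dots> \<le> (\<Sum>c\<in>C. M)" by (intro sum_mono M)
  finally show ?thesis using C(2) by simp
qed

lemma local_mass_le_larger_radius:
  fixes f :: "'a::euclidean_space \<Rightarrow> real"
  assumes "f \<in> borel_measurable borel" "0 < r" "local_mass_le r f M"
  shows "local_mass_le R f (of_nat (covering_number TYPE('a) R r) * M)"
  unfolding local_mass_le_def
  using mass_ball_le_covering_number[OF assms(1) _ assms(2) local_mass_leD[OF assms(3)], of UNIV] by simp

section \<open>Smoothing by the heat kernel\<close>

context fractional_heat
begin

definition heat_abs :: "('a \<Rightarrow> real) \<Rightarrow> real \<Rightarrow> 'a \<Rightarrow> ennreal" where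
  "heat_abs f t x = (\<integral>\<^sup>+y. ennreal (G (x - y) t * \<bar>f y\<bar>) \<partial>lborel)"

lemma borel_measurable_heat_abs [measurable (raw)]:
  assumes [measurable]: "case_prod f \<in> borel_measurable (borel \<Otimes>\<^sub>M borel)"
    "g \<in> borel_measurable M" "h \<in> borel_measurable M" "k \<in> borel_measurable M"
  shows "(\<lambda>w. heat_abs (\<lambda>y. f y (g w)) (h w) (k w)) \<in> borel_measurable M"
  unfolding heat_abs_def by measurable

lemma heat_abs_reflect:
  assumes [measurable]: "f \<in> borel_measurable borel" and t: "0 < t"
  shows "heat_abs f t x = (\<integral>\<^sup>+w. ennreal (G w t) * ennreal \<bar>f (x - w)\<bar> \<partial>lborel)"
proof -
  have "heat_abs f t x = (\<integral>\<^sup>+w. ennreal (G (x - (x - w)) t * \<bar>f (x - w)\<bar>) \<partial>lborel)"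
    unfolding heat_abs_def by (rule nn_integral_lborel_reflect[symmetric]) measurable
  then show ?thesis using G_nonneg[OF t] by (simp add: ennreal_mult)
qed

lemma heat_abs_le_sup:
  assumes [measurable]: "f \<in> borel_measurable borel" and t: "0 < t" and B: "\<And>y. \<bar>f y\<bar> \<le> B"
  shows "heat_abs f t x \<le> ennreal B"
proof -
  have "heat_abs f t x \<le> (\<integral>\<^sup>+w. ennreal (G w t) * ennreal B \<partial>lborel)"
    unfolding heat_abs_reflect[OF assms(1) t] using B by (intro nn_integral_mono mult_left_mono ennreal_leI) auto
  then show ?thesis by (simp add: nn_integral_G_multc[OF t])
qed

lemma nn_integral_heat_abs_le:
  assumes [measurable]: "f \<in> borel_measurable borel" "S \<in> sets borel" and t: "0 < t"
    and M: "\<And>w. mass (\<lambda>x. f (x - w)) S \<le> M"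
  shows "(\<integral>\<^sup>+x\<in>S. heat_abs f t x \<partial>lborel) \<le> M"
proof -
  have "(\<integral>\<^sup>+x\<in>S. heat_abs f t x \<partial>lborel)
      = (\<integral>\<^sup>+x. \<integral>\<^sup>+w. ennreal (G w t) * (ennreal \<bar>f (x - w)\<bar> * indicator S x) \<partial>lborel \<partial>lborel)"
    unfolding heat_abs_reflect[OF assms(1) t] mult.assoc[symmetric] by (subst nn_integral_multc) auto
  also have "\<dots> = (\<integral>\<^sup>+w. \<integral>\<^sup>+x. ennreal (G w t) * (ennreal \<bar>f (x - w)\<bar> * indicator S x) \<partial>lborel \<partial>lborel)"
    by (rule lborel_pair.Fubini') measurable
  also have "\<dots> = (\<integral>\<^sup>+w. ennreal (G w t) * mass (\<lambda>x. f (x - w)) S \<partial>lborel)"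
    by (simp add: nn_integral_cmult)
  also have "\<dots> \<le> (\<integral>\<^sup>+w. ennreal (G w t) * M \<partial>lborel)"
    by (intro nn_integral_mono mult_left_mono M) auto
  finally show ?thesis by (simp add: nn_integral_G_multc[OF t])
qed

text \<open>Away from the origin, radial monotonicity bounds the kernel by its average over a ball around \<open>w / 2\<close>.\<close>

lemma G_mult_ball_volume_le:
  assumes t: "0 < t" and \<sigma>: "0 < \<sigma>" "\<sigma> \<le> norm w"
  shows "ennreal (G w t) * emeasure lborel (ball (0::'a) (\<sigma> / 2))
    \<le> (\<integral>\<^sup>+u. ennreal (G u t) * indicator (ball (2 *\<^sub>R u) \<sigma>) w \<partial>lborel)"
proof -
  have "ennreal (G w t) * emeasure lborel (ball (0::'a) (\<sigma> / 2))
      = (\<integral>\<^sup>+u. ennreal (G w t) * indicator (ball ((1/2) *\<^sub>R w) (\<sigma> / 2)) u \<partial>lborel)"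
    using \<sigma>(1) by (subst nn_integral_cmult) (auto simp: emeasure_ball)
  also have "\<dots> \<le> (\<integral>\<^sup>+u. ennreal (G u t) * indicator (ball (2 *\<^sub>R u) \<sigma>) w \<partial>lborel)"
  proof (rule nn_integral_mono)
    fix u :: 'a
    show "ennreal (G w t) * indicator (ball ((1/2) *\<^sub>R w) (\<sigma> / 2)) u
        \<le> ennreal (G u t) * indicator (ball (2 *\<^sub>R u) \<sigma>) w"
    proof (cases "u \<in> ball ((1/2) *\<^sub>R w) (\<sigma> / 2)")
      case True
      then have d: "norm ((1/2) *\<^sub>R w - u) < \<sigma> / 2" by (simp add: dist_norm)
      have "norm u \<le> norm ((1/2) *\<^sub>R w) + norm ((1/2) *\<^sub>R w - u)"
        by (metis norm_minus_commute norm_triangle_sub)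
      also have "\<dots> \<le> norm w" using d \<sigma>(2) by simp
      finally have "G w t \<le> G u t" by (rule G_antimono[OF t])
      moreover have "norm (2 *\<^sub>R ((1/2) *\<^sub>R w - u)) < \<sigma>" using d by simp
      then have "w \<in> ball (2 *\<^sub>R u) \<sigma>" by (simp add: dist_norm norm_minus_commute scaleR_diff_right)
      ultimately show ?thesis using True by (simp add: ennreal_leI)
    qed simp
  qed
  finally show ?thesis .
qed

lemma G_le_near_plus_average:
  assumes t: "0 < t" and \<sigma>: "0 < \<sigma>" "\<sigma> \<le> t powr (1 / \<theta>)"
  defines "V \<equiv> unit_ball_vol (DIM('a)) * (\<sigma> / 2) ^ DIM('a)"
  shows "ennreal (G w t) \<le> ennreal (G 0 1 / \<sigma> ^ DIM('a)) * indicator (ball 0 \<sigma>) w +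
    ennreal (1 / V) * (\<integral>\<^sup>+u. ennreal (G u t) * indicator (ball (2 *\<^sub>R u) \<sigma>) w \<partial>lborel)"
proof (cases "norm w < \<sigma>")
  case True
  have "\<sigma> ^ DIM('a) \<le> t powr N"
    using \<sigma> power_mono[of \<sigma> "t powr (1 / \<theta>)" "DIM('a)"] by (simp add: powr_inverse_theta_power[OF t])
  then have "G 0 1 * t powr (- N) \<le> G 0 1 / \<sigma> ^ DIM('a)"
    using \<sigma> t G_nonneg[of 1 0] by (simp add: powr_minus_divide divide_left_mono)
  then have "G w t \<le> G 0 1 / \<sigma> ^ DIM('a)" using G_le[OF t, of w] by linarith
  then show ?thesis using True by (auto intro!: add_increasing2 ennreal_leI)
next
  case False
  have V: "0 < V" "emeasure lborel (ball (0::'a) (\<sigma> / 2)) = ennreal V"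
    using \<sigma> by (auto simp: V_def emeasure_ball)
  have "ennreal (G w t) = ennreal (1 / V) * (ennreal (G w t) * ennreal V)"
    using V G_nonneg[OF t] by (simp add: ennreal_mult[symmetric])
  also have "\<dots> \<le> ennreal (1 / V) * (\<integral>\<^sup>+u. ennreal (G u t) * indicator (ball (2 *\<^sub>R u) \<sigma>) w \<partial>lborel)"
    using G_mult_ball_volume_le[OF t \<sigma>(1), of w] False by (intro mult_left_mono) (auto simp: V)
  finally show ?thesis by (rule add_increasing[OF zero_le])
qed

definition smoothing_const :: real where
  "smoothing_const = G (0::'a) 1 + 2 ^ DIM('a) / unit_ball_vol (DIM('a))"

lemma smoothing_const_nonneg: "0 \<le> smoothing_const"
  using G_nonneg[of 1 0] by (simp add: smoothing_const_def)

lemma nn_integral_G_mult_le: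
  fixes g :: "'a \<Rightarrow> ennreal"
  assumes [measurable]: "g \<in> borel_measurable borel"
    and t: "0 < t" and \<sigma>: "0 < \<sigma>" "\<sigma> \<le> t powr (1 / \<theta>)" and M: "\<And>c. (\<integral>\<^sup>+w\<in>ball c \<sigma>. g w \<partial>lborel) \<le> M"
  shows "(\<integral>\<^sup>+w. ennreal (G w t) * g w \<partial>lborel) \<le> ennreal (smoothing_const / \<sigma> ^ DIM('a)) * M"
proof -
  define A V where "A = G 0 1 / \<sigma> ^ DIM('a)" and "V = unit_ball_vol (DIM('a)) * (\<sigma> / 2) ^ DIM('a)"
  have A: "0 \<le> A" and V: "0 < V" using \<sigma> G_nonneg[of 1 0] by (auto simp: A_def V_def)
  have A_V: "A + 1 / V = smoothing_const / \<sigma> ^ DIM('a)"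
    using \<sigma> by (simp add: A_def V_def smoothing_const_def add_divide_distrib power_divide)
  let ?avg = "\<lambda>w. \<integral>\<^sup>+u. ennreal (G u t) * indicator (ball (2 *\<^sub>R u) \<sigma>) w \<partial>lborel"
  have "(\<integral>\<^sup>+w. ?avg w * g w \<partial>lborel) = (\<integral>\<^sup>+w. \<integral>\<^sup>+u. ennreal (G u t) * (g w * indicator (ball (2 *\<^sub>R u) \<sigma>) w) \<partial>lborel \<partial>lborel)"
    by (subst nn_integral_multc[symmetric]) (auto simp: mult_ac)
  also have "\<dots> = (\<integral>\<^sup>+u. ennreal (G u t) * (\<integral>\<^sup>+w\<in>ball (2 *\<^sub>R u) \<sigma>. g w \<partial>lborel) \<partial>lborel)"
    by (subst lborel_pair.Fubini') (auto simp: nn_integral_cmult)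
  also have "\<dots> \<le> (\<integral>\<^sup>+u. ennreal (G u t) * M \<partial>lborel)"
    by (intro nn_integral_mono mult_left_mono M) auto
  finally have average: "(\<integral>\<^sup>+w. ?avg w * g w \<partial>lborel) \<le> M" by (simp add: nn_integral_G_multc[OF t])
  have "(\<integral>\<^sup>+w. ennreal (G w t) * g w \<partial>lborel)
      \<le> (\<integral>\<^sup>+w. (ennreal A * indicator (ball 0 \<sigma>) w + ennreal (1 / V) * ?avg w) * g w \<partial>lborel)"
    unfolding A_def V_def by (intro nn_integral_mono mult_right_mono G_le_near_plus_average t \<sigma>) auto
  also have "\<dots> = (\<integral>\<^sup>+w. ennreal A * (g w * indicator (ball 0 \<sigma>) w) + ennreal (1 / V) * (?avg w * g w) \<partial>lborel)"
    by (intro nn_integral_cong, subst distrib_right) (simp only: mult_ac)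
  also have "\<dots> = ennreal A * (\<integral>\<^sup>+w\<in>ball 0 \<sigma>. g w \<partial>lborel) + ennreal (1 / V) * (\<integral>\<^sup>+w. ?avg w * g w \<partial>lborel)"
    by (subst nn_integral_add) (auto simp: nn_integral_cmult)
  also have "\<dots> \<le> ennreal A * M + ennreal (1 / V) * M"
    by (intro add_mono mult_left_mono M average) auto
  also have "\<dots> = ennreal (smoothing_const / \<sigma> ^ DIM('a)) * M"
    using V A by (simp add: A_V[symmetric] distrib_right)
  finally show ?thesis .
qed

lemma heat_abs_smoothing:
  assumes [measurable]: "f \<in> borel_measurable borel" and \<eta>: "0 < \<eta>" "\<eta> \<le> t"
    and f: "local_mass_le (\<eta> powr (1 / \<theta>)) f M"
  shows "heat_abs f t x \<le> ennreal (smoothing_const * \<eta> powr (- N)) * M"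
proof -
  have t: "0 < t" using \<eta> by simp
  have "heat_abs f t x \<le> ennreal (smoothing_const / (\<eta> powr (1 / \<theta>)) ^ DIM('a)) * M"
    unfolding heat_abs_reflect[OF assms(1) t]
  proof (rule nn_integral_G_mult_le)
    show "\<eta> powr (1 / \<theta>) \<le> t powr (1 / \<theta>)" by (rule powr_inverse_theta_mono[OF \<eta>])
    show "(\<integral>\<^sup>+w\<in>ball c (\<eta> powr (1 / \<theta>)). ennreal \<bar>f (x - w)\<bar> \<partial>lborel) \<le> M" for c
      using f by (simp add: mass_reflect local_mass_le_def)
  qed (use \<eta> t in auto)
  then show ?thesis using \<eta> by (simp add: powr_inverse_theta_power powr_minus_divide)
qed

lemma nn_integral_G_increment_le:
  assumes [measurable]: "f \<in> borel_measurable borel" and t: "0 < t" "t \<le> s"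
  shows "(\<integral>\<^sup>+y. ennreal (\<bar>G (x - y) s - G (x - y) t\<bar> * \<bar>f y\<bar>) \<partial>lborel)
     \<le> ennreal (time_modulus (s / t)) * (heat_abs f (2 powr (\<theta> / 2) * s) x + heat_abs f t x)"
proof -
  define c where "c = 2 powr (\<theta> / 2) * s"
  have nonneg: "0 \<le> time_modulus (s / t)" "0 \<le> G w c" "0 \<le> G w t" for w
    using t by (auto intro: time_modulus_nonneg G_nonneg simp: c_def)
  have "(\<integral>\<^sup>+y. ennreal (\<bar>G (x - y) s - G (x - y) t\<bar> * \<bar>f y\<bar>) \<partial>lborel) \<le>
     (\<integral>\<^sup>+y. ennreal (time_modulus (s / t)) * (ennreal (G (x - y) c * \<bar>f y\<bar>)
         + ennreal (G (x - y) t * \<bar>f y\<bar>)) \<partial>lborel)"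
  proof (rule nn_integral_mono)
    fix y
    have "\<bar>G (x - y) s - G (x - y) t\<bar> * \<bar>f y\<bar> \<le> time_modulus (s / t) * (G (x - y) c + G (x - y) t) * \<bar>f y\<bar>"
      unfolding c_def by (intro mult_right_mono G_time_increment t) auto
    then show "ennreal (\<bar>G (x - y) s - G (x - y) t\<bar> * \<bar>f y\<bar>)
      \<le> ennreal (time_modulus (s / t)) * (ennreal (G (x - y) c * \<bar>f y\<bar>) + ennreal (G (x - y) t * \<bar>f y\<bar>))"
      using nonneg by (simp add: ennreal_mult[symmetric] ennreal_plus[symmetric] algebra_simps ennreal_leI
          del: ennreal_plus)
  qed
  also have "\<dots> = ennreal (time_modulus (s / t)) * (heat_abs f c x + heat_abs f t x)"
    unfolding heat_abs_def by (subst nn_integral_cmult) (auto simp: nn_integral_add)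
  finally show ?thesis by (simp add: c_def)
qed

end

section \<open>The logarithmic weight\<close>

definition Lg :: "real \<Rightarrow> real" where
  "Lg s = ln (exp 1 + 1 / s)"

lemma borel_measurable_Lg [measurable]: "Lg \<in> borel_measurable borel"
  unfolding Lg_def by measurable

lemma ln_exp_1_add_ge_1: "0 \<le> y \<Longrightarrow> 1 \<le> ln (exp 1 + y)" for y :: real
  by (subst ln_ge_iff) (auto intro: add_pos_nonneg)

lemma Lg_ge_1: "0 < s \<Longrightarrow> 1 \<le> Lg s"
  unfolding Lg_def by (intro ln_exp_1_add_ge_1) simp

lemma Lg_pos: "0 < s \<Longrightarrow> 0 < Lg s"
  using Lg_ge_1[of s] by simp

lemma Lg_antimono: "0 < s \<Longrightarrow> s \<le> t \<Longrightarrow> Lg t \<le> Lg s"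
  unfolding Lg_def by (subst ln_le_cancel_iff) (auto intro!: add_pos_pos divide_left_mono)

lemma Lg_powr_minus_le_1:
  assumes "0 < s" "0 \<le> a"
  shows "Lg s powr (- a) \<le> 1"
  using powr_mono[of "- a" 0 "Lg s"] Lg_ge_1[OF assms(1)] assms(2) by simp

lemma Lg_powr_minus_mono: "0 < s \<Longrightarrow> s \<le> t \<Longrightarrow> 0 \<le> a \<Longrightarrow> Lg s powr (- a) \<le> Lg t powr (- a)"
  using Lg_antimono[of s t] Lg_pos[of t] by (intro powr_mono2') auto

lemma ln_exp_1_add_powr_le:
  fixes y k :: real
  assumes y: "0 \<le> y" and k: "0 < k"
  shows "ln (exp 1 + y powr k) \<le> (2 + k) * ln (exp 1 + y)"
proof -
  define P where "P = (exp 1 + y) powr k"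
  have e: "2 \<le> exp (1::real)" using exp_ge_add_one_self[of 1] by simp
  have base: "0 < exp 1 + y" using y by (simp add: add_pos_nonneg)
  have P: "1 \<le> P" "y powr k \<le> P"
    using e y k by (auto simp: P_def intro!: ge_one_powr_ge_zero powr_mono2)
  have "exp 1 * 1 \<le> exp 1 * P" "1 * P \<le> exp 1 * P"
    using P e by (intro mult_left_mono mult_right_mono; simp)+
  then have "exp 1 + y powr k \<le> exp 1 * P + exp 1 * P"
    using P(2) by linarith
  also have "\<dots> \<le> exp 1 * exp 1 * P"
    using e P mult_right_mono[OF e, of "exp 1 * P"] by simp
  finally have "ln (exp 1 + y powr k) \<le> ln (exp 2 * P)"
    using P by (subst ln_le_cancel_iff) (auto intro: add_pos_nonneg simp flip: exp_add)
  also have "\<dots> = 2 + k * ln (exp 1 + y)"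
    using base P by (simp add: ln_mult P_def ln_powr)
  also have "\<dots> \<le> (2 + k) * ln (exp 1 + y)"
    using ln_exp_1_add_ge_1[OF y] by (simp add: distrib_right)
  finally show ?thesis .
qed

lemma ln_exp_1_add_cmult_le:
  fixes w c :: real
  assumes w: "0 \<le> w" and c: "0 < c"
  shows "ln (exp 1 + c * w) \<le> (ln (exp 1 + c) + 1) * ln (exp 1 + w)"
proof -
  have "exp 1 * 1 \<le> exp 1 * exp (1::real)" by (intro mult_left_mono) auto
  moreover have "0 \<le> exp 1 * w" "0 \<le> c * exp 1" using w c by auto
  ultimately have "exp 1 + c * w \<le> (exp 1 + c) * (exp 1 + w)"
    unfolding distrib_left distrib_right by linarith
  then have "ln (exp 1 + c * w) \<le> ln ((exp 1 + c) * (exp 1 + w))"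
    using w c by (subst ln_le_cancel_iff) (auto intro!: add_pos_nonneg mult_pos_pos)
  also have "\<dots> = ln (exp 1 + c) + ln (exp 1 + w)"
    using w c by (intro ln_mult_pos) (auto intro!: add_pos_nonneg)
  also have "\<dots> \<le> (ln (exp 1 + c) + 1) * ln (exp 1 + w)"
    using ln_exp_1_add_ge_1[OF w] ln_exp_1_add_ge_1[of c] c mult_left_mono[of 1 "ln (exp 1 + w)" "ln (exp 1 + c)"]
    by (simp add: distrib_right)
  finally show ?thesis .
qed

definition Lg_dilation_const :: "real \<Rightarrow> real \<Rightarrow> real" where
  "Lg_dilation_const \<kappa> c = (2 + 1 / \<kappa>) * (ln (exp 1 + c) + 1)"

lemma Lg_dilation_const_pos: "0 < \<kappa> \<Longrightarrow> 0 < c \<Longrightarrow> 0 < Lg_dilation_const \<kappa> c"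
  unfolding Lg_dilation_const_def using ln_exp_1_add_ge_1[of c]
  by (intro mult_pos_pos) (auto intro: add_pos_pos)

lemma Lg_le_dilation:
  assumes \<kappa>: "0 < \<kappa>" and c: "0 < c" and s: "0 < s"
  shows "Lg s \<le> Lg_dilation_const \<kappa> c * Lg (c * s powr \<kappa>)"
proof -
  define w where "w = 1 / (c * s powr \<kappa>)"
  have w: "0 < w" using s c by (simp add: w_def)
  have "(c * w) powr (1 / \<kappa>) = 1 / s"
    using c s \<kappa> by (simp add: w_def powr_divide powr_powr)
  then have "Lg s = ln (exp 1 + (c * w) powr (1 / \<kappa>))" by (simp add: Lg_def)
  also have "\<dots> \<le> (2 + 1 / \<kappa>) * ln (exp 1 + c * w)"
    using c w \<kappa> by (intro ln_exp_1_add_powr_le) auto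
  also have "\<dots> \<le> (2 + 1 / \<kappa>) * ((ln (exp 1 + c) + 1) * ln (exp 1 + w))"
    using w c \<kappa> by (intro mult_left_mono ln_exp_1_add_cmult_le) auto
  finally show ?thesis by (simp add: w_def Lg_def Lg_dilation_const_def mult.assoc)
qed

definition Lg_powr_const :: "real \<Rightarrow> real \<Rightarrow> real" where
  "Lg_powr_const \<delta> S = (exp 1 * S + 1) powr \<delta> / \<delta>"

lemma Lg_powr_const_pos: "0 < \<delta> \<Longrightarrow> 0 < S \<Longrightarrow> 0 < Lg_powr_const \<delta> S"
  unfolding Lg_powr_const_def by (simp add: add_pos_pos less_imp_neq[THEN not_sym])

lemma Lg_le_powr:
  assumes \<delta>: "0 < \<delta>" and s: "0 < s" "s \<le> S"
  shows "Lg s \<le> Lg_powr_const \<delta> S * s powr (- \<delta>)"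
proof -
  have pos: "0 < exp 1 + 1 / s" using s by (auto intro: add_pos_pos)
  have "Lg s = ln ((exp 1 + 1 / s) powr \<delta>) / \<delta>"
    using \<delta> pos by (simp add: Lg_def ln_powr)
  also have "\<dots> \<le> (exp 1 + 1 / s) powr \<delta> / \<delta>"
    using \<delta> pos ln_le_minus_one[of "(exp 1 + 1 / s) powr \<delta>"] by (intro divide_right_mono) auto
  also have "\<dots> \<le> ((exp 1 * S + 1) * (1 / s)) powr \<delta> / \<delta>"
    using \<delta> s pos by (intro divide_right_mono powr_mono2) (auto simp: field_simps)
  also have "\<dots> = Lg_powr_const \<delta> S * s powr (- \<delta>)"
    using s by (subst powr_mult) (auto simp: Lg_powr_const_def powr_minus_divide powr_divide)
  finally show ?thesis .
qed

definition mult_Lg_powr_const :: "real \<Rightarrow> real \<Rightarrow> real" where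
  "mult_Lg_powr_const \<gamma> S = S powr (1 / (\<gamma> + 1)) * Lg_powr_const (1 / (\<gamma> + 1)) S powr \<gamma>"

lemma mult_Lg_powr_le:
  assumes \<gamma>: "0 \<le> \<gamma>" and s: "0 < s" "s \<le> S"
  shows "s * Lg s powr \<gamma> \<le> mult_Lg_powr_const \<gamma> S"
proof -
  define \<delta> C where "\<delta> = 1 / (\<gamma> + 1)" and "C = Lg_powr_const \<delta> S"
  have "Lg s powr \<gamma> \<le> (C * s powr (- \<delta>)) powr \<gamma>"
    using Lg_le_powr[of \<delta> s S] Lg_pos[OF s(1)] \<gamma> s by (intro powr_mono2) (auto simp: \<delta>_def C_def)
  then have "s * Lg s powr \<gamma> \<le> s * (C powr \<gamma> * s powr (- \<delta> * \<gamma>))"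
    using s by (simp add: powr_mult powr_powr)
  also have "\<dots> = C powr \<gamma> * s powr (1 + - \<delta> * \<gamma>)"
    unfolding powr_add using s by simp
  also have "1 + - \<delta> * \<gamma> = \<delta>" using \<gamma> by (simp add: \<delta>_def field_simps)
  also have "C powr \<gamma> * s powr \<delta> \<le> C powr \<gamma> * S powr \<delta>"
    using s \<gamma> by (intro mult_left_mono powr_mono2) (auto simp: \<delta>_def)
  finally show ?thesis by (simp add: \<delta>_def C_def mult_Lg_powr_const_def mult.commute)
qed

definition Lg_comp_const :: "real \<Rightarrow> real \<Rightarrow> real \<Rightarrow> real" where
  "Lg_comp_const \<kappa> m S = Lg_dilation_const (\<kappa> / 2) (Lg_powr_const (\<kappa> / (2 * (m + 1))) S powr (m + 1))"

lemma Lg_comp_const_pos: "0 < \<kappa> \<Longrightarrow> 0 \<le> m \<Longrightarrow> 0 < S \<Longrightarrow> 0 < Lg_comp_const \<kappa> m S"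
  using Lg_powr_const_pos[of "\<kappa> / (2 * (m + 1))" S] by (simp add: Lg_comp_const_def Lg_dilation_const_pos)

lemma Lg_le_comp:
  assumes \<kappa>: "0 < \<kappa>" and m: "0 \<le> m" and s: "0 < s" "s \<le> S"
  shows "Lg s \<le> Lg_comp_const \<kappa> m S * Lg (s powr \<kappa> * Lg s powr m)"
proof -
  define \<delta> C where "\<delta> = \<kappa> / (2 * (m + 1))" and "C = Lg_powr_const \<delta> S powr (m + 1)"
  have \<delta>: "0 < \<delta>" using \<kappa> m by (simp add: \<delta>_def)
  then have C: "0 < C" using s Lg_powr_const_pos[of \<delta> S] by (simp add: C_def)
  have "Lg s powr m \<le> Lg s powr (m + 1)" using Lg_ge_1[OF s(1)] by (intro powr_mono) auto
  also have "\<dots> \<le> (Lg_powr_const \<delta> S * s powr (- \<delta>)) powr (m + 1)"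
    using Lg_le_powr[OF \<delta> s] Lg_pos[OF s(1)] m by (intro powr_mono2) auto
  also have "\<dots> = C * s powr (- (\<kappa> / 2))"
  proof -
    have "- \<delta> * (m + 1) = - (\<kappa> / 2)" using m by (simp add: \<delta>_def divide_simps)
    then show ?thesis by (simp only: powr_mult powr_powr C_def)
  qed
  finally have "s powr \<kappa> * Lg s powr m \<le> s powr \<kappa> * (C * s powr (- (\<kappa> / 2)))"
    by (intro mult_left_mono) auto
  also have "\<dots> = C * s powr (\<kappa> / 2)"
    by (simp add: mult.left_commute flip: powr_add)
  finally have "Lg (C * s powr (\<kappa> / 2)) \<le> Lg (s powr \<kappa> * Lg s powr m)"
    using s Lg_pos[OF s(1)] by (intro Lg_antimono mult_pos_pos) auto
  then have "Lg_comp_const \<kappa> m S * Lg (C * s powr (\<kappa> / 2)) \<le> Lg_comp_const \<kappa> m S * Lg (s powr \<kappa> * Lg s powr m)"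
    using Lg_comp_const_pos[OF \<kappa> m, of S] s by (intro mult_left_mono) auto
  then show ?thesis
    using Lg_le_dilation[of "\<kappa> / 2" C s] \<kappa> C s by (simp add: Lg_comp_const_def C_def \<delta>_def)
qed

lemma powr_minus_le_of_le_mult:
  fixes a b c q :: real
  assumes "0 < a" "0 < c" "a \<le> c * b" "0 \<le> q"
  shows "b powr (- q) \<le> c powr q * a powr (- q)"
proof -
  have "b powr (- q) \<le> (a / c) powr (- q)"
    using assms by (intro powr_mono2') (auto simp: field_simps)
  then show ?thesis using assms by (simp add: powr_divide powr_minus_divide)
qed

lemma filterlim_Lg_at_right_0: "filterlim Lg at_top (at_right 0)"
proof -
  have "filterlim (\<lambda>s::real. exp 1 + inverse s) at_top (at_right 0)"
    by (intro filterlim_tendsto_add_at_top[OF tendsto_const] filterlim_inverse_at_top_right)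
  then show ?thesis unfolding Lg_def inverse_eq_divide
    by (rule filterlim_compose[OF ln_at_top])
qed

lemma Lg_powr_minus_tendsto_0: "0 < a \<Longrightarrow> ((\<lambda>s. Lg s powr (- a)) \<longlongrightarrow> 0) (at_right 0)"
  by (intro tendsto_neg_powr filterlim_Lg_at_right_0) auto

lemma DERIV_Lg_powr:
  assumes s: "0 < s"
  shows "((\<lambda>s. Lg s powr (- a)) has_real_derivative a * Lg s powr (- a - 1) / (s * (exp 1 * s + 1))) (at s)"
proof -
  have p: "0 < exp 1 + 1 / s" using s by (auto intro: add_pos_pos)
  have "(Lg has_real_derivative (- 1 / s\<^sup>2) / (exp 1 + 1 / s)) (at s)"
    unfolding Lg_def using s p by (auto intro!: derivative_eq_intros simp: power2_eq_square)
  moreover have "(- 1 / s\<^sup>2) / (exp 1 + 1 / s) = - (1 / (s * (exp 1 * s + 1)))"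
    using s p by (simp add: field_simps power2_eq_square)
  ultimately show ?thesis
    using DERIV_fun_powr[of Lg "- (1 / (s * (exp 1 * s + 1)))" s "- a"] Lg_pos[OF s] by simp
qed

lemma nn_integral_Lg_powr_derivative:
  assumes a: "0 < a" and t: "0 < t"
  shows "(\<integral>\<^sup>+s\<in>{0<..<t}. ennreal (a * Lg s powr (- a - 1) / (s * (exp 1 * s + 1))) \<partial>lborel)
      = ennreal (Lg t powr (- a))"
proof -
  let ?w = "\<lambda>s. a * Lg s powr (- a - 1) / (s * (exp 1 * s + 1))"
  have "isCont ?w s" if "0 < s" for s
    unfolding Lg_def using that ln_exp_1_add_ge_1[of "1 / s"]
    by (intro continuous_intros) (auto simp: add_pos_pos less_imp_neq[THEN not_sym])
  moreover have "((\<lambda>s. Lg s powr (- a)) \<longlongrightarrow> Lg t powr (- a)) (at_left t)"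
    using DERIV_isCont[OF DERIV_Lg_powr[OF t]] by (simp add: isCont_def filterlim_at_split)
  ultimately have "set_integrable lborel {0<..<t} ?w" "(LBINT s=ereal 0..ereal t. ?w s) = Lg t powr (- a) - 0"
    using interval_integral_FTC_nonneg[of "ereal 0" "ereal t" "\<lambda>s. Lg s powr (- a)" ?w 0 "Lg t powr (- a)"] t a
      DERIV_Lg_powr[of _ a] Lg_powr_minus_tendsto_0[OF a]
    by (auto simp: ereal_tendsto_simps simp del: zero_ereal_def)
  then show ?thesis
    using t a by (subst nn_integral_set_ennreal, subst nn_integral_eq_integral)
      (auto simp: interval_lebesgue_integral_def set_integrable_def set_lebesgue_integral_def
          mult.commute indicator_def
        intro!: AE_I2)
qed

lemma nn_integral_Lg_powr_div_le:
  assumes a: "0 < a" and t: "0 < t" "t \<le> S"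
  shows "(\<integral>\<^sup>+s\<in>{0<..<t}. ennreal (s powr (- 1) * Lg s powr (- a - 1)) \<partial>lborel)
     \<le> ennreal ((exp 1 * S + 1) / a * Lg t powr (- a))"
proof -
  let ?w = "\<lambda>s. a * Lg s powr (- a - 1) / (s * (exp 1 * s + 1))"
  define c where "c = (exp 1 * S + 1) / a"
  have c: "0 \<le> c" using a t by (simp add: c_def)
  have "(\<integral>\<^sup>+s\<in>{0<..<t}. ennreal (s powr (- 1) * Lg s powr (- a - 1)) \<partial>lborel)
      \<le> (\<integral>\<^sup>+s. ennreal c * (ennreal (?w s) * indicator {0<..<t} s) \<partial>lborel)"
  proof (rule nn_integral_mono)
    fix s :: real
    have "s powr (- 1) * Lg s powr (- a - 1) \<le> c * ?w s" if "s \<in> {0<..<t}"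
    proof -
      have "s powr (- 1) * Lg s powr (- a - 1) = (exp 1 * s + 1) / a * ?w s"
        using that a by (simp add: powr_minus_divide add_pos_pos less_imp_neq[THEN not_sym])
      also have "\<dots> \<le> c * ?w s"
        unfolding c_def using that a t by (intro mult_right_mono divide_right_mono) auto
      finally show ?thesis .
    qed
    then show "ennreal (s powr (- 1) * Lg s powr (- a - 1)) * indicator {0<..<t} s
       \<le> ennreal c * (ennreal (?w s) * indicator {0<..<t} s)"
      using c a by (auto simp: indicator_def ennreal_mult[symmetric] intro!: ennreal_leI)
  qed
  also have "\<dots> = ennreal c * ennreal (Lg t powr (- a))"
    using nn_integral_Lg_powr_derivative[OF a t(1)] by (subst nn_integral_cmult) auto
  also have "\<dots> = ennreal ((exp 1 * S + 1) / a * Lg t powr (- a))"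
    using c by (simp add: ennreal_mult[symmetric] c_def)
  finally show ?thesis .
qed

lemma nn_integral_powr_tail:
  assumes q: "0 < q" and a: "0 < a"
  shows "(\<integral>\<^sup>+s\<in>{a..}. ennreal (s powr (- q - 1)) \<partial>lborel) = ennreal (a powr (- q) / q)"
proof -
  have "(\<integral>\<^sup>+s\<in>{a..}. ennreal (s powr (- q - 1)) \<partial>lborel) = ennreal (0 - (- (a powr (- q)) / q))"
  proof (rule nn_integral_FTC_atLeast)
    show "((\<lambda>s. - (s powr (- q)) / q) has_real_derivative s powr (- q - 1)) (at s)" if "a \<le> s" for s
      using that a q by (auto intro!: derivative_eq_intros)
    have "((\<lambda>s. s powr (- q)) \<longlongrightarrow> 0) at_top"
      using q by (intro tendsto_neg_powr filterlim_ident) auto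
    from tendsto_divide[OF tendsto_minus[OF this] tendsto_const[of q]]
    show "((\<lambda>s. - (s powr (- q)) / q) \<longlongrightarrow> 0) at_top" using q by simp
  qed auto
  then show ?thesis by simp
qed

section \<open>Logarithmic bounds on the mass of small sets\<close>

definition log_bounded :: "real \<Rightarrow> real \<Rightarrow> real \<Rightarrow> ('a::euclidean_space \<Rightarrow> real) \<Rightarrow> bool" where
  "log_bounded \<gamma> r K f \<longleftrightarrow> (\<forall>z E s. E \<in> sets borel \<and> 0 < s \<and> emeasure lborel E = ennreal s \<longrightarrow>
     mass f (E \<inter> ball z r) \<le> ennreal (K * Lg s powr (- \<gamma>)))"

lemma log_boundedI:
  fixes f :: "'a::euclidean_space \<Rightarrow> real"
  assumes "\<And>z E s. E \<in> sets borel \<Longrightarrow> 0 < s \<Longrightarrow> emeasure lborel E = ennreal s \<Longrightarrow>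
    mass f (E \<inter> ball z r) \<le> ennreal (K * Lg s powr (- \<gamma>))"
  shows "log_bounded \<gamma> r K f"
  using assms unfolding log_bounded_def by blast

lemma log_boundedD:
  fixes f :: "'a::euclidean_space \<Rightarrow> real"
  assumes "log_bounded \<gamma> r K f" "E \<in> sets borel" "0 < s" "emeasure lborel E = ennreal s"
  shows "mass f (E \<inter> ball z r) \<le> ennreal (K * Lg s powr (- \<gamma>))"
  using assms unfolding log_bounded_def by blast

lemma log_bounded_mono: "log_bounded \<gamma> r K f \<Longrightarrow> K \<le> K' \<Longrightarrow> log_bounded \<gamma> r K' f"
  unfolding log_bounded_def by (meson ennreal_leI mult_right_mono order_trans powr_ge_zero)

lemma log_bounded_zero: "log_bounded \<gamma> r K (\<lambda>x. 0)"
  by (simp add: log_bounded_def)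

lemma mass_le_of_log_bounded:
  assumes f: "log_bounded \<gamma> r K f" and [measurable]: "E \<in> sets borel"
    and E: "emeasure lborel E \<le> ennreal s" and s: "0 < s" and K: "0 \<le> K" and \<gamma>: "0 \<le> \<gamma>"
  shows "mass f (E \<inter> ball z r) \<le> ennreal (K * Lg s powr (- \<gamma>))"
proof (cases "emeasure lborel E = 0")
  case True
  then have "E \<inter> ball z r \<in> null_sets lborel"
    by (intro null_set_Int2) (auto simp: null_sets_def)
  then have "mass f (E \<inter> ball z r) = 0"
    by (rule nn_integral_null_set)
  then show ?thesis by simp
next
  case False
  obtain s' where s': "emeasure lborel E = ennreal s'" "0 \<le> s'"
    using E by (cases "emeasure lborel E") (auto simp: top_unique)
  then have le: "0 < s'" "s' \<le> s" using False E s by (auto simp: ennreal_le_iff less_le)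
  have "mass f (E \<inter> ball z r) \<le> ennreal (K * Lg s' powr (- \<gamma>))"
    using le s' by (intro log_boundedD[OF f]) auto
  also have "\<dots> \<le> ennreal (K * Lg s powr (- \<gamma>))"
    using le K \<gamma> by (intro ennreal_leI mult_left_mono Lg_powr_minus_mono) auto
  finally show ?thesis .
qed

lemma local_mass_le_of_log_bounded_small_radius:
  fixes f :: "'a::euclidean_space \<Rightarrow> real"
  assumes f: "log_bounded \<gamma> r K f" and r: "0 < r'" "r' \<le> r" and K: "0 \<le> K" and \<gamma>: "0 \<le> \<gamma>"
  shows "local_mass_le r' f (ennreal (K * Lg (unit_ball_vol (DIM('a)) * r' ^ DIM('a)) powr (- \<gamma>)))"
  unfolding local_mass_le_def
proof
  fix z :: 'a
  have "mass f (ball z r' \<inter> ball z r) \<le> ennreal (K * Lg (unit_ball_vol (DIM('a)) * r' ^ DIM('a)) powr (- \<gamma>))"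
    using r by (intro mass_le_of_log_bounded[OF f]) (auto simp: emeasure_ball K \<gamma>)
  moreover have "ball z r' \<inter> ball z r = ball z r'" using r by auto
  ultimately show "mass f (ball z r') \<le> ennreal (K * Lg (unit_ball_vol (DIM('a)) * r' ^ DIM('a)) powr (- \<gamma>))"
    by simp
qed

lemma local_mass_le_of_log_bounded:
  fixes f :: "'a::euclidean_space \<Rightarrow> real"
  assumes f: "log_bounded \<gamma> r K f" and r: "0 < r" and K: "0 \<le> K" and \<gamma>: "0 \<le> \<gamma>"
  shows "local_mass_le r f (ennreal K)"
proof -
  have "K * Lg (unit_ball_vol (DIM('a)) * r ^ DIM('a)) powr (- \<gamma>) \<le> K * 1"
    using K \<gamma> r by (intro mult_left_mono Lg_powr_minus_le_1) auto
  then show ?thesis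
    using local_mass_le_of_log_bounded_small_radius[OF f r order_refl K \<gamma>]
    unfolding local_mass_le_def by (auto intro: order_trans ennreal_leI)
qed

lemma log_bounded_add:
  fixes f g :: "'a::euclidean_space \<Rightarrow> real"
  assumes f: "log_bounded \<gamma> r K f" "0 \<le> K" and g: "log_bounded \<gamma> r K' g" "0 \<le> K'"
    and [measurable]: "f \<in> borel_measurable borel" "g \<in> borel_measurable borel"
    and h: "\<And>x. \<bar>h x\<bar> \<le> \<bar>f x\<bar> + \<bar>g x\<bar>"
  shows "log_bounded \<gamma> r (K + K') h"
proof (rule log_boundedI)
  fix z :: 'a and E :: "'a set" and s
  assume E[measurable]: "E \<in> sets borel" and s: "0 < s" "emeasure lborel E = ennreal s"
  have "mass h (E \<inter> ball z r) \<le>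
      (\<integral>\<^sup>+x. ennreal \<bar>f x\<bar> * indicator (E \<inter> ball z r) x + ennreal \<bar>g x\<bar> * indicator (E \<inter> ball z r) x \<partial>lborel)"
    using h by (intro nn_integral_mono)
      (auto simp: distrib_right[symmetric] ennreal_plus[symmetric] simp del: ennreal_plus
          intro!: mult_right_mono ennreal_leI)
  also have "\<dots> = mass f (E \<inter> ball z r) + mass g (E \<inter> ball z r)"
    by (rule nn_integral_add) measurable
  also have "\<dots> \<le> ennreal (K * Lg s powr (- \<gamma>)) + ennreal (K' * Lg s powr (- \<gamma>))"
    by (intro add_mono log_boundedD[OF f(1) E s] log_boundedD[OF g(1) E s])
  also have "\<dots> = ennreal ((K + K') * Lg s powr (- \<gamma>))"
    using f(2) g(2) by (simp add: distrib_right)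
  finally show "mass h (E \<inter> ball z r) \<le> ennreal ((K + K') * Lg s powr (- \<gamma>))" .
qed

lemma log_bounded_lim:
  fixes f :: "nat \<Rightarrow> 'a::euclidean_space \<Rightarrow> real"
  assumes f: "\<And>k. log_bounded \<gamma> r K (f k)" and [measurable]: "\<And>k. f k \<in> borel_measurable borel"
    and lim: "\<And>x. (\<lambda>k. f k x) \<longlonglongrightarrow> g x"
  shows "log_bounded \<gamma> r K g"
proof (rule log_boundedI)
  fix z :: 'a and E :: "'a set" and s
  assume E[measurable]: "E \<in> sets borel" and s: "0 < s" "emeasure lborel E = ennreal s"
  have g: "ennreal \<bar>g x\<bar> = liminf (\<lambda>k. ennreal \<bar>f k x\<bar>)" for x
    using tendsto_ennrealI[OF tendsto_rabs[OF lim[of x]]] by (intro lim_imp_Liminf[symmetric]) auto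
  have "mass g (E \<inter> ball z r) = (\<integral>\<^sup>+x. liminf (\<lambda>k. ennreal \<bar>f k x\<bar> * indicator (E \<inter> ball z r) x) \<partial>lborel)"
    unfolding g by (intro nn_integral_cong) (auto simp: indicator_def Liminf_const)
  also have "\<dots> \<le> liminf (\<lambda>k. mass (f k) (E \<inter> ball z r))"
    by (rule nn_integral_liminf) measurable
  also have "\<dots> \<le> liminf (\<lambda>k::nat. ennreal (K * Lg s powr (- \<gamma>)))"
    by (intro Liminf_mono always_eventually allI log_boundedD[OF f E s])
  also have "\<dots> = ennreal (K * Lg s powr (- \<gamma>))" by (rule Liminf_const) simp
  finally show "mass g (E \<inter> ball z r) \<le> ennreal (K * Lg s powr (- \<gamma>))" .
qed

lemma log_bounded_of_dominated:
  fixes g :: "'a::euclidean_space \<Rightarrow> real"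
  assumes "\<And>x. ennreal \<bar>g x\<bar> \<le> H x"
    and "\<And>z E s. E \<in> sets borel \<Longrightarrow> 0 < s \<Longrightarrow> emeasure lborel E = ennreal s \<Longrightarrow>
      (\<integral>\<^sup>+x\<in>E \<inter> ball z r. H x \<partial>lborel) \<le> ennreal (K * Lg s powr (- \<gamma>))"
  shows "log_bounded \<gamma> r K g"
proof (rule log_boundedI)
  fix z :: 'a and E :: "'a set" and s
  assume E: "E \<in> sets borel" "0 < s" "emeasure lborel E = ennreal s"
  have "mass g (E \<inter> ball z r) \<le> (\<integral>\<^sup>+x\<in>E \<inter> ball z r. H x \<partial>lborel)"
    by (intro nn_integral_mono mult_right_mono assms(1)) auto
  also note assms(2)[OF E]
  finally show "mass g (E \<inter> ball z r) \<le> ennreal (K * Lg s powr (- \<gamma>))" .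
qed

lemma log_bounded_of_bounded:
  fixes f :: "'a::euclidean_space \<Rightarrow> real"
  assumes f: "\<And>x. \<bar>f x\<bar> \<le> B" and r: "0 < r" and \<gamma>: "0 \<le> \<gamma>"
  defines "V \<equiv> unit_ball_vol (DIM('a)) * r ^ DIM('a)"
  shows "log_bounded \<gamma> r (mult_Lg_powr_const \<gamma> V * B) f"
proof (rule log_boundedI)
  fix z :: 'a and E :: "'a set" and s
  assume E[measurable]: "E \<in> sets borel" and s: "0 < s" "emeasure lborel E = ennreal s"
  define C where "C = mult_Lg_powr_const \<gamma> V"
  have V: "0 < V" using r by (simp add: V_def)
  have B: "0 \<le> B" using f[of 0] by linarith
  define m where "m = min s V"
  have m: "0 < m" "m \<le> V" "m \<le> s" using s V by (auto simp: m_def)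
  have "emeasure lborel (E \<inter> ball z r) \<le> ennreal m"
    using emeasure_mono[of "E \<inter> ball z r" E lborel] emeasure_mono[of "E \<inter> ball z r" "ball z r" lborel] r s
    by (auto simp: m_def min_def emeasure_ball V_def)
  moreover have "mass f (E \<inter> ball z r) \<le> (\<integral>\<^sup>+x. ennreal B * indicator (E \<inter> ball z r) x \<partial>lborel)"
    by (intro nn_integral_mono mult_right_mono ennreal_leI f) auto
  ultimately have "mass f (E \<inter> ball z r) \<le> ennreal B * ennreal m"
    by (auto simp: nn_integral_cmult_indicator elim!: order_trans intro: mult_left_mono)
  also have "\<dots> = ennreal (B * m)" using B m by (simp add: ennreal_mult)
  also have "\<dots> \<le> ennreal (C * B * Lg s powr (- \<gamma>))"
  proof (rule ennreal_leI)
    have "m \<le> C * Lg m powr (- \<gamma>)"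
      using mult_Lg_powr_le[OF \<gamma> m(1,2)] Lg_pos[OF m(1)] by (simp add: C_def powr_minus field_simps)
    also have "\<dots> \<le> C * Lg s powr (- \<gamma>)"
      using m \<gamma> by (intro mult_left_mono Lg_powr_minus_mono) (auto simp: C_def mult_Lg_powr_const_def)
    finally have "B * m \<le> B * (C * Lg s powr (- \<gamma>))" using B by (rule mult_left_mono)
    then show "B * m \<le> C * B * Lg s powr (- \<gamma>)" by (simp only: mult_ac)
  qed
  finally show "mass f (E \<inter> ball z r) \<le> ennreal (mult_Lg_powr_const \<gamma> V * B * Lg s powr (- \<gamma>))"
    by (simp add: C_def)
qed

section \<open>The norms\<close>

lemma mass_lebesgue_sets:
  fixes E :: "'a::euclidean_space set"
  assumes E: "E \<in> sets lebesgue"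
  obtains E' where "E' \<in> sets borel" "emeasure lborel E' = emeasure lebesgue E"
    "\<And>f F. mass f (E \<inter> F) = mass f (E' \<inter> F)"
proof
  let ?E' = "main_part lborel E"
  show "?E' \<in> sets borel" using main_part_sets[OF E] by simp
  show "emeasure lborel ?E' = emeasure lebesgue E" using E by simp
  fix f :: "'a \<Rightarrow> real" and F
  obtain Z where Z: "Z \<in> null_sets lborel" "null_part lborel E \<subseteq> Z" using null_part[OF E] by blast
  have "E = ?E' \<union> null_part lborel E" using E by simp
  then have "x \<in> E \<longleftrightarrow> x \<in> ?E'" if "x \<notin> Z" for x using that Z by auto
  with AE_not_in[OF Z(1)] show "mass f (E \<inter> F) = mass f (?E' \<inter> F)"
    by (intro nn_integral_cong_AE) (auto simp: indicator_def)
qed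

lemma triple_norm_1_eq:
  fixes f :: "'a::euclidean_space \<Rightarrow> real"
  shows "triple_norm 1 \<gamma> r f = (SUP z. SUP s\<in>{0<..}. SUP E\<in>{E \<in> sets lebesgue. emeasure lebesgue E = ennreal s}.
    ennreal (Lg s powr \<gamma>) * mass f (E \<inter> ball z r))"
proof -
  have "ennreal (\<bar>f x * indicator (ball z r) x\<bar> powr 1) * indicator E x
      = ennreal \<bar>f x\<bar> * indicator (E \<inter> ball z r) x" for x z E
    by (auto simp: indicator_def)
  moreover have "enn_root 1 y = y" for y
    unfolding enn_root_def by (cases y) (auto simp: top_ennreal.rep_eq)
  ultimately show ?thesis
    unfolding triple_norm_def LlogL_norm_def Lg_def nn_integral_completion SUP_mult_left_ennreal by simp
qed

lemma triple_norm_le_iff_log_bounded: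
  fixes f :: "'a::euclidean_space \<Rightarrow> real"
  assumes K: "0 \<le> K"
  shows "triple_norm 1 \<gamma> r f \<le> ennreal K \<longleftrightarrow> log_bounded \<gamma> r K f"
proof -
  have scale: "ennreal (Lg s powr \<gamma>) * X \<le> ennreal K \<longleftrightarrow> X \<le> ennreal (K * Lg s powr (- \<gamma>))" if "0 < s" for s X
    using Lg_pos[OF that] K
    by (cases X) (auto simp: ennreal_mult[symmetric] ennreal_mult_top powr_minus field_simps top_unique)
  have "log_bounded \<gamma> r K f \<longleftrightarrow> (\<forall>z. \<forall>s>0. \<forall>E\<in>{E \<in> sets lebesgue. emeasure lebesgue E = ennreal s}.
      mass f (E \<inter> ball z r) \<le> ennreal (K * Lg s powr (- \<gamma>)))"
  proof (intro iffI allI impI ballI)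
    fix z s and E :: "'a set"
    assume f: "log_bounded \<gamma> r K f" and s: "0 < s" and "E \<in> {E \<in> sets lebesgue. emeasure lebesgue E = ennreal s}"
    then have E: "E \<in> sets lebesgue" "emeasure lebesgue E = ennreal s" by auto
    obtain E' where "E' \<in> sets borel" "emeasure lborel E' = ennreal s"
      "mass f (E \<inter> ball z r) = mass f (E' \<inter> ball z r)"
      using mass_lebesgue_sets[OF E(1)] E(2) by metis
    then show "mass f (E \<inter> ball z r) \<le> ennreal (K * Lg s powr (- \<gamma>))"
      using log_boundedD[OF f _ s] by simp
  qed (auto simp: log_bounded_def)
  then show ?thesis
    unfolding triple_norm_1_eq SUP_le_iff by (auto simp: scale)
qed

lemma ul_norm_le: "log_bounded \<gamma> 1 K f \<Longrightarrow> 0 \<le> K \<Longrightarrow> ul_norm 1 \<gamma> f \<le> ennreal K"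
  by (simp add: ul_norm_def triple_norm_le_iff_log_bounded)

lemma triple_norm_cong_AE:
  fixes f g :: "'a::euclidean_space \<Rightarrow> real"
  assumes "AE x in lborel. f x = g x"
  shows "triple_norm 1 \<gamma> r f = triple_norm 1 \<gamma> r g"
proof -
  have "mass f (E \<inter> ball z r) = mass g (E \<inter> ball z r)" for E z
    using assms by (intro nn_integral_cong_AE) auto
  then show ?thesis unfolding triple_norm_1_eq by simp
qed

lemma ul_norm_le_of_bounded:
  fixes f :: "'a::euclidean_space \<Rightarrow> real"
  assumes f: "\<And>x. \<bar>f x\<bar> \<le> B" and \<gamma>: "0 \<le> \<gamma>"
  shows "ul_norm 1 \<gamma> f \<le> ennreal (mult_Lg_powr_const \<gamma> (unit_ball_vol (DIM('a))) * B)"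
proof (rule ul_norm_le)
  show "log_bounded \<gamma> 1 (mult_Lg_powr_const \<gamma> (unit_ball_vol (DIM('a))) * B) f"
    using log_bounded_of_bounded[OF f _ \<gamma>, of 1] by simp
  show "0 \<le> mult_Lg_powr_const \<gamma> (unit_ball_vol (DIM('a))) * B"
    using f[of 0] by (intro mult_nonneg_nonneg) (auto simp: mult_Lg_powr_const_def)
qed

lemma ul_norm_tendsto_0_of_uniform_limit:
  fixes f :: "'b \<Rightarrow> 'a::euclidean_space \<Rightarrow> real"
  assumes f: "uniform_limit UNIV f g F" and \<gamma>: "0 \<le> \<gamma>"
  shows "((\<lambda>s. ul_norm 1 \<gamma> (\<lambda>x. f s x - g x)) \<longlongrightarrow> 0) F"
proof (rule tendsto_zero_ennreal)
  define C where "C = mult_Lg_powr_const \<gamma> (unit_ball_vol (real (DIM('a))))"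
  have C: "0 \<le> C" by (simp add: C_def mult_Lg_powr_const_def)
  fix r :: real assume r: "0 < r"
  define e where "e = r / (C + 1)"
  have e: "0 < e" "C * e < r" using r C by (auto simp: e_def divide_less_eq algebra_simps)
  from uniform_limitD[OF f e(1)] show "\<forall>\<^sub>F s in F. ul_norm 1 \<gamma> (\<lambda>x. f s x - g x) < ennreal r"
  proof eventually_elim
    case (elim s)
    then have "\<bar>f s x - g x\<bar> \<le> e" for x by (auto simp: dist_real_def less_imp_le)
    then have "ul_norm 1 \<gamma> (\<lambda>x. f s x - g x) \<le> ennreal (C * e)"
      unfolding C_def by (rule ul_norm_le_of_bounded) (rule \<gamma>)
    also have "\<dots> < ennreal r" using r e by (intro ennreal_lessI) auto
    finally show ?case .
  qed
qed

lemma Linf_norm_le: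
  fixes f :: "'a::euclidean_space \<Rightarrow> real"
  assumes "f \<in> borel_measurable borel" "\<And>x. \<bar>f x\<bar> \<le> B"
  shows "Linf_norm f \<le> ereal B"
  unfolding Linf_norm_def
proof (rule esssup_I)
  show "(\<lambda>x. ereal \<bar>f x\<bar>) \<in> borel_measurable lebesgue"
    using assms(1) by (intro measurable_completion) measurable
qed (use assms(2) in auto)

lemma locally_integrable_bounded:
  fixes f :: "'a::euclidean_space \<Rightarrow> real"
  assumes f[measurable]: "f \<in> borel_measurable borel" and B: "\<And>x. \<bar>f x\<bar> \<le> B"
  shows "locally_integrable f"
  unfolding locally_integrable_def
proof (intro conjI allI impI)
  show "f \<in> borel_measurable lebesgue" by (intro measurable_completion) simp
  fix K :: "'a set" assume K: "compact K"
  then have [measurable]: "K \<in> sets borel" by (rule borel_compact)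
  have "integrable lborel (\<lambda>x. indicator K x *\<^sub>R f x)"
    using B emeasure_compact_finite[OF K] by (intro integrableI_bounded_set_indicator) auto
  then show "set_integrable lebesgue K f"
    unfolding set_integrable_def by (subst integrable_completion) auto
qed

lemma ul_space_bounded:
  fixes f :: "'a::euclidean_space \<Rightarrow> real"
  assumes f: "f \<in> borel_measurable borel" "\<And>x. \<bar>f x\<bar> \<le> B" and \<gamma>: "0 \<le> \<gamma>"
  shows "f \<in> ul_space 1 \<gamma>"
  using locally_integrable_bounded[OF f] ul_norm_le_of_bounded[of f B, OF f(2) \<gamma>]
  by (auto simp: ul_space_def intro: le_less_trans)

lemma continuous_on_test_fun:
  assumes "test_fun \<psi>"
  shows "continuous_on UNIV \<psi>"
proof -
  have "smooth_fun \<psi>" using assms by (simp add: test_fun_def)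
  from this[unfolded smooth_fun_def, rule_format, of "[]"] show ?thesis by simp
qed

lemma test_fun_boundedE:
  fixes \<psi> :: "'a::euclidean_space \<Rightarrow> real"
  assumes \<psi>: "test_fun \<psi>"
  obtains B R where "\<And>x. \<bar>\<psi> x\<bar> \<le> B" "\<And>x. R \<le> norm x \<Longrightarrow> \<psi> x = 0"
proof -
  have compact: "compact (closure {x. \<psi> x \<noteq> 0})" using \<psi> by (simp add: test_fun_def)
  obtain R where R: "\<And>x. x \<in> closure {x. \<psi> x \<noteq> 0} \<Longrightarrow> norm x < R"
    using compact_imp_bounded[OF compact] unfolding bounded_pos_less by blast
  have "bounded (\<psi> ` closure {x. \<psi> x \<noteq> 0})"
    using continuous_on_subset[OF continuous_on_test_fun[OF \<psi>]] compact
    by (intro compact_imp_bounded compact_continuous_image) auto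
  then obtain B where B: "0 < B" "\<forall>y\<in>\<psi> ` closure {x. \<psi> x \<noteq> 0}. norm y \<le> B"
    unfolding bounded_pos by blast
  show ?thesis
  proof
    show "\<bar>\<psi> x\<bar> \<le> B" for x
      using B subsetD[OF closure_subset, of x "{x. \<psi> x \<noteq> 0}"] by (cases "\<psi> x = 0") auto
    show "\<psi> x = 0" if "R \<le> norm x" for x
      using R[OF subsetD[OF closure_subset], of x] that by (cases "\<psi> x = 0") auto
  qed
qed

section \<open>The critical nonlinearity\<close>

lemma emeasure_superlevel_le:
  fixes f :: "'a::euclidean_space \<Rightarrow> real"
  assumes [measurable]: "f \<in> borel_measurable borel" "A \<in> sets borel"
    and c: "0 < c" and K: "0 \<le> K" "mass f A \<le> ennreal K"
  shows "emeasure lborel ({x. c < \<bar>f x\<bar>} \<inter> A) \<le> ennreal (K / c)"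
proof -
  have "emeasure lborel ({x. c < \<bar>f x\<bar>} \<inter> A) \<le> emeasure lborel {x \<in> A. 1 \<le> ennreal (1 / c) * ennreal \<bar>f x\<bar>}"
    using c by (intro emeasure_mono) (auto simp: ennreal_mult[symmetric])
  also have "\<dots> \<le> ennreal (1 / c) * mass f A"
    by (rule nn_integral_Markov_inequality) measurable
  also have "\<dots> \<le> ennreal (1 / c) * ennreal K" by (intro mult_left_mono K) simp
  finally show ?thesis using c K by (simp add: ennreal_mult[symmetric])
qed

lemma mass_powr_mult_le:
  fixes w h :: "'a::euclidean_space \<Rightarrow> real"
  assumes [measurable]: "w \<in> borel_measurable borel" "h \<in> borel_measurable borel" "A \<in> sets borel"
    and q: "0 \<le> q" and B: "\<And>x. \<bar>w x\<bar> \<le> B"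
  shows "mass (\<lambda>x. \<bar>w x\<bar> powr q * h x) A
    \<le> ennreal (c powr q) * mass h A + ennreal (B powr q) * mass h ({x. c < \<bar>w x\<bar>} \<inter> A)"
proof -
  let ?E = "{x. c < \<bar>w x\<bar>} \<inter> A"
  have "ennreal \<bar>\<bar>w x\<bar> powr q * h x\<bar> * indicator A x
      \<le> ennreal (c powr q) * (ennreal \<bar>h x\<bar> * indicator A x)
          + ennreal (B powr q) * (ennreal \<bar>h x\<bar> * indicator ?E x)" for x
  proof (cases "x \<in> A")
    case True
    have "\<bar>w x\<bar> powr q \<le> (if x \<in> ?E then B powr q else c powr q)"
      using True q B[of x] by (auto intro!: powr_mono2)
    then have "ennreal (\<bar>w x\<bar> powr q) * ennreal \<bar>h x\<bar>
        \<le> ennreal (if x \<in> ?E then B powr q else c powr q) * ennreal \<bar>h x\<bar>"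
      by (intro mult_right_mono ennreal_leI) auto
    with True show ?thesis
      by (cases "x \<in> ?E") (auto simp: abs_mult ennreal_mult intro: add_increasing add_increasing2)
  qed simp
  then have "mass (\<lambda>x. \<bar>w x\<bar> powr q * h x) A \<le>
      (\<integral>\<^sup>+x. ennreal (c powr q) * (ennreal \<bar>h x\<bar> * indicator A x)
          + ennreal (B powr q) * (ennreal \<bar>h x\<bar> * indicator ?E x) \<partial>lborel)"
    by (rule nn_integral_mono)
  also have "\<dots> = ennreal (c powr q) * mass h A + ennreal (B powr q) * mass h ?E"
    by (subst nn_integral_add) (auto simp: nn_integral_cmult)
  finally show ?thesis .
qed

context fractional_heat
begin

abbreviation p :: real where "p \<equiv> 1 + 1 / N"

definition decay_rate :: "real \<Rightarrow> real" where
  "decay_rate t = t powr (- N) * Lg t powr (- N)"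

definition source_rate :: "real \<Rightarrow> real" where
  "source_rate t = t powr (- 1) * Lg t powr (- N - 1)"

lemma borel_measurable_source_rate [measurable]: "source_rate \<in> borel_measurable borel"
  unfolding source_rate_def by measurable

lemma decay_rate_nonneg: "0 \<le> decay_rate t"
  by (simp add: decay_rate_def)

lemma source_rate_nonneg: "0 \<le> source_rate t"
  by (simp add: source_rate_def)

lemma decay_rate_powr: "decay_rate t powr (1 / N) = t powr (- 1) * Lg t powr (- 1)"
  using N_pos by (simp add: decay_rate_def powr_mult powr_powr)

lemma source_rate_eq: "source_rate t = t powr (- 1) * Lg t powr (- 1) * Lg t powr (- N)"
  unfolding source_rate_def mult.assoc powr_add[symmetric] by (simp only: diff_conv_add_uminus add.commute)

lemma decay_rate_powr_mult: "decay_rate t powr (1 / N) * decay_rate t = t powr (- N) * source_rate t"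
  unfolding decay_rate_powr source_rate_eq by (simp add: decay_rate_def)

lemma powr_minus_mult_source_rate: "s powr (- N) * source_rate s = s powr (- N - 1) * Lg s powr (- N - 1)"
  unfolding source_rate_def mult.assoc[symmetric] powr_add[symmetric] by (simp only: diff_conv_add_uminus)

lemma powr_minus_mult_source_rate_le:
  assumes "0 < s"
  shows "s powr (- N) * source_rate s \<le> s powr (- N - 1)"
  unfolding powr_minus_mult_source_rate using Lg_powr_minus_le_1[OF assms, of "N + 1"] N_pos
  by (simp add: mult_left_le)

definition critical_product_const :: "real \<Rightarrow> real" where
  "critical_product_const S = 1 + Lg_comp_const N (N + N * N) S powr N"

lemma critical_product_const_ge_1: "1 \<le> critical_product_const S"
  by (simp add: critical_product_const_def)

text \<open>Split at the level \<open>|w| = K s\<^bsup>-N\<^esup> L(s)\<^bsup>-N-N*N\<^esup>\<close>: below it the factor \<open>|w|\<^bsup>1/N\<^esup>\<close> supplies the missing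
  logarithms, above it the set is so small that the logarithmic bound on \<open>h\<close> supplies them.\<close>

lemma local_mass_powr_mult:
  fixes w h :: "'a \<Rightarrow> real"
  assumes [measurable]: "w \<in> borel_measurable borel" "h \<in> borel_measurable borel"
    and w: "log_bounded N r K w" "0 < K" and h: "log_bounded N r d h" "0 \<le> d" and r: "0 < r"
    and s: "0 < s" "s \<le> S" and sup: "\<And>x. \<bar>w x\<bar> \<le> K * decay_rate s"
  shows "local_mass_le r (\<lambda>x. \<bar>w x\<bar> powr (1 / N) * h x)
    (ennreal (critical_product_const S * K powr (1 / N) * d * source_rate s))"
  unfolding local_mass_le_def
proof
  fix z
  define c m where "c = K * (s powr (- N) * Lg s powr (- (N + N * N)))" and "m = s powr N * Lg s powr (N + N * N)"
  have L: "0 < Lg s" using Lg_pos s by simp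
  have c: "0 < c" and m: "0 < m" using w(2) s L by (auto simp: c_def m_def)
  have K_c: "K / c = m" using w(2) s L unfolding c_def m_def powr_minus by (simp add: field_simps)
  define a b where "a = K powr (1 / N) * source_rate s" and "b = K powr (1 / N) * (s powr (- 1) * Lg s powr (- 1))"
  have ab: "0 \<le> a" "0 \<le> b" by (auto simp: a_def b_def source_rate_nonneg)
  have "- N * (1 / N) = - 1" "- (N + N * N) * (1 / N) = - N - 1" using N_pos by (auto simp: field_simps)
  then have c_powr: "c powr (1 / N) = a" by (simp only: c_def a_def source_rate_def powr_mult powr_powr)
  have sup_powr: "(K * decay_rate s) powr (1 / N) = b" by (simp add: b_def powr_mult decay_rate_powr)
  define E where "E = {x. c < \<bar>w x\<bar>} \<inter> ball z r"
  have [measurable]: "E \<in> sets borel" unfolding E_def by measurable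
  define e where "e = Lg_comp_const N (N + N * N) S powr N * Lg s powr (- N)"
  have "emeasure lborel E \<le> ennreal m"
    using local_mass_le_of_log_bounded[OF w(1) r] w(2) c N_pos unfolding E_def K_c[symmetric]
    by (intro emeasure_superlevel_le) (auto simp: local_mass_le_def)
  then have "mass h (E \<inter> ball z r) \<le> ennreal (d * Lg m powr (- N))"
    using N_pos m h by (intro mass_le_of_log_bounded) auto
  also have "\<dots> \<le> ennreal (d * e)"
    unfolding e_def m_def using N_pos s h L Lg_comp_const_pos[of N "N + N * N" S]
    by (intro ennreal_leI mult_left_mono powr_minus_le_of_le_mult Lg_le_comp) (auto simp: add_nonneg_nonneg)
  also have "E \<inter> ball z r = E" by (auto simp: E_def)
  finally have h_E: "mass h E \<le> ennreal (d * e)" .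
  have "mass (\<lambda>x. \<bar>w x\<bar> powr (1 / N) * h x) (ball z r) \<le> ennreal a * mass h (ball z r) + ennreal b * mass h E"
    unfolding E_def c_powr[symmetric] sup_powr[symmetric] using N_pos sup by (intro mass_powr_mult_le) auto
  also have "\<dots> \<le> ennreal a * ennreal d + ennreal b * ennreal (d * e)"
    using local_mass_le_of_log_bounded[OF h(1) r h(2)] N_pos h_E
    by (intro add_mono mult_left_mono) (auto simp: local_mass_le_def)
  also have "\<dots> = ennreal (a * d + b * (d * e))"
    using ab h by (simp add: ennreal_mult[symmetric] e_def)
  also have "a * d + b * (d * e) = critical_product_const S * K powr (1 / N) * d * source_rate s"
    by (simp add: a_def b_def e_def critical_product_const_def source_rate_eq algebra_simps)
  finally show "mass (\<lambda>x. \<bar>w x\<bar> powr (1 / N) * h x) (ball z r)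
      \<le> ennreal (critical_product_const S * K powr (1 / N) * d * source_rate s)" .
qed

section \<open>The Duhamel integral of absolute values\<close>

abbreviation jointly_measurable :: "('a \<Rightarrow> real \<Rightarrow> real) \<Rightarrow> bool" where
  "jointly_measurable f \<equiv> case_prod f \<in> borel_measurable (borel \<Otimes>\<^sub>M borel)"

definition duhamel_abs :: "('a \<Rightarrow> real \<Rightarrow> real) \<Rightarrow> 'a \<Rightarrow> real \<Rightarrow> ennreal" where
  "duhamel_abs f x t = (\<integral>\<^sup>+s\<in>{0<..<t}. heat_abs (\<lambda>y. f y s) (t - s) x \<partial>lborel)"

lemma nn_integral_duhamel_abs:
  assumes [measurable]: "jointly_measurable f" "E \<in> sets borel"
  shows "(\<integral>\<^sup>+x\<in>E. duhamel_abs f x t \<partial>lborel)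
    = (\<integral>\<^sup>+s\<in>{0<..<t}. (\<integral>\<^sup>+x\<in>E. heat_abs (\<lambda>y. f y s) (t - s) x \<partial>lborel) \<partial>lborel)"
proof -
  let ?F = "\<lambda>x s. heat_abs (\<lambda>y. f y s) (t - s) x"
  have "(\<integral>\<^sup>+x\<in>E. duhamel_abs f x t \<partial>lborel) = (\<integral>\<^sup>+x. \<integral>\<^sup>+s. ?F x s * indicator {0<..<t} s * indicator E x \<partial>lborel \<partial>lborel)"
    unfolding duhamel_abs_def by (subst nn_integral_multc) auto
  also have "\<dots> = (\<integral>\<^sup>+s. \<integral>\<^sup>+x. ?F x s * indicator {0<..<t} s * indicator E x \<partial>lborel \<partial>lborel)"
    by (rule lborel_pair.Fubini') measurable
  moreover have "(\<integral>\<^sup>+x. ?F x s * indicator {0<..<t} s * indicator E x \<partial>lborel)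
      = (\<integral>\<^sup>+x\<in>E. ?F x s \<partial>lborel) * indicator {0<..<t} s" for s
    by (subst nn_integral_multc[symmetric]) (auto simp: mult_ac)
  ultimately show ?thesis by simp
qed

end

locale bounded_horizon = fractional_heat \<theta> N space_type
  for \<theta> N :: real and space_type :: "'a::euclidean_space itself" +
  fixes S :: real
  assumes S_pos: "0 < S"
begin

definition source_const :: real where
  "source_const = (exp 1 * S + 1) / N"

lemma source_const_pos: "0 < source_const"
  using S_pos N_pos by (simp add: source_const_def add_pos_pos)

lemma nn_integral_source_rate:
  "0 < t \<Longrightarrow> t \<le> S \<Longrightarrow> (\<integral>\<^sup>+s\<in>{0<..<t}. ennreal (source_rate s) \<partial>lborel) \<le> ennreal (source_const * Lg t powr (- N))"
  unfolding source_rate_def source_const_def by (rule nn_integral_Lg_powr_div_le[OF N_pos])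

lemma nn_integral_source_rate_le_const:
  assumes "0 < t" "t \<le> S"
  shows "(\<integral>\<^sup>+s\<in>{0<..<t}. ennreal (source_rate s) \<partial>lborel) \<le> ennreal source_const"
proof -
  have "source_const * Lg t powr (- N) \<le> source_const"
    using source_const_pos Lg_powr_minus_le_1[OF assms(1), of N] N_pos by (simp add: mult_left_le)
  then show ?thesis
    using nn_integral_source_rate[OF assms] by (auto intro: order_trans ennreal_leI)
qed

definition duhamel_sup_const :: real where
  "duhamel_sup_const = 2 powr N * (smoothing_const * source_const + 1)"

definition duhamel_mass_const :: real where
  "duhamel_mass_const = source_const * (Lg 1 powr N + Lg_comp_const (1 / N) 1 1 powr N) + 1 / N"

end

locale critical_problem = bounded_horizon \<theta> N space_type S
  for \<theta> N :: real and space_type :: "'a::euclidean_space itself" and S :: real +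
  fixes T :: real
  assumes T: "0 < T" "T \<le> S"
begin

abbreviation \<rho> :: real where "\<rho> \<equiv> T powr (1 / \<theta>)"

definition source_bound :: "real \<Rightarrow> ('a \<Rightarrow> real \<Rightarrow> real) \<Rightarrow> bool" where
  "source_bound M f \<longleftrightarrow> (\<forall>s\<in>{0<..<T}. local_mass_le \<rho> (\<lambda>y. f y s) (ennreal (M * source_rate s)) \<and>
     (\<forall>y. \<bar>f y s\<bar> \<le> M * (s powr (- N) * source_rate s)))"

lemma source_bound_massD:
  "source_bound M f \<Longrightarrow> 0 < s \<Longrightarrow> s < T \<Longrightarrow> local_mass_le \<rho> (\<lambda>y. f y s) (ennreal (M * source_rate s))"
  by (simp add: source_bound_def)

lemma heat_abs_source_le_sup:
  assumes [measurable]: "jointly_measurable f" and f: "source_bound M f" and s: "0 < s" "s < T" and t: "0 < t"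
  shows "heat_abs (\<lambda>y. f y s) t x \<le> ennreal (M * (s powr (- N) * source_rate s))"
  using f s by (intro heat_abs_le_sup t) (auto simp: source_bound_def)

lemma heat_abs_source_smoothing:
  assumes [measurable]: "jointly_measurable f" and f: "source_bound M f" and M: "0 \<le> M"
    and s: "0 < s" "s < T" and \<eta>: "0 < \<eta>" "\<eta> \<le> T" "\<eta> \<le> t"
  shows "heat_abs (\<lambda>y. f y s) t x \<le> ennreal (smoothing_const * \<eta> powr (- N) * M * source_rate s)"
proof -
  have "local_mass_le (\<eta> powr (1 / \<theta>)) (\<lambda>y. f y s) (ennreal (M * source_rate s))"
    by (rule local_mass_le_smaller_radius[OF source_bound_massD[OF f s] powr_inverse_theta_mono[OF \<eta>(1,2)]])
  then have "heat_abs (\<lambda>y. f y s) t x \<le> ennreal (smoothing_const * \<eta> powr (- N)) * ennreal (M * source_rate s)"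
    by (intro heat_abs_smoothing \<eta>) auto
  then show ?thesis
    using M by (simp add: ennreal_mult[symmetric] smoothing_const_nonneg source_rate_nonneg mult_ac)
qed

lemma nn_integral_heat_abs_source_le:
  assumes [measurable]: "jointly_measurable f" "E \<in> sets borel"
    and f: "source_bound M f" and s: "0 < s" "s < T" "s < t"
  shows "(\<integral>\<^sup>+x\<in>E \<inter> ball z \<rho>. heat_abs (\<lambda>y. f y s) (t - s) x \<partial>lborel) \<le> ennreal (M * source_rate s)"
proof (rule nn_integral_heat_abs_le)
  fix w
  have "mass (\<lambda>x. f (x - w) s) (E \<inter> ball z \<rho>) = mass (\<lambda>x. f x s) ((+) w -` (E \<inter> ball z \<rho>))"
    by (rule mass_translate) measurable
  then show "mass (\<lambda>x. f (x - w) s) (E \<inter> ball z \<rho>) \<le> ennreal (M * source_rate s)"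
    using local_mass_leD[OF source_bound_massD[OF f s(1,2)]] by (simp add: vimage_Int vimage_plus_ball)
qed (use s in auto)

lemma nn_integral_duhamel_abs_le:
  assumes f[measurable]: "jointly_measurable f" and E[measurable]: "E \<in> sets borel"
    and src: "source_bound M f" and M: "0 \<le> M" and t: "0 < t" "t < T"
  shows "(\<integral>\<^sup>+x\<in>E \<inter> ball z \<rho>. duhamel_abs f x t \<partial>lborel) \<le> ennreal (source_const * M * Lg t powr (- N))"
proof -
  have "(\<integral>\<^sup>+x\<in>E \<inter> ball z \<rho>. duhamel_abs f x t \<partial>lborel)
      = (\<integral>\<^sup>+s\<in>{0<..<t}. (\<integral>\<^sup>+x\<in>E \<inter> ball z \<rho>. heat_abs (\<lambda>y. f y s) (t - s) x \<partial>lborel) \<partial>lborel)"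
    by (rule nn_integral_duhamel_abs) measurable
  also have "\<dots> \<le> (\<integral>\<^sup>+s. ennreal M * (ennreal (source_rate s) * indicator {0<..<t} s) \<partial>lborel)"
    using nn_integral_heat_abs_source_le[OF f E src, of _ t z] t M
    by (intro nn_integral_mono) (auto simp: indicator_def ennreal_mult[symmetric] source_rate_nonneg)
  also have "\<dots> = ennreal M * (\<integral>\<^sup>+s\<in>{0<..<t}. ennreal (source_rate s) \<partial>lborel)"
    by (rule nn_integral_cmult) measurable
  also have "\<dots> \<le> ennreal M * ennreal (source_const * Lg t powr (- N))"
    using t T by (intro mult_left_mono nn_integral_source_rate) auto
  also have "\<dots> = ennreal (source_const * M * Lg t powr (- N))"
    using M source_const_pos by (simp add: ennreal_mult[symmetric] mult_ac)
  finally show ?thesis .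
qed

lemma heat_abs_source_le_second_half:
  assumes f: "jointly_measurable f" "source_bound M f" and M: "0 \<le> M"
    and t: "0 < t" "t < T" and s: "t / 2 \<le> s" "s < t"
  shows "heat_abs (\<lambda>y. f y s) (t - s) x \<le> ennreal (M * ((t / 2) powr (- N - 1) * Lg t powr (- N)))"
proof -
  have s0: "0 < s" using s t by simp
  have "Lg s powr (- N - 1) \<le> Lg s powr (- N)" using Lg_ge_1[OF s0] by (intro powr_mono) auto
  also have "\<dots> \<le> Lg t powr (- N)" using s s0 N_pos by (intro Lg_powr_minus_mono) auto
  finally have "s powr (- N) * source_rate s \<le> (t / 2) powr (- N - 1) * Lg t powr (- N)"
    unfolding powr_minus_mult_source_rate using s t N_pos by (intro mult_mono powr_mono2') auto
  then have "M * (s powr (- N) * source_rate s) \<le> M * ((t / 2) powr (- N - 1) * Lg t powr (- N))"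
    using M by (rule mult_left_mono)
  then show ?thesis
    using heat_abs_source_le_sup[OF f s0, of "t - s" x] s t by (auto intro: order_trans ennreal_leI)
qed

text \<open>Before \<open>t / 2\<close> the local mass of the source is smoothed, after \<open>t / 2\<close> its supremum is used.\<close>

lemma duhamel_abs_le_sup:
  assumes f[measurable]: "jointly_measurable f" and src: "source_bound M f" and M: "0 \<le> M" and t: "0 < t" "t < T"
  shows "duhamel_abs f x t \<le> ennreal (duhamel_sup_const * M * decay_rate t)"
proof -
  define A B where "A = smoothing_const * (t / 2) powr (- N) * M"
    and "B = M * ((t / 2) powr (- N - 1) * Lg t powr (- N))"
  have AB: "0 \<le> A" "0 \<le> B" using smoothing_const_nonneg M by (auto simp: A_def B_def)
  have late: "heat_abs (\<lambda>y. f y s) (t - s) x \<le> ennreal B" if "t / 2 \<le> s" "s < t" for s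
    unfolding B_def by (rule heat_abs_source_le_second_half[OF f src M t that])
  have early: "heat_abs (\<lambda>y. f y s) (t - s) x \<le> ennreal A * ennreal (source_rate s)" if s: "0 < s" "s < t / 2" for s
    using heat_abs_source_smoothing[OF f src M s(1), of "t / 2" "t - s" x] s t AB(1)
    by (simp add: A_def ennreal_mult[symmetric] source_rate_nonneg)
  have "heat_abs (\<lambda>y. f y s) (t - s) x * indicator {0<..<t} s
      \<le> ennreal A * (ennreal (source_rate s) * indicator {0<..<t} s) + ennreal B * indicator {t/2..t} s" for s
    using early[of s] late[of s]
    by (cases "s < t / 2") (auto simp: indicator_def intro: add_increasing add_increasing2)
  then have "duhamel_abs f x t \<le>
      (\<integral>\<^sup>+s. ennreal A * (ennreal (source_rate s) * indicator {0<..<t} s)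
          + ennreal B * indicator {t/2..t} s \<partial>lborel)"
    unfolding duhamel_abs_def by (rule nn_integral_mono)
  also have "\<dots> = ennreal A * (\<integral>\<^sup>+s\<in>{0<..<t}. ennreal (source_rate s) \<partial>lborel) + ennreal B * ennreal (t / 2)"
    using t by (subst nn_integral_add) (auto simp: nn_integral_cmult nn_integral_cmult_indicator)
  also have "\<dots> \<le> ennreal A * ennreal (source_const * Lg t powr (- N)) + ennreal B * ennreal (t / 2)"
    using t T by (intro add_right_mono mult_left_mono nn_integral_source_rate) auto
  also have "\<dots> = ennreal (A * (source_const * Lg t powr (- N)) + B * (t / 2))"
    using AB t source_const_pos by (simp add: ennreal_mult[symmetric] ennreal_plus[symmetric] del: ennreal_plus)
  also have "A * (source_const * Lg t powr (- N)) + B * (t / 2) = duhamel_sup_const * M * decay_rate t"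
  proof -
    have half: "(t / 2) powr (- N) = 2 powr N * t powr (- N)" using t by (simp add: powr_divide powr_minus_divide)
    have "(t / 2) powr (- N - 1) * (t / 2) = (t / 2) powr (- N)"
      using t powr_add[of "t / 2" "- N - 1" 1] by simp
    then have "B * (t / 2) = M * ((t / 2) powr (- N) * Lg t powr (- N))" by (simp add: B_def mult_ac)
    then show ?thesis by (simp add: A_def duhamel_sup_const_def decay_rate_def half algebra_simps)
  qed
  finally show ?thesis .
qed

lemma nn_integral_heat_abs_source_le_measure:
  assumes f[measurable]: "jointly_measurable f" and [measurable]: "E \<in> sets borel"
    and src: "source_bound M f" and M: "0 \<le> M" and s: "0 < s" "s < T" "s < t"
    and \<sigma>: "0 < \<sigma>" "emeasure lborel E = ennreal \<sigma>"
  shows "(\<integral>\<^sup>+x\<in>E \<inter> ball z \<rho>. heat_abs (\<lambda>y. f y s) (t - s) x \<partial>lborel) \<le> ennreal (M * \<sigma>) * ennreal (s powr (- N - 1))"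
proof -
  have "(\<integral>\<^sup>+x\<in>E \<inter> ball z \<rho>. heat_abs (\<lambda>y. f y s) (t - s) x \<partial>lborel)
      \<le> (\<integral>\<^sup>+x. ennreal (M * s powr (- N - 1)) * indicator E x \<partial>lborel)"
  proof (rule nn_integral_mono)
    fix x
    have "M * (s powr (- N) * source_rate s) \<le> M * s powr (- N - 1)"
      by (intro mult_left_mono powr_minus_mult_source_rate_le s M)
    then have "heat_abs (\<lambda>y. f y s) (t - s) x \<le> ennreal (M * s powr (- N - 1))"
      using heat_abs_source_le_sup[OF f src s(1,2), of "t - s" x] s(3)
      by (auto intro: order_trans ennreal_leI)
    then show "heat_abs (\<lambda>y. f y s) (t - s) x * indicator (E \<inter> ball z \<rho>) x
        \<le> ennreal (M * s powr (- N - 1)) * indicator E x"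
      by (auto simp: indicator_def)
  qed
  also have "\<dots> = ennreal (M * s powr (- N - 1)) * ennreal \<sigma>"
    by (simp add: nn_integral_cmult_indicator \<sigma>)
  also have "\<dots> = ennreal (M * \<sigma>) * ennreal (s powr (- N - 1))"
    using M \<sigma> by (simp add: ennreal_mult[symmetric] mult_ac)
  finally show ?thesis .
qed

text \<open>The time integral is split at \<open>s = \<sigma>\<^bsup>1/N\<^esup> L(\<sigma>)\<close>: the local mass is used before, the supremum after.\<close>

lemma nn_integral_duhamel_abs_le_small_sets:
  assumes f[measurable]: "jointly_measurable f" and E[measurable]: "E \<in> sets borel"
    and src: "source_bound M f" and M: "0 \<le> M" and t: "0 < t" "t < T"
    and \<sigma>: "0 < \<sigma>" "\<sigma> \<le> 1" "emeasure lborel E = ennreal \<sigma>"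
  shows "(\<integral>\<^sup>+x\<in>E \<inter> ball z \<rho>. duhamel_abs f x t \<partial>lborel)
    \<le> ennreal ((source_const * Lg_comp_const (1 / N) 1 1 powr N + 1 / N) * M * Lg \<sigma> powr (- N))"
proof -
  have L: "0 < Lg \<sigma>" using \<sigma> Lg_pos by simp
  define s0 a where "s0 = \<sigma> powr (1 / N) * Lg \<sigma>" and "a = min s0 t"
  have a: "0 < s0" "0 < a" "a \<le> s0" "a \<le> S" using \<sigma> L t T by (auto simp: s0_def a_def)
  have s0_powr: "\<sigma> * s0 powr (- N) = Lg \<sigma> powr (- N)"
    using \<sigma> L N_pos by (simp add: s0_def powr_mult powr_powr powr_minus)
  have "Lg a powr (- N) \<le> Lg s0 powr (- N)" using a N_pos by (intro Lg_powr_minus_mono) auto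
  also have "\<dots> \<le> Lg_comp_const (1 / N) 1 1 powr N * Lg \<sigma> powr (- N)"
    using Lg_le_comp[of "1 / N" 1 \<sigma> 1] Lg_comp_const_pos[of "1 / N" 1 1] N_pos \<sigma> L
    by (intro powr_minus_le_of_le_mult) (auto simp: s0_def)
  finally have Lg_a: "Lg a powr (- N) \<le> Lg_comp_const (1 / N) 1 1 powr N * Lg \<sigma> powr (- N)" .
  let ?F = "\<lambda>s. \<integral>\<^sup>+x\<in>E \<inter> ball z \<rho>. heat_abs (\<lambda>y. f y s) (t - s) x \<partial>lborel"
  have "?F s * indicator {0<..<t} s \<le> ennreal M * (ennreal (source_rate s) * indicator {0<..<a} s) +
      ennreal (M * \<sigma>) * (ennreal (s powr (- N - 1)) * indicator {s0..} s)" for s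
    using nn_integral_heat_abs_source_le[OF f E src, of s t z]
      nn_integral_heat_abs_source_le_measure[OF f E src M _ _ _ \<sigma>(1,3), of s t z] M t
    by (cases "s < s0") (auto simp: indicator_def a_def ennreal_mult[symmetric] source_rate_nonneg)
  then have "(\<integral>\<^sup>+x\<in>E \<inter> ball z \<rho>. duhamel_abs f x t \<partial>lborel) \<le>
      (\<integral>\<^sup>+s. ennreal M * (ennreal (source_rate s) * indicator {0<..<a} s) +
        ennreal (M * \<sigma>) * (ennreal (s powr (- N - 1)) * indicator {s0..} s) \<partial>lborel)"
    by (subst nn_integral_duhamel_abs) (auto intro: nn_integral_mono)
  also have "\<dots> = ennreal M * (\<integral>\<^sup>+s\<in>{0<..<a}. ennreal (source_rate s) \<partial>lborel) +
      ennreal (M * \<sigma>) * (\<integral>\<^sup>+s\<in>{s0..}. ennreal (s powr (- N - 1)) \<partial>lborel)"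
    by (subst nn_integral_add) (auto simp: nn_integral_cmult)
  also have "\<dots> \<le> ennreal M * ennreal (source_const * Lg a powr (- N))
      + ennreal (M * \<sigma>) * ennreal (s0 powr (- N) / N)"
    unfolding nn_integral_powr_tail[OF N_pos a(1)]
    using a by (intro add_right_mono mult_left_mono nn_integral_source_rate) auto
  also have "\<dots> = ennreal (M * (source_const * Lg a powr (- N)) + M * (\<sigma> * s0 powr (- N)) / N)"
    using M source_const_pos \<sigma> N_pos
    by (simp add: ennreal_mult[symmetric] ennreal_plus[symmetric] mult_ac del: ennreal_plus)
  also have "\<dots> \<le> ennreal (M * (source_const * (Lg_comp_const (1 / N) 1 1 powr N * Lg \<sigma> powr (- N)))
      + M * Lg \<sigma> powr (- N) / N)"
    unfolding s0_powr using M source_const_pos Lg_a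
    by (intro ennreal_leI add_right_mono mult_left_mono) auto
  finally show ?thesis by (simp add: algebra_simps)
qed

lemma nn_integral_duhamel_abs_le_log:
  assumes f: "jointly_measurable f" and E: "E \<in> sets borel"
    and src: "source_bound M f" and M: "0 \<le> M" and t: "0 < t" "t < T"
    and \<sigma>: "0 < \<sigma>" "emeasure lborel E = ennreal \<sigma>"
  shows "(\<integral>\<^sup>+x\<in>E \<inter> ball z \<rho>. duhamel_abs f x t \<partial>lborel) \<le> ennreal (duhamel_mass_const * M * Lg \<sigma> powr (- N))"
proof (cases "\<sigma> \<le> 1")
  case True
  have "source_const * Lg_comp_const (1 / N) 1 1 powr N + 1 / N \<le> duhamel_mass_const"
    using source_const_pos by (simp add: duhamel_mass_const_def distrib_left)
  then show ?thesis
    using nn_integral_duhamel_abs_le_small_sets[OF f E src M t \<sigma>(1) True \<sigma>(2), of z] M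
    by (elim order_trans) (auto intro!: ennreal_leI mult_right_mono)
next
  case False
  have "source_const * M * Lg t powr (- N) \<le> source_const * M * 1"
    using source_const_pos M t N_pos by (intro mult_left_mono Lg_powr_minus_le_1) auto
  also have "\<dots> = source_const * Lg 1 powr N * M * Lg 1 powr (- N)"
    using Lg_pos[of 1] by (simp add: powr_minus)
  also have "\<dots> \<le> source_const * Lg 1 powr N * M * Lg \<sigma> powr (- N)"
    using False source_const_pos M N_pos by (intro mult_left_mono Lg_powr_minus_mono) auto
  also have "\<dots> \<le> duhamel_mass_const * M * Lg \<sigma> powr (- N)"
    using source_const_pos M N_pos by (intro mult_right_mono) (auto simp: duhamel_mass_const_def distrib_left)
  finally show ?thesis
    using nn_integral_duhamel_abs_le[OF f E src M t, of z] by (elim order_trans) (rule ennreal_leI)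
qed

end

section \<open>The power nonlinearity\<close>

lemma borel_measurable_Fp [measurable]: "Fp p \<in> borel_measurable borel"
  unfolding Fp_def by measurable

lemma Fp_0 [simp]: "Fp p 0 = 0"
  by (simp add: Fp_def)

lemma Fp_eq_powr: "0 < s \<Longrightarrow> Fp p s = s powr p"
  using powr_add[of s "p - 1" 1] by (simp add: Fp_def)

lemma DERIV_Fp:
  assumes p: "1 < p"
  shows "(Fp p has_real_derivative p * \<bar>s\<bar> powr (p - 1)) (at s)"
proof -
  have pos: "(Fp p has_real_derivative p * s powr (p - 1)) (at s)" if s: "0 < s" for s
    by (rule has_field_derivative_transform_within_open[OF has_real_derivative_powr[OF s], of "{0<..}"])
       (use s in \<open>auto simp: Fp_eq_powr\<close>)
  consider "0 < s" | "s < 0" | "s = 0" by linarith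
  then show ?thesis
  proof cases
    case 1
    then show ?thesis using pos by simp
  next
    case 2
    have "((\<lambda>x. - Fp p (- x)) has_real_derivative p * (- s) powr (p - 1)) (at s)"
      using DERIV_minus[OF DERIV_mirror[THEN iffD1, OF pos[of "- s"]]] 2 by simp
    moreover have "(\<lambda>x. - Fp p (- x)) = Fp p" by (auto simp: Fp_def)
    ultimately show ?thesis using 2 by simp
  next
    case 3
    have "((\<lambda>h. \<bar>h\<bar> powr (p - 1)) \<longlongrightarrow> 0 powr (p - 1)) (at 0)"
      using p by (intro tendsto_powr' tendsto_rabs_zero tendsto_ident_at tendsto_const) auto
    moreover have "\<forall>\<^sub>F h in at 0. \<bar>h\<bar> powr (p - 1) = (Fp p (0 + h) - Fp p 0) / h"
      by (auto simp: eventually_at_filter Fp_def)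
    ultimately have "((\<lambda>h. (Fp p (0 + h) - Fp p 0) / h) \<longlongrightarrow> 0) (at 0)"
      by (auto intro: Lim_transform_eventually)
    then show ?thesis using 3 by (simp add: has_field_derivative_def[symmetric] DERIV_def)
  qed
qed

lemma abs_Fp_diff_le:
  assumes p: "1 < p"
  shows "\<bar>Fp p a - Fp p b\<bar> \<le> p * ((\<bar>a\<bar> + \<bar>b\<bar>) powr (p - 1) * \<bar>a - b\<bar>)"
proof -
  define R where "R = \<bar>a\<bar> + \<bar>b\<bar>"
  have "norm (Fp p a - Fp p b) \<le> p * R powr (p - 1) * norm (a - b)"
  proof (rule field_differentiable_bound[of "{- R..R}"])
    show "(Fp p has_field_derivative p * \<bar>s\<bar> powr (p - 1)) (at s within {- R..R})" for s
      by (rule has_field_derivative_at_within[OF DERIV_Fp[OF p]])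
    show "norm (p * \<bar>s\<bar> powr (p - 1)) \<le> p * R powr (p - 1)" if "s \<in> {- R..R}" for s
      using that p by (auto simp: abs_mult intro!: mult_left_mono powr_mono2)
  qed (auto simp: R_def)
  then show ?thesis by (simp add: R_def mult.assoc)
qed

section \<open>The heat evolution and the Duhamel integral\<close>

context fractional_heat
begin

definition heat :: "('a \<Rightarrow> real) \<Rightarrow> 'a \<Rightarrow> real \<Rightarrow> real" where
  "heat \<phi> x t = (\<integral>y. G (x - y) t * \<phi> y \<partial>lborel)"

definition duhamel_integrand :: "('a \<Rightarrow> real \<Rightarrow> real) \<Rightarrow> 'a \<Rightarrow> real \<Rightarrow> 'a \<times> real \<Rightarrow> real" where
  "duhamel_integrand f x t z = indicator {0<..<t} (snd z) * (G (x - fst z) (t - snd z) * f (fst z) (snd z))"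

definition duhamel :: "('a \<Rightarrow> real \<Rightarrow> real) \<Rightarrow> 'a \<Rightarrow> real \<Rightarrow> real" where
  "duhamel f x t = (\<integral>z. duhamel_integrand f x t z \<partial>(lborel \<Otimes>\<^sub>M lborel))"

lemma jointly_measurable_heat [measurable]:
  assumes [measurable]: "\<phi> \<in> borel_measurable borel"
  shows "jointly_measurable (heat \<phi>)"
  unfolding heat_def by measurable

lemma borel_measurable_duhamel_integrand [measurable (raw)]:
  assumes [measurable]: "jointly_measurable f"
    "g \<in> borel_measurable M" "h \<in> borel_measurable M" "k \<in> M \<rightarrow>\<^sub>M (borel \<Otimes>\<^sub>M borel)"
  shows "(\<lambda>w. duhamel_integrand f (g w) (h w) (k w)) \<in> borel_measurable M"
  unfolding duhamel_integrand_def indicator_def greaterThanLessThan_iff by measurable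

lemma jointly_measurable_duhamel [measurable]:
  assumes [measurable]: "jointly_measurable f"
  shows "jointly_measurable (duhamel f)"
  unfolding duhamel_def by measurable

lemma integrable_heat_integrand:
  assumes [measurable]: "\<phi> \<in> borel_measurable borel" and t: "0 < t" and "heat_abs \<phi> t x < \<infinity>"
  shows "integrable lborel (\<lambda>y. G (x - y) t * \<phi> y)"
  using assms(3) G_nonneg[OF t] unfolding integrable_iff_bounded heat_abs_def by (auto simp: abs_mult)

lemma abs_heat_le: "0 < t \<Longrightarrow> ennreal \<bar>heat \<phi> x t\<bar> \<le> heat_abs \<phi> t x"
  using abs_integral_le_nn_integral[of lborel "\<lambda>y. G (x - y) t * \<phi> y"] G_nonneg[of t]
  by (simp add: heat_def heat_abs_def abs_mult)

lemma nn_integral_duhamel_integrand_slice: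
  "(\<integral>\<^sup>+y. ennreal \<bar>duhamel_integrand f x t (y, s)\<bar> \<partial>lborel) = heat_abs (\<lambda>y. f y s) (t - s) x * indicator {0<..<t} s"
  using G_nonneg[of "t - s"] by (cases "s \<in> {0<..<t}") (auto simp: duhamel_integrand_def heat_abs_def abs_mult)

lemma nn_integral_duhamel_integrand:
  assumes [measurable]: "jointly_measurable f"
  shows "(\<integral>\<^sup>+z. ennreal \<bar>duhamel_integrand f x t z\<bar> \<partial>(lborel \<Otimes>\<^sub>M lborel)) = duhamel_abs f x t"
  unfolding duhamel_abs_def nn_integral_duhamel_integrand_slice[symmetric]
  by (rule lborel_pair.nn_integral_snd[symmetric]) measurable

lemma integrable_duhamel_integrand:
  assumes [measurable]: "jointly_measurable f" and "duhamel_abs f x t < \<infinity>"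
  shows "integrable (lborel \<Otimes>\<^sub>M lborel) (duhamel_integrand f x t)"
  using assms(2) nn_integral_duhamel_integrand[OF assms(1)] unfolding integrable_iff_bounded by auto

lemma abs_duhamel_le: "jointly_measurable f \<Longrightarrow> ennreal \<bar>duhamel f x t\<bar> \<le> duhamel_abs f x t"
  using abs_integral_le_nn_integral[of "lborel \<Otimes>\<^sub>M lborel" "duhamel_integrand f x t"]
  by (simp add: duhamel_def nn_integral_duhamel_integrand)

lemma duhamel_diff:
  assumes "jointly_measurable f" "jointly_measurable g" "duhamel_abs f x t < \<infinity>" "duhamel_abs g x t < \<infinity>"
  shows "duhamel (\<lambda>y s. f y s - g y s) x t = duhamel f x t - duhamel g x t"
proof -
  have "duhamel_integrand (\<lambda>y s. f y s - g y s) x t z = duhamel_integrand f x t z - duhamel_integrand g x t z" for z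
    by (simp add: duhamel_integrand_def algebra_simps)
  then show ?thesis
    using assms by (simp add: duhamel_def integrable_duhamel_integrand)
qed

abbreviation nonlin :: "('a \<Rightarrow> real \<Rightarrow> real) \<Rightarrow> 'a \<Rightarrow> real \<Rightarrow> real" where
  "nonlin u \<equiv> (\<lambda>y s. Fp p (u y s))"

lemma jointly_measurable_nonlin:
  assumes [measurable]: "jointly_measurable u"
  shows "jointly_measurable (nonlin u)"
  by measurable

definition heat_const :: real where
  "heat_const = smoothing_const * Lg_dilation_const N (unit_ball_vol (DIM('a))) powr N + 1"

lemma heat_const_ge_1: "1 \<le> heat_const"
  using smoothing_const_nonneg by (simp add: heat_const_def)

end

section \<open>The critical bounds\<close>

context critical_problem
begin

definition critical_bound :: "real \<Rightarrow> ('a \<Rightarrow> real \<Rightarrow> real) \<Rightarrow> bool" where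
  "critical_bound K u \<longleftrightarrow> (\<forall>t\<in>{0<..<T}. log_bounded N \<rho> K (\<lambda>x. u x t) \<and> (\<forall>x. \<bar>u x t\<bar> \<le> K * decay_rate t))"

lemma critical_boundI:
  assumes "\<And>t. 0 < t \<Longrightarrow> t < T \<Longrightarrow> log_bounded N \<rho> K (\<lambda>x. u x t)"
    and "\<And>x t. 0 < t \<Longrightarrow> t < T \<Longrightarrow> \<bar>u x t\<bar> \<le> K * decay_rate t"
  shows "critical_bound K u"
  using assms by (simp add: critical_bound_def)

lemma critical_bound_logD: "critical_bound K u \<Longrightarrow> 0 < t \<Longrightarrow> t < T \<Longrightarrow> log_bounded N \<rho> K (\<lambda>x. u x t)"
  by (simp add: critical_bound_def)

lemma critical_bound_supD: "critical_bound K u \<Longrightarrow> 0 < t \<Longrightarrow> t < T \<Longrightarrow> \<bar>u x t\<bar> \<le> K * decay_rate t"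
  by (simp add: critical_bound_def)

lemma critical_bound_zero: "0 \<le> K \<Longrightarrow> critical_bound K (\<lambda>x t. 0)"
  by (simp add: critical_bound_def log_bounded_zero decay_rate_nonneg)

lemma critical_bound_mono:
  assumes u: "critical_bound K u" and K: "K \<le> K'"
  shows "critical_bound K' u"
proof (rule critical_boundI)
  fix x t assume t: "0 < t" "t < T"
  show "log_bounded N \<rho> K' (\<lambda>x. u x t)" by (rule log_bounded_mono[OF critical_bound_logD[OF u t] K])
  show "\<bar>u x t\<bar> \<le> K' * decay_rate t"
    using critical_bound_supD[OF u t, of x] mult_right_mono[OF K decay_rate_nonneg, of t] by linarith
qed

lemma critical_bound_add:
  assumes u: "critical_bound K u" "0 \<le> K" and v: "critical_bound K' v" "0 \<le> K'"
    and [measurable]: "jointly_measurable u" "jointly_measurable v"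
    and w: "\<And>x t. 0 < t \<Longrightarrow> t < T \<Longrightarrow> \<bar>w x t\<bar> \<le> \<bar>u x t\<bar> + \<bar>v x t\<bar>"
  shows "critical_bound (K + K') w"
proof (rule critical_boundI)
  fix x t assume t: "0 < t" "t < T"
  show "log_bounded N \<rho> (K + K') (\<lambda>x. w x t)"
    by (rule log_bounded_add[OF critical_bound_logD[OF u(1) t] u(2) critical_bound_logD[OF v(1) t] v(2)])
       (use w[OF t] in auto)
  show "\<bar>w x t\<bar> \<le> (K + K') * decay_rate t"
    using critical_bound_supD[OF u(1) t, of x] critical_bound_supD[OF v(1) t, of x] w[OF t, of x]
    by (simp add: distrib_right)
qed

lemma critical_bound_lim:
  assumes u: "\<And>k::nat. critical_bound K (u k)" and [measurable]: "\<And>k. jointly_measurable (u k)"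
    and lim: "\<And>x t. 0 < t \<Longrightarrow> t < T \<Longrightarrow> (\<lambda>k. u k x t) \<longlonglongrightarrow> v x t"
  shows "critical_bound K v"
proof (rule critical_boundI)
  fix x t assume t: "0 < t" "t < T"
  show "log_bounded N \<rho> K (\<lambda>x. v x t)"
    by (rule log_bounded_lim[OF critical_bound_logD[OF u t] _ lim[OF t]]) measurable
  show "\<bar>v x t\<bar> \<le> K * decay_rate t"
    by (rule LIMSEQ_le_const2[OF tendsto_rabs[OF lim[OF t]]]) (use critical_bound_supD[OF u t] in auto)
qed

lemma heat_abs_le_decay_rate:
  assumes \<phi>: "\<phi> \<in> borel_measurable borel" "log_bounded N \<rho> K \<phi>" and K: "0 \<le> K" and t: "0 < t" "t < T"
  shows "heat_abs \<phi> t x \<le> ennreal (heat_const * K * decay_rate t)"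
proof -
  define v D where "v = unit_ball_vol (real (DIM('a)))" and "D = Lg_dilation_const N v"
  have v: "0 < v" "0 < D" using N_pos by (auto simp: v_def D_def intro: Lg_dilation_const_pos)
  have "local_mass_le (t powr (1 / \<theta>)) \<phi> (ennreal (K * Lg (v * t powr N) powr (- N)))"
    using local_mass_le_of_log_bounded_small_radius[OF \<phi>(2) _ powr_inverse_theta_mono[of t T] K] t N_pos
    by (simp add: powr_inverse_theta_power v_def)
  then have "heat_abs \<phi> t x \<le> ennreal (smoothing_const * t powr (- N)) * ennreal (K * Lg (v * t powr N) powr (- N))"
    by (intro heat_abs_smoothing \<phi> t) auto
  also have "\<dots> = ennreal (smoothing_const * t powr (- N) * K * Lg (v * t powr N) powr (- N))"
    using K smoothing_const_nonneg by (simp add: ennreal_mult[symmetric] mult.assoc)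
  also have "\<dots> \<le> ennreal (smoothing_const * t powr (- N) * K * (D powr N * Lg t powr (- N)))"
    using K smoothing_const_nonneg N_pos v t Lg_pos[OF t(1)] Lg_le_dilation[of N v t]
    by (intro ennreal_leI mult_left_mono powr_minus_le_of_le_mult) (auto simp: D_def)
  also have "smoothing_const * t powr (- N) * K * (D powr N * Lg t powr (- N))
      = (heat_const - 1) * K * decay_rate t"
    by (simp add: heat_const_def D_def v_def decay_rate_def)
  also have "ennreal \<dots> \<le> ennreal (heat_const * K * decay_rate t)"
    using K by (intro ennreal_leI mult_right_mono decay_rate_nonneg) auto
  finally show ?thesis .
qed

lemma critical_bound_heat:
  assumes \<phi>: "\<phi> \<in> borel_measurable borel" "log_bounded N \<rho> K \<phi>" and K: "0 \<le> K"
  shows "critical_bound (heat_const * K) (heat \<phi>)"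
proof (rule critical_boundI)
  fix t assume t: "0 < t" "t < T"
  have "log_bounded N \<rho> K (\<lambda>x. heat \<phi> x t)"
  proof (rule log_bounded_of_dominated[OF abs_heat_le[OF t(1)]])
    fix z :: 'a and E :: "'a set" and s
    assume E[measurable]: "E \<in> sets borel" and s: "0 < s" "emeasure lborel E = ennreal s"
    show "(\<integral>\<^sup>+x\<in>E \<inter> ball z \<rho>. heat_abs \<phi> t x \<partial>lborel) \<le> ennreal (K * Lg s powr (- N))"
    proof (rule nn_integral_heat_abs_le[OF \<phi>(1) _ t(1)])
      fix w
      have "mass (\<lambda>x. \<phi> (x - w)) (E \<inter> ball z \<rho>) = mass \<phi> ((+) w -` E \<inter> ball (z - w) \<rho>)"
        using \<phi>(1) by (subst mass_translate) (auto simp: vimage_Int vimage_plus_ball)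
      also have "\<dots> \<le> ennreal (K * Lg s powr (- N))"
        using s by (intro log_boundedD[OF \<phi>(2)]) (auto simp: emeasure_lborel_vimage_plus)
      finally show "mass (\<lambda>x. \<phi> (x - w)) (E \<inter> ball z \<rho>) \<le> ennreal (K * Lg s powr (- N))" .
    qed measurable
  qed
  then show "log_bounded N \<rho> (heat_const * K) (\<lambda>x. heat \<phi> x t)"
    by (rule log_bounded_mono) (use mult_right_mono[OF heat_const_ge_1 K] in simp)
  fix x
  have "ennreal \<bar>heat \<phi> x t\<bar> \<le> ennreal (heat_const * K * decay_rate t)"
    using abs_heat_le[OF t(1)] heat_abs_le_decay_rate[OF \<phi> K t] by (rule order_trans)
  then show "\<bar>heat \<phi> x t\<bar> \<le> heat_const * K * decay_rate t"
    using K heat_const_ge_1 decay_rate_nonneg by (subst (asm) ennreal_le_iff) auto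
qed

end

context bounded_horizon
begin

definition duhamel_const :: real where
  "duhamel_const = duhamel_sup_const + duhamel_mass_const"

lemma duhamel_sup_const_pos: "0 < duhamel_sup_const"
  unfolding duhamel_sup_const_def using smoothing_const_nonneg source_const_pos
  by (intro mult_pos_pos add_nonneg_pos mult_nonneg_nonneg) auto

lemma duhamel_mass_const_pos: "0 < duhamel_mass_const"
  unfolding duhamel_mass_const_def using source_const_pos N_pos by (intro add_nonneg_pos mult_nonneg_nonneg) auto

definition nonlin_const :: real where
  "nonlin_const = p * 2 powr (1 / N) * critical_product_const S"

lemma nonlin_const_pos: "0 < nonlin_const"
  unfolding nonlin_const_def using critical_product_const_ge_1[of S] N_pos
  by (intro mult_pos_pos) (auto intro: add_pos_pos)

definition solution_radius :: real where
  "solution_radius = (1 / (2 * duhamel_const * nonlin_const)) powr N"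

lemma duhamel_const_pos: "0 < duhamel_const"
  using duhamel_sup_const_pos duhamel_mass_const_pos by (simp add: duhamel_const_def)

lemma solution_radius_pos: "0 < solution_radius"
  using duhamel_const_pos nonlin_const_pos by (simp add: solution_radius_def)

lemma solution_radius_contracts: "duhamel_const * (nonlin_const * solution_radius powr (1 / N) * d) = d / 2"
proof -
  have "solution_radius powr (1 / N) = 1 / (2 * duhamel_const * nonlin_const)"
    using duhamel_const_pos nonlin_const_pos N_pos by (simp add: solution_radius_def powr_powr)
  then show ?thesis using duhamel_const_pos nonlin_const_pos by simp
qed

end

context critical_problem
begin

lemma duhamel_abs_finite:
  "jointly_measurable f \<Longrightarrow> source_bound M f \<Longrightarrow> 0 \<le> M \<Longrightarrow> 0 < t \<Longrightarrow> t < T \<Longrightarrow> duhamel_abs f x t < \<infinity>"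
  using duhamel_abs_le_sup[of f M t x] by (auto intro: le_less_trans)

lemma critical_bound_duhamel:
  assumes f: "jointly_measurable f" "source_bound M f" and M: "0 \<le> M"
  shows "critical_bound (duhamel_const * M) (duhamel f)"
proof (rule critical_boundI)
  fix t assume t: "0 < t" "t < T"
  have "log_bounded N \<rho> (duhamel_mass_const * M) (\<lambda>x. duhamel f x t)"
    by (rule log_bounded_of_dominated[OF abs_duhamel_le[OF f(1)]
          nn_integral_duhamel_abs_le_log[OF f(1) _ f(2) M t]])
  then show "log_bounded N \<rho> (duhamel_const * M) (\<lambda>x. duhamel f x t)"
    by (rule log_bounded_mono)
       (use M duhamel_sup_const_pos in \<open>auto simp: duhamel_const_def intro!: mult_right_mono\<close>)
  fix x
  have "ennreal \<bar>duhamel f x t\<bar> \<le> ennreal (duhamel_sup_const * M * decay_rate t)"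
    using abs_duhamel_le[OF f(1)] duhamel_abs_le_sup[OF f M t] by (rule order_trans)
  then have "\<bar>duhamel f x t\<bar> \<le> duhamel_sup_const * M * decay_rate t"
    using M duhamel_sup_const_pos decay_rate_nonneg by (subst (asm) ennreal_le_iff) auto
  also have "\<dots> \<le> duhamel_const * M * decay_rate t"
    using M duhamel_mass_const_pos decay_rate_nonneg by (intro mult_right_mono) (auto simp: duhamel_const_def)
  finally show "\<bar>duhamel f x t\<bar> \<le> duhamel_const * M * decay_rate t" .
qed

lemma abs_nonlin_diff_le: "\<bar>nonlin u x t - nonlin v x t\<bar> \<le> p * ((\<bar>u x t\<bar> + \<bar>v x t\<bar>) powr (1 / N) * \<bar>u x t - v x t\<bar>)"
  using abs_Fp_diff_le[of p "u x t" "v x t"] N_pos by simp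

lemma local_mass_nonlin_diff:
  assumes [measurable]: "jointly_measurable u" "jointly_measurable v"
    and K: "0 < K" "critical_bound K u" "critical_bound K v"
    and d: "0 \<le> d" "critical_bound d (\<lambda>x t. u x t - v x t)" and s: "0 < s" "s < T"
  shows "local_mass_le \<rho> (\<lambda>y. nonlin u y s - nonlin v y s) (ennreal (nonlin_const * K powr (1 / N) * d * source_rate s))"
proof -
  define w h where "w x t = \<bar>u x t\<bar> + \<bar>v x t\<bar>" and "h x t = u x t - v x t" for x t
  have [measurable]: "jointly_measurable w" "jointly_measurable h" unfolding w_def h_def by measurable
  have w: "critical_bound (2 * K) w"
    using critical_bound_add[OF K(2) _ K(3), of w] K(1) by (simp add: w_def)
  have h: "critical_bound d h" using d(2) by (simp add: h_def[abs_def])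
  define C where "C = critical_product_const S"
  have "local_mass_le \<rho> (\<lambda>x. \<bar>w x s\<bar> powr (1 / N) * h x s) (ennreal (C * (2 * K) powr (1 / N) * d * source_rate s))"
    unfolding C_def using s T K(1) d(1) critical_bound_logD[OF w s] critical_bound_supD[OF w s]
        critical_bound_logD[OF h s]
    by (intro local_mass_powr_mult) auto
  then have "local_mass_le \<rho> (\<lambda>y. nonlin u y s - nonlin v y s) (ennreal (p * (C * (2 * K) powr (1 / N) * d * source_rate s)))"
    by (rule local_mass_le_cmult[rotated])
       (use N_pos abs_nonlin_diff_le[of u _ s v] in \<open>auto simp: abs_mult w_def h_def\<close>)
  then show ?thesis by (simp add: nonlin_const_def C_def powr_mult mult_ac)
qed

lemma source_bound_nonlin_diff:
  assumes u: "jointly_measurable u" and v: "jointly_measurable v"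
    and K: "0 < K" "critical_bound K u" "critical_bound K v"
    and d: "0 \<le> d" "critical_bound d (\<lambda>x t. u x t - v x t)"
  shows "source_bound (nonlin_const * K powr (1 / N) * d) (\<lambda>y s. nonlin u y s - nonlin v y s)"
  unfolding source_bound_def
proof (intro ballI conjI allI local_mass_nonlin_diff[OF u v K d])
  fix s y assume "s \<in> {0<..<T}"
  then have s: "0 < s" "s < T" by auto
  define A where "A = p * (2 * K) powr (1 / N) * d"
  have A: "0 \<le> A" "critical_product_const S * A = nonlin_const * K powr (1 / N) * d"
    using N_pos d by (auto simp: A_def nonlin_const_def powr_mult mult_ac)
  have sum: "\<bar>u y s\<bar> + \<bar>v y s\<bar> \<le> 2 * K * decay_rate s"
    using critical_bound_supD[OF K(2) s, of y] critical_bound_supD[OF K(3) s, of y] by simp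
  have "\<bar>nonlin u y s - nonlin v y s\<bar> \<le> p * ((2 * K * decay_rate s) powr (1 / N) * (d * decay_rate s))"
    using abs_nonlin_diff_le[of u y s v] sum critical_bound_supD[OF d(2) s, of y] N_pos
    by (elim order_trans) (intro mult_left_mono mult_mono powr_mono2, auto)
  also have "\<dots> = A * (decay_rate s powr (1 / N) * decay_rate s)"
    by (simp add: A_def powr_mult mult_ac)
  also have "\<dots> \<le> critical_product_const S * A * (decay_rate s powr (1 / N) * decay_rate s)"
    using A(1) mult_right_mono[OF critical_product_const_ge_1[of S] A(1)]
    by (intro mult_right_mono mult_nonneg_nonneg decay_rate_nonneg) auto
  finally show "\<bar>nonlin u y s - nonlin v y s\<bar> \<le> nonlin_const * K powr (1 / N) * d * (s powr (- N) * source_rate s)"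
    unfolding A(2) decay_rate_powr_mult .
qed auto

lemma source_bound_nonlin:
  assumes "jointly_measurable u" "0 < K" "critical_bound K u"
  shows "source_bound (nonlin_const * K powr (1 / N) * K) (nonlin u)"
  using source_bound_nonlin_diff[OF assms(1) _ assms(2,3) critical_bound_zero, of K] assms by simp

lemma duhamel_abs_nonlin_finite:
  assumes "jointly_measurable u" "0 < K" "critical_bound K u" "0 < t" "t < T"
  shows "duhamel_abs (nonlin u) x t < \<infinity>"
  using assms nonlin_const_pos
  by (intro duhamel_abs_finite[OF jointly_measurable_nonlin source_bound_nonlin]) auto

lemma critical_bound_duhamel_nonlin_diff:
  assumes u: "jointly_measurable u" "critical_bound solution_radius u"
    and v: "jointly_measurable v" "critical_bound solution_radius v"
    and d: "0 \<le> d" "critical_bound d (\<lambda>x t. u x t - v x t)"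
  shows "critical_bound (d / 2) (\<lambda>x t. duhamel (nonlin u) x t - duhamel (nonlin v) x t)"
proof -
  let ?f = "\<lambda>y s. nonlin u y s - nonlin v y s"
  have [measurable]: "jointly_measurable u" "jointly_measurable v" using u v by auto
  have "source_bound (nonlin_const * solution_radius powr (1 / N) * d) ?f"
    by (rule source_bound_nonlin_diff[OF u(1) v(1) solution_radius_pos u(2) v(2) d])
  then have "critical_bound (duhamel_const * (nonlin_const * solution_radius powr (1 / N) * d)) (duhamel ?f)"
    using d(1) nonlin_const_pos by (intro critical_bound_duhamel) auto
  then have "critical_bound (d / 2) (duhamel ?f)" by (simp only: solution_radius_contracts)
  moreover have "duhamel ?f x t = duhamel (nonlin u) x t - duhamel (nonlin v) x t" if "0 < t" "t < T" for x t
    using that u v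
    by (intro duhamel_diff jointly_measurable_nonlin duhamel_abs_nonlin_finite[OF _ solution_radius_pos]) auto
  ultimately show ?thesis by (simp add: critical_bound_def)
qed

section \<open>The fixed point iteration\<close>

lemma critical_bound_telescope:
  assumes [measurable]: "\<And>k. jointly_measurable (U k)" and c: "0 \<le> c"
    and step: "\<And>k. critical_bound (c * (1 / 2) ^ k) (\<lambda>x t. U (Suc k) x t - U k x t)"
  shows "critical_bound (2 * c * (1 / 2) ^ k) (\<lambda>x t. U (k + j) x t - U k x t)"
proof -
  have "critical_bound (2 * c * (1 / 2) ^ k * (1 - (1 / 2) ^ j)) (\<lambda>x t. U (k + j) x t - U k x t)"
  proof (induction j)
    case 0
    then show ?case by (simp add: critical_bound_zero)
  next
    case (Suc j)
    have nonneg: "0 \<le> 2 * c * (1 / 2) ^ k * (1 - (1 / 2) ^ j)"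
      using c by (intro mult_nonneg_nonneg) (auto simp: power_le_one)
    have "critical_bound (2 * c * (1 / 2) ^ k * (1 - (1 / 2) ^ j) + c * (1 / 2) ^ (k + j))
        (\<lambda>x t. U (k + Suc j) x t - U k x t)"
      by (rule critical_bound_add[OF Suc nonneg step[of "k + j"]]) (use c in auto)
    also have "2 * c * (1 / 2) ^ k * (1 - (1 / 2) ^ j) + c * (1 / 2) ^ (k + j)
        = 2 * c * (1 / 2) ^ k * (1 - (1 / 2) ^ Suc j)"
      by (simp add: power_add field_simps)
    finally show ?case .
  qed
  then show ?thesis by (rule critical_bound_mono) (use c in \<open>simp add: mult_left_le\<close>)
qed

lemma critical_bound_geometric_limit:
  assumes [measurable]: "\<And>k. jointly_measurable (U k)" and "0 \<le> c"
    and step: "\<And>k. critical_bound (c * (1 / 2) ^ k) (\<lambda>x t. U (Suc k) x t - U k x t)"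
  obtains u where "jointly_measurable u" "\<And>x t. 0 < t \<Longrightarrow> t < T \<Longrightarrow> (\<lambda>k. U k x t) \<longlonglongrightarrow> u x t"
    "\<And>k. critical_bound (2 * c * (1 / 2) ^ k) (\<lambda>x t. u x t - U k x t)"
proof
  define u where "u x t = lim (\<lambda>k. U k x t)" for x t
  show "jointly_measurable u" unfolding u_def by measurable
  show conv: "(\<lambda>k. U k x t) \<longlonglongrightarrow> u x t" if t: "0 < t" "t < T" for x t
  proof -
    have "summable (\<lambda>k. U (Suc k) x t - U k x t)"
    proof (rule summable_comparison_test)
      show "\<exists>m. \<forall>k\<ge>m. norm (U (Suc k) x t - U k x t) \<le> c * (1 / 2) ^ k * decay_rate t"
        using critical_bound_supD[OF step t, of _ x] by auto
      show "summable (\<lambda>k. c * (1 / 2) ^ k * decay_rate t)"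
        by (intro summable_mult summable_mult2 summable_geometric) auto
    qed
    then have "convergent (\<lambda>n. U n x t)"
      by (simp add: summable_iff_convergent sum_lessThan_telescope[where f="\<lambda>k. U k x t"]
          convergent_diff_const_right_iff)
    then show ?thesis unfolding u_def by (simp add: convergent_LIMSEQ_iff)
  qed
  show "critical_bound (2 * c * (1 / 2) ^ k) (\<lambda>x t. u x t - U k x t)" for k
  proof (rule critical_bound_lim)
    show "critical_bound (2 * c * (1 / 2) ^ k) (\<lambda>x t. U (k + j) x t - U k x t)" for j
      by (rule critical_bound_telescope[OF assms])
    show "(\<lambda>j. U (k + j) x t - U k x t) \<longlonglongrightarrow> u x t - U k x t" if "0 < t" "t < T" for x t
      using LIMSEQ_ignore_initial_segment[OF conv[OF that, of x], of k]
      by (intro tendsto_diff tendsto_const) (simp add: add.commute)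
  qed measurable
qed

end

context fractional_heat
begin

fun picard :: "('a \<Rightarrow> real) \<Rightarrow> nat \<Rightarrow> 'a \<Rightarrow> real \<Rightarrow> real" where
  "picard \<phi> 0 = (\<lambda>x t. 0)"
| "picard \<phi> (Suc k) = (\<lambda>x t. heat \<phi> x t + duhamel (nonlin (picard \<phi> k)) x t)"

lemma jointly_measurable_picard [measurable]:
  assumes [measurable]: "\<phi> \<in> borel_measurable borel"
  shows "jointly_measurable (picard \<phi> k)"
proof (induction k)
  case (Suc k)
  note [measurable] = Suc
  show ?case unfolding picard.simps by measurable
qed simp

end

context critical_problem
begin

lemma critical_bound_picard:
  assumes \<phi>: "\<phi> \<in> borel_measurable borel" and heat: "critical_bound (solution_radius / 2) (heat \<phi>)"
  shows "critical_bound solution_radius (picard \<phi> k)"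
proof (induction k)
  case 0
  then show ?case using solution_radius_pos by (simp add: critical_bound_zero)
next
  case (Suc k)
  note [measurable] = \<phi>
  have "critical_bound (solution_radius / 2) (\<lambda>x t. duhamel (nonlin (picard \<phi> k)) x t - duhamel (nonlin (\<lambda>x t. 0)) x t)"
    using Suc solution_radius_pos
    by (intro critical_bound_duhamel_nonlin_diff jointly_measurable_picard \<phi>) (auto intro: critical_bound_zero)
  moreover have "duhamel (nonlin (\<lambda>x t. 0)) x t = 0" for x t
    by (simp add: duhamel_def duhamel_integrand_def)
  ultimately have duhamel: "critical_bound (solution_radius / 2) (duhamel (nonlin (picard \<phi> k)))" by simp
  have "critical_bound (solution_radius / 2 + solution_radius / 2) (picard \<phi> (Suc k))"
    by (rule critical_bound_add[OF heat _ duhamel]) (use solution_radius_pos in \<open>auto intro: abs_triangle_ineq\<close>)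
  then show ?case by simp
qed

lemma critical_bound_picard_step:
  assumes "\<phi> \<in> borel_measurable borel" and "critical_bound (solution_radius / 2) (heat \<phi>)"
  shows "critical_bound (solution_radius * (1 / 2) ^ k) (\<lambda>x t. picard \<phi> (Suc k) x t - picard \<phi> k x t)"
proof (induction k)
  case 0
  then show ?case using critical_bound_picard[OF assms, of "Suc 0"] by simp
next
  case (Suc k)
  have "critical_bound (solution_radius * (1 / 2) ^ k / 2)
      (\<lambda>x t. duhamel (nonlin (picard \<phi> (Suc k))) x t - duhamel (nonlin (picard \<phi> k)) x t)"
    using solution_radius_pos
    by (intro critical_bound_duhamel_nonlin_diff jointly_measurable_picard critical_bound_picard assms Suc) auto
  then show ?case by simp
qed

theorem mild_solution_exists:
  assumes \<phi>: "\<phi> \<in> borel_measurable borel" and "critical_bound (solution_radius / 2) (heat \<phi>)"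
  obtains u where "jointly_measurable u" "critical_bound solution_radius u"
    "\<And>x t. 0 < t \<Longrightarrow> t < T \<Longrightarrow> u x t = heat \<phi> x t + duhamel (nonlin u) x t"
proof -
  note [measurable] = \<phi>
  obtain u where u: "jointly_measurable u"
    and lim: "\<And>x t. 0 < t \<Longrightarrow> t < T \<Longrightarrow> (\<lambda>k. picard \<phi> k x t) \<longlonglongrightarrow> u x t"
    and close: "\<And>k. critical_bound (2 * solution_radius * (1 / 2) ^ k) (\<lambda>x t. u x t - picard \<phi> k x t)"
    by (rule critical_bound_geometric_limit[OF jointly_measurable_picard[OF \<phi>] less_imp_le[OF solution_radius_pos]
          critical_bound_picard_step[OF assms]]) blast
  have bound: "critical_bound solution_radius u"
    by (rule critical_bound_lim[OF critical_bound_picard[OF assms] _ lim]) measurable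
  have "u x t = heat \<phi> x t + duhamel (nonlin u) x t" if t: "0 < t" "t < T" for x t
  proof -
    have "\<bar>duhamel (nonlin u) x t - duhamel (nonlin (picard \<phi> k)) x t\<bar>
        \<le> 2 * solution_radius * (1 / 2) ^ k / 2 * decay_rate t" for k
      using solution_radius_pos
      by (intro critical_bound_supD[OF critical_bound_duhamel_nonlin_diff t] u bound close
          critical_bound_picard assms) auto
    then have "\<forall>\<^sub>F k in sequentially. norm (duhamel (nonlin (picard \<phi> k)) x t - duhamel (nonlin u) x t)
        \<le> solution_radius * decay_rate t * (1 / 2) ^ k"
      by (simp add: abs_minus_commute mult_ac)
    moreover have "(\<lambda>k. solution_radius * decay_rate t * (1 / 2) ^ k) \<longlonglongrightarrow> 0"
      by (intro tendsto_mult_right_zero LIMSEQ_power_zero) simp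
    ultimately have "(\<lambda>k. duhamel (nonlin (picard \<phi> k)) x t) \<longlonglongrightarrow> duhamel (nonlin u) x t"
      by (rule LIM_zero_cancel[OF Lim_null_comparison])
    then have "(\<lambda>k. picard \<phi> (Suc k) x t) \<longlonglongrightarrow> heat \<phi> x t + duhamel (nonlin u) x t"
      by (simp add: tendsto_add)
    with LIMSEQ_Suc[OF lim[OF t]] show ?thesis by (rule LIMSEQ_unique)
  qed
  with u bound show ?thesis by (rule that)
qed

end

section \<open>Continuity in time\<close>

context fractional_heat
begin

lemma abs_heat_diff_le:
  assumes [measurable]: "\<phi> \<in> borel_measurable borel" and t: "0 < t" "t \<le> s"
    and finite: "heat_abs \<phi> s x < \<infinity>" "heat_abs \<phi> t x < \<infinity>"
  shows "ennreal \<bar>heat \<phi> x s - heat \<phi> x t\<bar>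
    \<le> ennreal (time_modulus (s / t)) * (heat_abs \<phi> (2 powr (\<theta> / 2) * s) x + heat_abs \<phi> t x)"
proof -
  have "heat \<phi> x s - heat \<phi> x t = (\<integral>y. (G (x - y) s - G (x - y) t) * \<phi> y \<partial>lborel)"
    using t finite unfolding heat_def left_diff_distrib
    by (intro Bochner_Integration.integral_diff[symmetric] integrable_heat_integrand) auto
  then have "ennreal \<bar>heat \<phi> x s - heat \<phi> x t\<bar> \<le> (\<integral>\<^sup>+y. ennreal (\<bar>G (x - y) s - G (x - y) t\<bar> * \<bar>\<phi> y\<bar>) \<partial>lborel)"
    using abs_integral_le_nn_integral[of lborel "\<lambda>y. (G (x - y) s - G (x - y) t) * \<phi> y"] by (simp add: abs_mult)
  also note nn_integral_G_increment_le[OF assms(1) t]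
  finally show ?thesis .
qed

lemma le_two_powr_multI: "0 \<le> t \<Longrightarrow> a \<le> t \<Longrightarrow> a \<le> 2 powr (\<theta> / 2) * t"
  using ge_one_powr_ge_zero[of 2 "\<theta> / 2"] theta mult_right_mono[of 1 "2 powr (\<theta> / 2)" t] by simp

end

context critical_problem
begin

lemma heat_abs_le_of_local_mass:
  assumes \<phi>: "\<phi> \<in> borel_measurable borel" "local_mass_le \<rho> \<phi> (ennreal M)" and M: "0 \<le> M"
    and \<eta>: "0 < \<eta>" "\<eta> \<le> T" "\<eta> \<le> t"
  shows "heat_abs \<phi> t x \<le> ennreal (smoothing_const * \<eta> powr (- N) * M)"
proof -
  have "heat_abs \<phi> t x \<le> ennreal (smoothing_const * \<eta> powr (- N)) * ennreal M"
    by (intro heat_abs_smoothing \<phi>(1) \<eta> local_mass_le_smaller_radius[OF \<phi>(2) powr_inverse_theta_mono[OF \<eta>(1,2)]])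
  then show ?thesis using M smoothing_const_nonneg by (simp add: ennreal_mult[symmetric])
qed

lemma heat_time_modulus:
  assumes \<phi>: "\<phi> \<in> borel_measurable borel" "local_mass_le \<rho> \<phi> (ennreal M)" and M: "0 \<le> M"
    and a: "0 < a" "a \<le> T" "a \<le> s" "a \<le> t"
  shows "\<bar>heat \<phi> x s - heat \<phi> x t\<bar> \<le> 2 * smoothing_const * a powr (- N) * M * time_modulus (1 + \<bar>s - t\<bar> / a)"
proof -
  define B where "B = smoothing_const * a powr (- N) * M"
  have B: "0 \<le> B" using M smoothing_const_nonneg by (simp add: B_def)
  have heat_abs: "heat_abs \<phi> \<tau> x \<le> ennreal B" if "a \<le> \<tau>" for \<tau>
    unfolding B_def by (rule heat_abs_le_of_local_mass[OF \<phi> M a(1,2) that])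
  have "\<bar>heat \<phi> x s - heat \<phi> x t\<bar> \<le> 2 * B * time_modulus (1 + \<bar>s - t\<bar> / a)"
    if st: "a \<le> t" "t \<le> s" for s t
  proof -
    have r: "1 \<le> s / t" "s / t \<le> 1 + \<bar>s - t\<bar> / a"
    proof -
      have "s / t = 1 + (s - t) / t" using st a(1) by (simp add: field_simps)
      moreover have "(s - t) / t \<le> (s - t) / a" using st a(1) by (intro divide_left_mono) auto
      ultimately show "s / t \<le> 1 + \<bar>s - t\<bar> / a" using st by simp
    qed (use st a(1) in simp)
    have finite: "heat_abs \<phi> s x < \<infinity>" "heat_abs \<phi> t x < \<infinity>"
      using heat_abs[of s] heat_abs[of t] st by (auto intro: le_less_trans)
    have "ennreal \<bar>heat \<phi> x s - heat \<phi> x t\<bar>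
        \<le> ennreal (time_modulus (s / t)) * (heat_abs \<phi> (2 powr (\<theta> / 2) * s) x + heat_abs \<phi> t x)"
      using st a(1) by (intro abs_heat_diff_le \<phi>(1) finite) auto
    also have "\<dots> \<le> ennreal (time_modulus (1 + \<bar>s - t\<bar> / a)) * (ennreal B + ennreal B)"
      using st a(1) r by (intro mult_mono add_mono heat_abs ennreal_leI time_modulus_mono le_two_powr_multI) auto
    also have "\<dots> = ennreal (2 * B * time_modulus (1 + \<bar>s - t\<bar> / a))"
      using B r by (simp add: ennreal_mult[symmetric] ennreal_plus[symmetric] time_modulus_nonneg mult_ac
          del: ennreal_plus)
    finally show ?thesis
      using B r by (subst (asm) ennreal_le_iff) (auto intro!: mult_nonneg_nonneg time_modulus_nonneg)
  qed
  from this[of t s] this[of s t] a(3,4) show ?thesis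
    by (cases "t \<le> s") (auto simp: B_def abs_minus_commute mult_ac)
qed

definition duhamel_slice_diff :: "('a \<Rightarrow> real \<Rightarrow> real) \<Rightarrow> 'a \<Rightarrow> real \<Rightarrow> real \<Rightarrow> real \<Rightarrow> ennreal" where
  "duhamel_slice_diff f x t' t s = (\<integral>\<^sup>+y. ennreal \<bar>duhamel_integrand f x t' (y, s) - duhamel_integrand f x t (y, s)\<bar> \<partial>lborel)"

lemma abs_duhamel_diff_le:
  assumes f[measurable]: "jointly_measurable f" "source_bound M f" and M: "0 \<le> M"
    and t: "0 < t" "t < T" "0 < t'" "t' < T"
  shows "ennreal \<bar>duhamel f x t' - duhamel f x t\<bar> \<le> (\<integral>\<^sup>+s. duhamel_slice_diff f x t' t s \<partial>lborel)"
proof -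
  have "duhamel f x t' - duhamel f x t
      = (\<integral>z. duhamel_integrand f x t' z - duhamel_integrand f x t z \<partial>(lborel \<Otimes>\<^sub>M lborel))"
    unfolding duhamel_def using t f M
    by (intro Bochner_Integration.integral_diff[symmetric] integrable_duhamel_integrand duhamel_abs_finite) auto
  then have "ennreal \<bar>duhamel f x t' - duhamel f x t\<bar>
      \<le> (\<integral>\<^sup>+z. ennreal \<bar>duhamel_integrand f x t' z - duhamel_integrand f x t z\<bar> \<partial>(lborel \<Otimes>\<^sub>M lborel))"
    by (simp only: abs_integral_le_nn_integral)
  also have "\<dots> = (\<integral>\<^sup>+s. duhamel_slice_diff f x t' t s \<partial>lborel)"
    unfolding duhamel_slice_diff_def by (rule lborel_pair.nn_integral_snd[symmetric]) (use f(1) in measurable)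
  finally show ?thesis .
qed

lemma duhamel_slice_diff_early:
  assumes f: "jointly_measurable f" "source_bound M f" and M: "0 \<le> M"
    and \<eta>: "0 < \<eta>" and s: "0 < s" "s \<le> t - \<eta>" and t: "t \<le> t'" "t' < T"
  shows "duhamel_slice_diff f x t' t s
    \<le> ennreal (2 * smoothing_const * \<eta> powr (- N) * M * time_modulus (1 + (t' - t) / \<eta>)) * ennreal (source_rate s)"
proof -
  define B where "B = smoothing_const * \<eta> powr (- N) * M * source_rate s"
  have B: "0 \<le> B" using M smoothing_const_nonneg source_rate_nonneg by (simp add: B_def)
  have heat_abs: "heat_abs (\<lambda>y. f y s) \<tau> x \<le> ennreal B" if "\<eta> \<le> \<tau>" for \<tau>
    unfolding B_def using s t \<eta> that by (intro heat_abs_source_smoothing f M) auto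
  have r: "1 \<le> (t' - s) / (t - s)" "(t' - s) / (t - s) \<le> 1 + (t' - t) / \<eta>"
  proof -
    have "(t' - s) / (t - s) = 1 + (t' - t) / (t - s)" using s \<eta> by (simp add: field_simps)
    moreover have "(t' - t) / (t - s) \<le> (t' - t) / \<eta>" using s t \<eta> by (intro divide_left_mono) auto
    ultimately show "(t' - s) / (t - s) \<le> 1 + (t' - t) / \<eta>" by simp
  qed (use s t \<eta> in simp)
  have "duhamel_slice_diff f x t' t s = (\<integral>\<^sup>+y. ennreal (\<bar>G (x - y) (t' - s) - G (x - y) (t - s)\<bar> * \<bar>f y s\<bar>) \<partial>lborel)"
    using s t \<eta> by (simp add: duhamel_slice_diff_def duhamel_integrand_def abs_mult[symmetric] left_diff_distrib)
  also have "\<dots> \<le> ennreal (time_modulus ((t' - s) / (t - s))) *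
      (heat_abs (\<lambda>y. f y s) (2 powr (\<theta> / 2) * (t' - s)) x + heat_abs (\<lambda>y. f y s) (t - s) x)"
    using s t \<eta> f(1) by (intro nn_integral_G_increment_le) auto
  also have "\<dots> \<le> ennreal (time_modulus (1 + (t' - t) / \<eta>)) * (ennreal B + ennreal B)"
    using s t \<eta> r by (intro mult_mono add_mono heat_abs ennreal_leI time_modulus_mono le_two_powr_multI) auto
  also have "\<dots> = ennreal (2 * smoothing_const * \<eta> powr (- N) * M * time_modulus (1 + (t' - t) / \<eta>))
      * ennreal (source_rate s)"
    using B r M smoothing_const_nonneg
    by (simp add: ennreal_mult[symmetric] ennreal_plus[symmetric] time_modulus_nonneg source_rate_nonneg B_def
        mult_ac del: ennreal_plus)
  finally show ?thesis .
qed

lemma duhamel_slice_diff_late: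
  assumes f[measurable]: "jointly_measurable f" "source_bound M f" and M: "0 \<le> M"
    and a: "0 < a" "a \<le> s" "s < T"
  shows "duhamel_slice_diff f x t' t s \<le> ennreal (2 * M * a powr (- N - 1))"
proof -
  define B where "B = M * a powr (- N - 1)"
  have s: "0 < s" using a by simp
  have "s powr (- N) * source_rate s \<le> s powr (- N - 1)" by (rule powr_minus_mult_source_rate_le[OF s])
  also have "\<dots> \<le> a powr (- N - 1)" using a N_pos by (intro powr_mono2') auto
  finally have "M * (s powr (- N) * source_rate s) \<le> B" using M by (simp add: B_def mult_left_mono)
  then have slice: "(\<integral>\<^sup>+y. ennreal \<bar>duhamel_integrand f x \<tau> (y, s)\<bar> \<partial>lborel) \<le> ennreal B" for \<tau>
    unfolding nn_integral_duhamel_integrand_slice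
    using heat_abs_source_le_sup[OF f s a(3), of "\<tau> - s" x]
    by (auto simp: indicator_def intro: order_trans ennreal_leI)
  have "duhamel_slice_diff f x t' t s
      \<le> (\<integral>\<^sup>+y. ennreal \<bar>duhamel_integrand f x t' (y, s)\<bar> + ennreal \<bar>duhamel_integrand f x t (y, s)\<bar> \<partial>lborel)"
    unfolding duhamel_slice_diff_def
    by (intro nn_integral_mono) (simp add: ennreal_plus[symmetric] ennreal_leI abs_triangle_ineq4 del: ennreal_plus)
  also have "\<dots> = (\<integral>\<^sup>+y. ennreal \<bar>duhamel_integrand f x t' (y, s)\<bar> \<partial>lborel)
      + (\<integral>\<^sup>+y. ennreal \<bar>duhamel_integrand f x t (y, s)\<bar> \<partial>lborel)"
    using f(1) by (intro nn_integral_add) measurable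
  also have "\<dots> \<le> ennreal B + ennreal B" by (intro add_mono slice)
  also have "\<dots> = ennreal (2 * M * a powr (- N - 1))"
    using M by (simp add: B_def ennreal_plus[symmetric] del: ennreal_plus)
  finally show ?thesis .
qed

lemma duhamel_slice_diff_le:
  assumes f: "jointly_measurable f" "source_bound M f" and M: "0 \<le> M"
    and \<eta>: "0 < \<eta>" "2 * \<eta> \<le> a" and t: "a \<le> t" "t \<le> t'" "t' < T"
  shows "duhamel_slice_diff f x t' t s
    \<le> ennreal (2 * smoothing_const * \<eta> powr (- N) * M * time_modulus (1 + (t' - t) / \<eta>)) *
        (ennreal (source_rate s) * indicator {0<..<t} s) +
      ennreal (2 * M * (a / 2) powr (- N - 1)) * indicator {t - \<eta>..t'} s"
proof -
  consider "s \<le> 0 \<or> t' \<le> s" | "0 < s" "s < t - \<eta>" | "t - \<eta> \<le> s" "s < t'" by linarith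
  then show ?thesis
  proof cases
    case 1
    then show ?thesis using t by (auto simp: duhamel_slice_diff_def duhamel_integrand_def)
  next
    case 2
    then show ?thesis
      using duhamel_slice_diff_early[OF f M \<eta>(1), of s t t' x] t \<eta> by (simp add: add_increasing2)
  next
    case 3
    then show ?thesis
      using duhamel_slice_diff_late[OF f M, of "a / 2" s x t' t] t \<eta> by (simp add: add_increasing)
  qed
qed

lemma duhamel_time_modulus_ordered:
  assumes f: "jointly_measurable f" "source_bound M f" and M: "0 \<le> M"
    and \<eta>: "0 < \<eta>" "2 * \<eta> \<le> a" and t: "a \<le> t" "t \<le> t'" "t' < T"
  shows "\<bar>duhamel f x t' - duhamel f x t\<bar>
    \<le> 2 * smoothing_const * \<eta> powr (- N) * M * source_const * time_modulus (1 + (t' - t) / \<eta>) +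
      2 * M * (a / 2) powr (- N - 1) * (t' - t + \<eta>)"
proof -
  define w A where "w = 2 * smoothing_const * \<eta> powr (- N) * M * time_modulus (1 + (t' - t) / \<eta>)"
    and "A = 2 * M * (a / 2) powr (- N - 1)"
  have w: "0 \<le> w" and A: "0 \<le> A"
    using M smoothing_const_nonneg t \<eta> by (auto simp: w_def A_def intro!: mult_nonneg_nonneg time_modulus_nonneg)
  have "ennreal \<bar>duhamel f x t' - duhamel f x t\<bar> \<le> (\<integral>\<^sup>+s. duhamel_slice_diff f x t' t s \<partial>lborel)"
    using t \<eta> by (intro abs_duhamel_diff_le[OF f M]) auto
  also have "\<dots> \<le> (\<integral>\<^sup>+s. ennreal w * (ennreal (source_rate s) * indicator {0<..<t} s)
      + ennreal A * indicator {t - \<eta>..t'} s \<partial>lborel)"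
    unfolding w_def A_def by (intro nn_integral_mono duhamel_slice_diff_le f M \<eta> t)
  also have "\<dots> = ennreal w * (\<integral>\<^sup>+s\<in>{0<..<t}. ennreal (source_rate s) \<partial>lborel) + ennreal A * ennreal (t' - t + \<eta>)"
    using \<eta> t by (subst nn_integral_add) (auto simp: nn_integral_cmult nn_integral_cmult_indicator algebra_simps)
  also have "\<dots> \<le> ennreal w * ennreal source_const + ennreal A * ennreal (t' - t + \<eta>)"
    using t \<eta> T by (intro add_right_mono mult_left_mono nn_integral_source_rate_le_const) auto
  also have "\<dots> = ennreal (w * source_const + A * (t' - t + \<eta>))"
    using w A source_const_pos t \<eta> by (simp add: ennreal_mult[symmetric] ennreal_plus[symmetric] del: ennreal_plus)
  finally have "\<bar>duhamel f x t' - duhamel f x t\<bar> \<le> w * source_const + A * (t' - t + \<eta>)"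
    using w A source_const_pos t \<eta> by (subst (asm) ennreal_le_iff) auto
  then show ?thesis by (simp add: w_def A_def mult_ac)
qed

lemma duhamel_time_modulus:
  assumes f: "jointly_measurable f" "source_bound M f" and M: "0 \<le> M"
    and \<eta>: "0 < \<eta>" "2 * \<eta> \<le> a" and t: "a \<le> t" "t < T" "a \<le> s" "s < T"
  shows "\<bar>duhamel f x s - duhamel f x t\<bar>
    \<le> 2 * smoothing_const * \<eta> powr (- N) * M * source_const * time_modulus (1 + \<bar>s - t\<bar> / \<eta>) +
      2 * M * (a / 2) powr (- N - 1) * (\<bar>s - t\<bar> + \<eta>)"
  using duhamel_time_modulus_ordered[OF f M \<eta>, of t s x] duhamel_time_modulus_ordered[OF f M \<eta>, of s t x] t
  by (cases "t \<le> s") (auto simp: abs_minus_commute)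

lemma eventually_half_le: "0 < t \<Longrightarrow> \<forall>\<^sub>F s in at t within {0<..<T}. t / 2 \<le> s \<and> s < T" for t :: real
  unfolding eventually_at dist_real_def abs_less_iff by (intro exI[of _ "t / 2"]) auto

lemma time_modulus_increment_tendsto_0:
  assumes \<eta>: "0 < \<eta>"
  shows "((\<lambda>s. time_modulus (1 + \<bar>s - t\<bar> / \<eta>)) \<longlongrightarrow> 0) (at t within A)"
proof (rule time_modulus_tendsto_0)
  have "((\<lambda>s. 1 + \<bar>s - t\<bar> / \<eta>) \<longlongrightarrow> 1 + \<bar>t - t\<bar> / \<eta>) (at t within A)"
    using \<eta> by (intro tendsto_intros) auto
  then show "((\<lambda>s. 1 + \<bar>s - t\<bar> / \<eta>) \<longlongrightarrow> 1) (at t within A)" by simp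
qed

lemma heat_uniform_limit:
  assumes \<phi>: "\<phi> \<in> borel_measurable borel" "local_mass_le \<rho> \<phi> (ennreal M)" and M: "0 \<le> M" and t: "0 < t" "t < T"
  shows "uniform_limit UNIV (\<lambda>s x. heat \<phi> x s) (\<lambda>x. heat \<phi> x t) (at t within {0<..<T})"
proof (rule uniform_limitI)
  fix e :: real assume e: "0 < e"
  let ?b = "\<lambda>s. 2 * smoothing_const * (t / 2) powr (- N) * M * time_modulus (1 + \<bar>s - t\<bar> / (t / 2))"
  have "(?b \<longlongrightarrow> 0) (at t within {0<..<T})"
    using t by (intro tendsto_mult_right_zero time_modulus_increment_tendsto_0) simp
  with e have "\<forall>\<^sub>F s in at t within {0<..<T}. ?b s < e" by (blast dest: order_tendstoD(2))
  with eventually_half_le[OF t(1)]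
  show "\<forall>\<^sub>F s in at t within {0<..<T}. \<forall>x\<in>UNIV. dist (heat \<phi> x s) (heat \<phi> x t) < e"
  proof eventually_elim
    case (elim s)
    have "\<bar>heat \<phi> x s - heat \<phi> x t\<bar> \<le> ?b s" for x
      using t elim by (intro heat_time_modulus \<phi> M) auto
    then show ?case using elim by (auto simp: dist_real_def intro: le_less_trans)
  qed
qed

lemma duhamel_uniform_limit:
  assumes f: "jointly_measurable f" "source_bound M f" and M: "0 \<le> M" and t: "0 < t" "t < T"
  shows "uniform_limit UNIV (\<lambda>s x. duhamel f x s) (\<lambda>x. duhamel f x t) (at t within {0<..<T})"
proof (rule uniform_limitI)
  fix e :: real assume e: "0 < e"
  define C where "C = 2 * M * (t / 2 / 2) powr (- N - 1)"
  have C: "0 \<le> C" using M by (simp add: C_def)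
  define \<eta> where "\<eta> = min (t / 4) (e / (C + 1))"
  have \<eta>: "0 < \<eta>" "2 * \<eta> \<le> t / 2" "\<eta> \<le> e / (C + 1)" using t e C by (auto simp: \<eta>_def)
  have "C * \<eta> < (C + 1) * \<eta>" using \<eta> by simp
  also have "\<dots> \<le> (C + 1) * (e / (C + 1))" using C \<eta> by (intro mult_left_mono) auto
  finally have small: "C * (\<bar>t - t\<bar> + \<eta>) < e" using C by simp
  let ?b = "\<lambda>s. 2 * smoothing_const * \<eta> powr (- N) * M * source_const * time_modulus (1 + \<bar>s - t\<bar> / \<eta>)
      + C * (\<bar>s - t\<bar> + \<eta>)"
  have "(?b \<longlongrightarrow> 0 + C * (\<bar>t - t\<bar> + \<eta>)) (at t within {0<..<T})"
    using \<eta>(1) by (intro tendsto_add tendsto_mult_right_zero time_modulus_increment_tendsto_0 tendsto_intros)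
  with small have "\<forall>\<^sub>F s in at t within {0<..<T}. ?b s < e" by (auto dest: order_tendstoD(2))
  with eventually_half_le[OF t(1)]
  show "\<forall>\<^sub>F s in at t within {0<..<T}. \<forall>x\<in>UNIV. dist (duhamel f x s) (duhamel f x t) < e"
  proof eventually_elim
    case (elim s)
    have "\<bar>duhamel f x s - duhamel f x t\<bar> \<le> ?b s" for x
      unfolding C_def using t elim by (intro duhamel_time_modulus f M \<eta>) auto
    then show ?case using elim by (auto simp: dist_real_def intro: le_less_trans)
  qed
qed

end

section \<open>The initial trace\<close>

lemma compactly_supported_mult_mass:
  fixes g f :: "'a::euclidean_space \<Rightarrow> real"
  assumes [measurable]: "f \<in> borel_measurable borel" "g \<in> borel_measurable borel"
    and B: "\<And>x. \<bar>g x\<bar> \<le> B" and supp: "\<And>x. x \<notin> ball z R \<Longrightarrow> g x = 0"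
    and M: "mass f (ball z R) \<le> ennreal M" "0 \<le> M"
  shows integrable_compactly_supported_mult: "integrable lborel (\<lambda>x. g x * f x)"
    and abs_integral_compactly_supported_mult_le: "\<bar>\<integral>x. g x * f x \<partial>lborel\<bar> \<le> B * M"
proof -
  have B0: "0 \<le> B" using B[of 0] by linarith
  have "ennreal \<bar>g x * f x\<bar> \<le> ennreal B * (ennreal \<bar>f x\<bar> * indicator (ball z R) x)" for x
    using B[of x] supp[of x] B0
    by (cases "x \<in> ball z R") (auto simp: abs_mult ennreal_mult[symmetric] mult_right_mono intro!: ennreal_leI)
  then have "(\<integral>\<^sup>+x. ennreal \<bar>g x * f x\<bar> \<partial>lborel)
      \<le> (\<integral>\<^sup>+x. ennreal B * (ennreal \<bar>f x\<bar> * indicator (ball z R) x) \<partial>lborel)"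
    by (rule nn_integral_mono)
  also have "\<dots> = ennreal B * mass f (ball z R)" by (rule nn_integral_cmult) measurable
  also have "\<dots> \<le> ennreal B * ennreal M" by (intro mult_left_mono M) simp
  also have "\<dots> = ennreal (B * M)" using B0 M by (simp add: ennreal_mult)
  finally have bound: "(\<integral>\<^sup>+x. ennreal \<bar>g x * f x\<bar> \<partial>lborel) \<le> ennreal (B * M)" .
  then show "integrable lborel (\<lambda>x. g x * f x)"
    by (auto simp: integrable_iff_bounded intro: le_less_trans)
  have "ennreal \<bar>\<integral>x. g x * f x \<partial>lborel\<bar> \<le> ennreal (B * M)"
    using abs_integral_le_nn_integral bound by (rule order_trans)
  then show "\<bar>\<integral>x. g x * f x \<partial>lborel\<bar> \<le> B * M" using B0 M by (subst (asm) ennreal_le_iff) auto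
qed

definition correlation :: "('a::euclidean_space \<Rightarrow> real) \<Rightarrow> ('a \<Rightarrow> real) \<Rightarrow> 'a \<Rightarrow> real" where
  "correlation \<psi> \<phi> w = (\<integral>x. \<psi> (x + w) * \<phi> x \<partial>lborel)"

lemma borel_measurable_correlation [measurable]:
  assumes [measurable]: "\<phi> \<in> borel_measurable borel" "\<psi> \<in> borel_measurable borel"
  shows "correlation \<psi> \<phi> \<in> borel_measurable borel"
  unfolding correlation_def by measurable

lemma
  fixes \<phi> \<psi> :: "'a::euclidean_space \<Rightarrow> real"
  assumes [measurable]: "\<phi> \<in> borel_measurable borel" "\<psi> \<in> borel_measurable borel"
    and B: "\<And>x. \<bar>\<psi> x\<bar> \<le> B" and supp: "\<And>x. R \<le> norm x \<Longrightarrow> \<psi> x = 0"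
    and M: "local_mass_le R \<phi> (ennreal M)" "0 \<le> M"
  shows integrable_correlation: "integrable lborel (\<lambda>x. \<psi> (x + w) * \<phi> x)"
    and abs_correlation_le: "\<bar>correlation \<psi> \<phi> w\<bar> \<le> B * M"
proof -
  have "\<psi> (x + w) = 0" if "x \<notin> ball (- w) R" for x
    using that by (intro supp) (simp add: dist_norm norm_minus_commute)
  then show "integrable lborel (\<lambda>x. \<psi> (x + w) * \<phi> x)" "\<bar>correlation \<psi> \<phi> w\<bar> \<le> B * M"
    using compactly_supported_mult_mass[of \<phi> "\<lambda>x. \<psi> (x + w)" B "- w" R M] B M
    by (auto simp: correlation_def local_mass_le_def)
qed

lemma isCont_correlation_0:
  fixes \<phi> \<psi> :: "'a::euclidean_space \<Rightarrow> real"
  assumes [measurable]: "\<phi> \<in> borel_measurable borel" and \<psi>: "continuous_on UNIV \<psi>"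
    and B: "\<And>x. \<bar>\<psi> x\<bar> \<le> B" and supp: "\<And>x. R \<le> norm x \<Longrightarrow> \<psi> x = 0"
    and M: "local_mass_le (R + 1) \<phi> (ennreal M)" "0 \<le> M"
  shows "isCont (correlation \<psi> \<phi>) 0"
proof -
  have [measurable]: "\<psi> \<in> borel_measurable borel" by (rule borel_measurable_continuous_onI[OF \<psi>])
  have B0: "0 \<le> B" using B[of 0] by linarith
  let ?b = "\<lambda>x. B * indicator (ball 0 (R + 1)) x"
  have dominated: "\<bar>\<psi> (x + w)\<bar> \<le> ?b x" if "norm w \<le> 1" for x w
  proof (cases "norm (x + w) < R")
    case True
    then have "norm x < R + 1" using norm_triangle_ineq4[of "x + w" w] that by simp
    then show ?thesis using B[of "x + w"] by simp
  qed (use supp B0 in simp)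
  have "(\<lambda>n. correlation \<psi> \<phi> (w n)) \<longlonglongrightarrow> correlation \<psi> \<phi> 0" if w: "\<And>n. norm (w n) \<le> 1" "w \<longlonglongrightarrow> 0" for w
    unfolding correlation_def
  proof (rule integral_dominated_convergence)
    show "integrable lborel (\<lambda>x. \<bar>?b x * \<phi> x\<bar>)"
      using M(2) B0 M(1)[unfolded local_mass_le_def, rule_format, of 0]
      by (intro integrable_abs integrable_compactly_supported_mult[where B = B and z = 0 and R = "R + 1"])
         (auto simp: indicator_def)
    show "AE x in lborel. norm (\<psi> (x + w n) * \<phi> x) \<le> \<bar>?b x * \<phi> x\<bar>" for n
      using dominated[OF w(1)] B0 by (intro AE_I2) (auto simp: abs_mult intro!: mult_right_mono)
    have "(\<lambda>n. \<psi> (x + w n)) \<longlonglongrightarrow> \<psi> (x + 0)" for x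
      using \<psi> by (intro isCont_tendsto_compose[of _ \<psi>] tendsto_intros w(2))
          (simp add: continuous_on_eq_continuous_at)
    then show "AE x in lborel. (\<lambda>n. \<psi> (x + w n) * \<phi> x) \<longlonglongrightarrow> \<psi> (x + 0) * \<phi> x"
      by (intro AE_I2 tendsto_mult_right)
  qed measurable
  then have "(correlation \<psi> \<phi> \<longlongrightarrow> correlation \<psi> \<phi> 0) (at 0 within ball 0 1)"
    by (simp add: tendsto_at_iff_sequentially o_def less_imp_le)
  then show ?thesis by (simp add: isCont_def at_within_open[OF _ open_ball])
qed

context fractional_heat
begin

lemma integral_G_mult_tendsto:
  fixes H :: "'a \<Rightarrow> real"
  assumes [measurable]: "H \<in> borel_measurable borel" and B: "\<And>w. \<bar>H w\<bar> \<le> B" and cont: "isCont H 0"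
  shows "((\<lambda>t. \<integral>w. G w t * H w \<partial>lborel) \<longlongrightarrow> H 0) (at_right 0)"
proof (rule tendsto_at_right_sequentially[of 0 1])
  fix \<tau> :: "nat \<Rightarrow> real"
  assume \<tau>: "\<And>n. 0 < \<tau> n" "\<tau> \<longlonglongrightarrow> 0"
  define r where "r n = \<tau> n powr (1 / \<theta>)" for n
  have r: "r \<longlonglongrightarrow> 0"
    using tendsto_powr'[OF \<tau>(2) tendsto_const[of "1 / \<theta>"]] \<tau>(1) theta by (simp add: r_def[abs_def] less_imp_le)
  have G1: "integrable lborel (\<lambda>w. G w 1 * B)"
    using has_bochner_integral_G[of 1] by (intro integrable_mult_left) (auto simp: has_bochner_integral_iff)
  have scaled: "(\<integral>w. G w t * H w \<partial>lborel) = (\<integral>w. G w 1 * H (t powr (1 / \<theta>) *\<^sub>R w) \<partial>lborel)" if t: "0 < t" for t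
  proof -
    define c where "c = t powr (1 / \<theta>)"
    have c: "0 < c" "c ^ DIM('a) = t powr N" using t powr_inverse_theta_power by (auto simp: c_def)
    have "integrable lborel (\<lambda>w. G w t * B)"
      using has_bochner_integral_G[OF t] by (intro integrable_mult_left) (auto simp: has_bochner_integral_iff)
    then have "integrable lborel (\<lambda>w. G w t * H w)"
      by (rule Bochner_Integration.integrable_bound)
         (use B G_nonneg[OF t] in \<open>auto simp: abs_mult intro!: mult_left_mono order_trans[OF _ abs_ge_self]\<close>)
    from integral_lborel_affine[OF this, of c 0] c
    have "(\<integral>w. G w t * H w \<partial>lborel) = t powr N * (\<integral>w. G (c *\<^sub>R w) t * H (c *\<^sub>R w) \<partial>lborel)"
      using t by simp
    also have "\<dots> = (\<integral>w. t powr N * (G (c *\<^sub>R w) t * H (c *\<^sub>R w)) \<partial>lborel)"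
      by (rule integral_mult_right_zero[symmetric])
    moreover have "t powr N * (G (c *\<^sub>R w) t * H (c *\<^sub>R w)) = G w 1 * H (c *\<^sub>R w)" for w
      using t by (simp add: G_scaling[OF t] c_def powr_minus)
    ultimately show ?thesis by (simp only: c_def)
  qed
  have "(\<lambda>n. \<integral>w. G w 1 * H (r n *\<^sub>R w) \<partial>lborel) \<longlonglongrightarrow> (\<integral>w. G w 1 * H 0 \<partial>lborel)"
  proof (rule integral_dominated_convergence[OF _ _ G1])
    show "AE w in lborel. norm (G w 1 * H (r n *\<^sub>R w)) \<le> G w 1 * B" for n
      using B G_nonneg[of 1] by (intro AE_I2) (auto simp: abs_mult intro!: mult_left_mono)
    have "(\<lambda>n. H (r n *\<^sub>R w)) \<longlonglongrightarrow> H 0" for w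
      using tendsto_scaleR[OF r tendsto_const[of w]] by (intro isCont_tendsto_compose[OF cont]) simp
    then show "AE w in lborel. (\<lambda>n. G w 1 * H (r n *\<^sub>R w)) \<longlonglongrightarrow> G w 1 * H 0"
      by (intro AE_I2 tendsto_mult_left)
  qed measurable
  moreover have "(\<integral>w. G w 1 * H 0 \<partial>lborel) = H 0"
    using has_bochner_integral_G[of 1] by (simp add: has_bochner_integral_iff)
  ultimately show "(\<lambda>n. \<integral>w. G w (\<tau> n) * H w \<partial>lborel) \<longlonglongrightarrow> H 0"
    by (simp only: scaled[OF \<tau>(1)] r_def)
qed simp

lemma heat_reflect:
  assumes "\<phi> \<in> borel_measurable borel" and "0 < t" and "heat_abs \<phi> t x < \<infinity>"
  shows "heat \<phi> x t = (\<integral>w. G w t * \<phi> (x - w) \<partial>lborel)"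
  using integral_lborel_affine[OF integrable_heat_integrand[OF assms], of "- 1" x] by (simp add: heat_def)

lemma integrable_compactly_supported_heat_integrand:
  assumes \<phi>[measurable]: "\<phi> \<in> borel_measurable borel" and [measurable]: "\<psi> \<in> borel_measurable borel"
    and t: "0 < t" and A: "\<And>x. heat_abs \<phi> t x \<le> ennreal A"
    and B: "\<And>x. \<bar>\<psi> x\<bar> \<le> B" and supp: "\<And>x. R \<le> norm x \<Longrightarrow> \<psi> x = 0"
  shows "integrable (lborel \<Otimes>\<^sub>M lborel) (\<lambda>(x, w). \<psi> x * (G w t * \<phi> (x - w)))"
proof -
  let ?F = "\<lambda>x w. \<psi> x * (G w t * \<phi> (x - w))"
  have slice: "(\<integral>\<^sup>+w. ennreal \<bar>?F x w\<bar> \<partial>lborel) \<le> ennreal B * ennreal A * indicator (ball 0 R) x" for x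
  proof -
    have "(\<integral>\<^sup>+w. ennreal \<bar>?F x w\<bar> \<partial>lborel) = (\<integral>\<^sup>+w. ennreal \<bar>\<psi> x\<bar> * (ennreal (G w t) * ennreal \<bar>\<phi> (x - w)\<bar>) \<partial>lborel)"
      using G_nonneg[OF t] by (simp add: abs_mult ennreal_mult)
    also have "\<dots> = ennreal \<bar>\<psi> x\<bar> * heat_abs \<phi> t x"
      unfolding heat_abs_reflect[OF \<phi> t] by (rule nn_integral_cmult) measurable
    also have "\<dots> \<le> ennreal B * indicator (ball 0 R) x * ennreal A"
      using B[of x] supp[of x] by (intro mult_mono A) (auto simp: indicator_def intro!: ennreal_leI)
    finally show ?thesis by (simp add: mult_ac)
  qed
  have "(\<integral>\<^sup>+z. ennreal \<bar>case_prod ?F z\<bar> \<partial>(lborel \<Otimes>\<^sub>M lborel)) = (\<integral>\<^sup>+x. \<integral>\<^sup>+w. ennreal \<bar>?F x w\<bar> \<partial>lborel \<partial>lborel)"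
    by (subst lborel.nn_integral_fst[symmetric]) auto
  also have "\<dots> \<le> (\<integral>\<^sup>+x. ennreal B * ennreal A * indicator (ball (0::'a) R) x \<partial>lborel)"
    by (intro nn_integral_mono slice)
  also have "\<dots> < \<infinity>"
    using emeasure_lborel_ball_finite[of "0::'a" R] by (simp add: nn_integral_cmult_indicator ennreal_mult_less_top)
  finally show ?thesis by (simp add: integrable_iff_bounded)
qed

lemma integral_heat_mult:
  assumes \<phi>[measurable]: "\<phi> \<in> borel_measurable borel" and \<psi>[measurable]: "\<psi> \<in> borel_measurable borel"
    and t: "0 < t" and A: "\<And>x. heat_abs \<phi> t x \<le> ennreal A"
    and B: "\<And>x. \<bar>\<psi> x\<bar> \<le> B" and supp: "\<And>x. R \<le> norm x \<Longrightarrow> \<psi> x = 0"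
    and M: "local_mass_le R \<phi> (ennreal M)" "0 \<le> M"
  shows "(\<integral>x. \<psi> x * heat \<phi> x t \<partial>lborel) = (\<integral>w. G w t * correlation \<psi> \<phi> w \<partial>lborel)"
proof -
  let ?F = "\<lambda>x w. \<psi> x * (G w t * \<phi> (x - w))"
  have finite: "heat_abs \<phi> t x < \<infinity>" for x using A[of x] by (auto intro: le_less_trans)
  have over_w: "(\<integral>w. ?F x w \<partial>lborel) = \<psi> x * heat \<phi> x t" for x
    by (simp add: heat_reflect[OF \<phi> t finite])
  have over_x: "(\<integral>x. ?F x w \<partial>lborel) = G w t * correlation \<psi> \<phi> w" for w
  proof -
    have "correlation \<psi> \<phi> w = (\<integral>x. \<psi> x * \<phi> (x - w) \<partial>lborel)"
      using integral_lborel_affine[OF integrable_correlation[OF \<phi> \<psi> B supp M, of w], of 1 "- w"]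
      by (simp add: correlation_def)
    then show ?thesis
      by (simp add: mult.left_commute[of "\<psi> _"])
  qed
  show ?thesis
    using lborel_pair.Fubini_integral[OF integrable_compactly_supported_heat_integrand[OF \<phi> \<psi> t A B supp]]
    unfolding over_w over_x by (rule sym)
qed

end

context critical_problem
begin

lemma heat_tendsto_distribution:
  assumes \<phi>: "\<phi> \<in> borel_measurable borel" "local_mass_le \<rho> \<phi> (ennreal M)" and M: "0 \<le> M"
    and \<psi>: "continuous_on UNIV \<psi>" "\<And>x. \<bar>\<psi> x\<bar> \<le> B" "\<And>x. R \<le> norm x \<Longrightarrow> \<psi> x = 0"
  shows "((\<lambda>t. \<integral>x. \<psi> x * heat \<phi> x t \<partial>lborel) \<longlongrightarrow> (\<integral>x. \<psi> x * \<phi> x \<partial>lborel)) (at_right 0)"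
proof -
  have \<psi>_borel: "\<psi> \<in> borel_measurable borel" by (rule borel_measurable_continuous_onI[OF \<psi>(1)])
  define m where "m = real (covering_number TYPE('a) (R + 1) \<rho>) * M"
  have m: "0 \<le> m" "local_mass_le (R + 1) \<phi> (ennreal m)"
    using local_mass_le_larger_radius[OF \<phi>(1) _ \<phi>(2), of "R + 1"] T M
    by (auto simp: m_def ennreal_mult ennreal_of_nat_eq_real_of_nat)
  have m_R: "local_mass_le R \<phi> (ennreal m)" by (rule local_mass_le_smaller_radius[OF m(2)]) simp
  have "((\<lambda>t. \<integral>w. G w t * correlation \<psi> \<phi> w \<partial>lborel) \<longlongrightarrow> correlation \<psi> \<phi> 0) (at_right 0)"
    by (intro integral_G_mult_tendsto[where B = "B * m"] isCont_correlation_0[OF \<phi>(1) \<psi> m(2,1)]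
        borel_measurable_correlation \<phi>(1) \<psi>_borel
        abs_correlation_le[OF \<phi>(1) \<psi>_borel \<psi>(2,3) m_R m(1)])
  moreover have "\<forall>\<^sub>F t in at_right 0. (\<integral>w. G w t * correlation \<psi> \<phi> w \<partial>lborel) = (\<integral>x. \<psi> x * heat \<phi> x t \<partial>lborel)"
    using eventually_at_right_real[OF T(1)]
  proof eventually_elim
    case (elim t)
    then have t: "0 < t" "t \<le> T" by auto
    show ?case
      by (rule integral_heat_mult[OF \<phi>(1) \<psi>_borel t(1) heat_abs_le_of_local_mass[OF \<phi> M t order_refl] \<psi>(2,3)
            m_R m(1), symmetric])
  qed
  ultimately have "((\<lambda>t. \<integral>x. \<psi> x * heat \<phi> x t \<partial>lborel) \<longlongrightarrow> correlation \<psi> \<phi> 0) (at_right 0)"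
    by (rule Lim_transform_eventually)
  then show ?thesis by (simp add: correlation_def)
qed

lemma mass_duhamel_le:
  "jointly_measurable f \<Longrightarrow> mass (\<lambda>x. duhamel f x t) E \<le> (\<integral>\<^sup>+x\<in>E. duhamel_abs f x t \<partial>lborel)"
  using abs_duhamel_le by (intro nn_integral_mono mult_right_mono) auto

lemma local_mass_duhamel:
  assumes f: "jointly_measurable f" "source_bound M f" and M: "0 \<le> M" and t: "0 < t" "t < T"
  shows "local_mass_le \<rho> (\<lambda>x. duhamel f x t) (ennreal (source_const * M * Lg t powr (- N)))"
  unfolding local_mass_le_def
  using order_trans[OF mass_duhamel_le[OF f(1)] nn_integral_duhamel_abs_le[OF f(1) _ f(2) M t, of UNIV]] by auto

lemma duhamel_tendsto_distribution:
  assumes f[measurable]: "jointly_measurable f" and src: "source_bound M f" and M: "0 \<le> M"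
    and \<psi>[measurable]: "\<psi> \<in> borel_measurable borel"
    and B: "\<And>x. \<bar>\<psi> x\<bar> \<le> B" and supp: "\<And>x. R \<le> norm x \<Longrightarrow> \<psi> x = 0"
  shows "((\<lambda>t. \<integral>x. \<psi> x * duhamel f x t \<partial>lborel) \<longlongrightarrow> 0) (at_right 0)"
proof -
  define c where "c = real (covering_number TYPE('a) R \<rho>) * (source_const * M)"
  have c: "0 \<le> c" using M source_const_pos by (simp add: c_def)
  have "\<forall>\<^sub>F t in at_right 0. norm (\<integral>x. \<psi> x * duhamel f x t \<partial>lborel) \<le> B * (c * Lg t powr (- N))"
    using eventually_at_right_real[OF T(1)]
  proof eventually_elim
    case (elim t)
    have "local_mass_le R (\<lambda>x. duhamel f x t) (of_nat (covering_number TYPE('a) R \<rho>) * ennreal (source_const * M * Lg t powr (- N)))"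
      using elim T(1) by (intro local_mass_le_larger_radius local_mass_duhamel f src M) auto
    then have "mass (\<lambda>x. duhamel f x t) (ball 0 R) \<le> ennreal (c * Lg t powr (- N))"
      using M source_const_pos
      by (simp add: local_mass_le_def c_def ennreal_of_nat_eq_real_of_nat ennreal_mult[symmetric] mult_ac)
    then show ?case
      using abs_integral_compactly_supported_mult_le[OF _ \<psi> B, of "\<lambda>x. duhamel f x t" 0 R] supp c by simp
  qed
  moreover have "((\<lambda>t. B * (c * Lg t powr (- N))) \<longlongrightarrow> 0) (at_right 0)"
    by (intro tendsto_mult_right_zero Lg_powr_minus_tendsto_0 N_pos)
  ultimately show ?thesis by (rule Lim_null_comparison)
qed

lemma nn_integral_duhamel_abs_interpolate:
  assumes f[measurable]: "jointly_measurable f" and E[measurable]: "E \<in> sets borel"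
    and src: "source_bound M f" and M: "0 \<le> M" and t: "0 < t" "t < T"
    and \<sigma>: "0 < \<sigma>" "emeasure lborel E = ennreal \<sigma>" and \<gamma>: "0 \<le> \<gamma>" "\<gamma> \<le> N"
  shows "(\<integral>\<^sup>+x\<in>E \<inter> ball z \<rho>. duhamel_abs f x t \<partial>lborel)
    \<le> ennreal ((source_const + duhamel_mass_const) * M * Lg t powr (- (N - \<gamma>)) * Lg \<sigma> powr (- \<gamma>))"
proof -
  define C where "C = source_const + duhamel_mass_const"
  have C: "source_const \<le> C" "duhamel_mass_const \<le> C" "0 \<le> C"
    using source_const_pos duhamel_mass_const_pos by (auto simp: C_def)
  define L where "L = max (Lg t) (Lg \<sigma>)"
  have L: "Lg t \<le> L" "Lg \<sigma> \<le> L" "0 < Lg t" "0 < Lg \<sigma>" using Lg_pos t \<sigma> by (auto simp: L_def)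
  have "(\<integral>\<^sup>+x\<in>E \<inter> ball z \<rho>. duhamel_abs f x t \<partial>lborel) \<le> ennreal (C * M * L powr (- N))"
  proof (cases "Lg t \<le> Lg \<sigma>")
    case True
    then show ?thesis
      using nn_integral_duhamel_abs_le_log[OF f E src M t \<sigma>, of z] C M
      by (elim order_trans) (auto simp: L_def intro!: ennreal_leI mult_right_mono)
  next
    case False
    then show ?thesis
      using nn_integral_duhamel_abs_le[OF f E src M t, of z] C M
      by (elim order_trans) (auto simp: L_def intro!: ennreal_leI mult_right_mono)
  qed
  also have "L powr (- N) = L powr (- (N - \<gamma>)) * L powr (- \<gamma>)"
    by (simp flip: powr_add)
  also have "C * M * (L powr (- (N - \<gamma>)) * L powr (- \<gamma>)) \<le> C * M * (Lg t powr (- (N - \<gamma>)) * Lg \<sigma> powr (- \<gamma>))"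
    using C M L \<gamma> by (intro mult_left_mono mult_mono powr_mono2') auto
  finally show ?thesis by (simp add: C_def mult.assoc ennreal_leI)
qed

definition trace_const :: real where
  "trace_const = real (covering_number TYPE('a) 1 \<rho>) * (source_const + duhamel_mass_const)"

lemma trace_const_nonneg: "0 \<le> trace_const"
  using source_const_pos duhamel_mass_const_pos by (simp add: trace_const_def)

lemma ul_norm_duhamel_le:
  assumes f[measurable]: "jointly_measurable f" and src: "source_bound M f" and M: "0 \<le> M"
    and t: "0 < t" "t < T" and \<gamma>: "0 \<le> \<gamma>" "\<gamma> \<le> N"
  shows "ul_norm 1 \<gamma> (\<lambda>x. duhamel f x t) \<le> ennreal (trace_const * M * Lg t powr (- (N - \<gamma>)))"
proof (intro ul_norm_le log_boundedI)
  fix z :: 'a and E :: "'a set" and s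
  assume E[measurable]: "E \<in> sets borel" and s: "0 < s" "emeasure lborel E = ennreal s"
  let ?m = "(source_const + duhamel_mass_const) * M * Lg t powr (- (N - \<gamma>)) * Lg s powr (- \<gamma>)"
  have "mass (\<lambda>x. duhamel f x t) (E \<inter> ball z' \<rho>) \<le> ennreal ?m" for z'
    using mass_duhamel_le[OF f] nn_integral_duhamel_abs_interpolate[OF f E src M t s \<gamma>] by (rule order_trans)
  then have "mass (\<lambda>x. duhamel f x t) (E \<inter> ball z 1) \<le> of_nat (covering_number TYPE('a) 1 \<rho>) * ennreal ?m"
    using T(1) by (intro mass_ball_le_covering_number) auto
  also have "\<dots> = ennreal (trace_const * M * Lg t powr (- (N - \<gamma>)) * Lg s powr (- \<gamma>))"
    using M source_const_pos duhamel_mass_const_pos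
    by (simp add: trace_const_def ennreal_of_nat_eq_real_of_nat ennreal_mult[symmetric] mult.assoc)
  finally show "mass (\<lambda>x. duhamel f x t) (E \<inter> ball z 1)
      \<le> ennreal (trace_const * M * Lg t powr (- (N - \<gamma>)) * Lg s powr (- \<gamma>))" .
qed (use M trace_const_nonneg in simp)

end

section \<open>From the integral equation to solutions\<close>

context fractional_heat
begin

lemma
  assumes f: "f \<in> borel_measurable lebesgue" and [measurable]: "g \<in> borel_measurable borel"
    and ae: "AE y in lborel. f y = g y"
  shows frac_semigroup_eq_heat: "frac_semigroup \<theta> t f x = heat g x t"
    and integrable_lebesgue_heat_integrand_iff:
      "integrable lebesgue (\<lambda>y. G (x - y) t * f y) \<longleftrightarrow> integrable lborel (\<lambda>y. G (x - y) t * g y)"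
proof -
  have g': "(\<lambda>y. G (x - y) t * g y) \<in> borel_measurable lborel" by measurable
  have f': "(\<lambda>y. G (x - y) t * f y) \<in> borel_measurable lebesgue"
    by (intro borel_measurable_times f measurable_completion) measurable
  have ae': "AE y in lebesgue. G (x - y) t * f y = G (x - y) t * g y"
    using ae by (intro AE_completion) auto
  show "frac_semigroup \<theta> t f x = heat g x t"
    unfolding frac_semigroup_def heat_def integral_cong_AE[OF f' measurable_completion[OF g'] ae']
    by (rule integral_completion[OF g'])
  show "integrable lebesgue (\<lambda>y. G (x - y) t * f y) \<longleftrightarrow> integrable lborel (\<lambda>y. G (x - y) t * g y)"
    unfolding integrable_cong_AE[OF f' measurable_completion[OF g'] ae'] by (rule integrable_completion[OF g'])
qed

lemma set_integrable_duhamel_integrand: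
  assumes f[measurable]: "jointly_measurable f" and finite: "duhamel_abs f x t < \<infinity>"
  shows "set_integrable (lebesgue :: ('a \<times> real) measure) (UNIV \<times> {0<..<t}) (\<lambda>(y, s). G (x - y) (t - s) * f y s)"
proof -
  have "integrable lborel (duhamel_integrand f x t)"
    using integrable_duhamel_integrand[OF f finite] by (simp add: lborel_prod)
  then have "integrable lebesgue (duhamel_integrand f x t)"
    by (subst integrable_completion) auto
  moreover have "duhamel_integrand f x t
      = (\<lambda>z. indicator (UNIV \<times> {0<..<t}) z *\<^sub>R (case z of (y, s) \<Rightarrow> G (x - y) (t - s) * f y s))"
    by (auto simp: duhamel_integrand_def indicator_def)
  ultimately show ?thesis by (simp add: set_integrable_def)
qed

lemma set_integral_frac_semigroup:
  assumes f[measurable]: "jointly_measurable f" and finite: "duhamel_abs f x t < \<infinity>"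
  shows "(LINT s:{0<..<t}|lebesgue. frac_semigroup \<theta> (t - s) (\<lambda>y. f y s) x) = duhamel f x t"
proof -
  have slice: "frac_semigroup \<theta> (t - s) (\<lambda>y. f y s) x = heat (\<lambda>y. f y s) x (t - s)" for s
    by (intro frac_semigroup_eq_heat measurable_completion) auto
  have "(\<lambda>s. indicator {0<..<t} s *\<^sub>R heat (\<lambda>y. f y s) x (t - s)) \<in> borel_measurable lborel"
    unfolding heat_def by measurable
  then have "(LINT s:{0<..<t}|lebesgue. frac_semigroup \<theta> (t - s) (\<lambda>y. f y s) x)
      = (\<integral>s. indicator {0<..<t} s *\<^sub>R heat (\<lambda>y. f y s) x (t - s) \<partial>lborel)"
    unfolding set_lebesgue_integral_def slice by (rule integral_completion)
  also have "\<dots> = (\<integral>s. \<integral>y. duhamel_integrand f x t (y, s) \<partial>lborel \<partial>lborel)"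
    by (simp add: duhamel_integrand_def heat_def)
  also have "\<dots> = duhamel f x t"
    using lborel_pair.integral_snd[of "\<lambda>y s. duhamel_integrand f x t (y, s)"]
        integrable_duhamel_integrand[OF f finite]
    by (simp add: duhamel_def)
  finally show ?thesis .
qed

end

locale mild_solution = critical_problem \<theta> N space_type S T
  for \<theta> N :: real and space_type :: "'a::euclidean_space itself" and S T :: real +
  fixes \<phi> \<phi>' :: "'a \<Rightarrow> real" and k :: real and u :: "'a \<Rightarrow> real \<Rightarrow> real" and K :: real
  assumes \<phi>: "\<phi> \<in> borel_measurable lebesgue"
    and \<phi>': "\<phi>' \<in> borel_measurable borel" "AE x in lborel. \<phi> x = \<phi>' x"
    and \<phi>'_bound: "log_bounded N \<rho> k \<phi>'" and k: "0 \<le> k"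
    and u [measurable]: "jointly_measurable u" and u_bound: "critical_bound K u" and K: "0 < K"
    and equation: "\<And>x t. 0 < t \<Longrightarrow> t < T \<Longrightarrow> u x t = heat \<phi>' x t + duhamel (nonlin u) x t"
begin

definition source_size :: real where
  "source_size = nonlin_const * K powr (1 / N) * K"

lemma source_size_nonneg: "0 \<le> source_size"
  using nonlin_const_pos K by (simp add: source_size_def)

lemma source_bound_nonlin_u: "source_bound source_size (nonlin u)"
  unfolding source_size_def by (rule source_bound_nonlin[OF u K u_bound])

lemmas nonlin_u_source = jointly_measurable_nonlin[OF u] source_bound_nonlin_u source_size_nonneg

lemma frac_semigroup_\<phi>: "frac_semigroup \<theta> t \<phi> x = heat \<phi>' x t"
  by (rule frac_semigroup_eq_heat[OF \<phi> \<phi>'])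

lemma local_mass_\<phi>': "local_mass_le \<rho> \<phi>' (ennreal k)"
  using local_mass_le_of_log_bounded[OF \<phi>'_bound _ k] T(1) N_pos by simp

lemma abs_u_le: "0 < t \<Longrightarrow> t < T \<Longrightarrow> \<bar>u x t\<bar> \<le> K * decay_rate t"
  by (rule critical_bound_supD[OF u_bound])

lemma is_solution_u: "is_solution \<theta> p \<phi> T u"
  unfolding is_solution_def
proof (intro conjI AE_I2 impI)
  have "case_prod u \<in> borel_measurable lborel" using u by (simp add: borel_prod)
  then show "case_prod u \<in> borel_measurable (restrict_space lebesgue (UNIV \<times> {0<..<T}))"
    by (intro measurable_restrict_space1 measurable_completion)
next
  fix z :: "'a \<times> real" assume "z \<in> UNIV \<times> {0<..<T}"
  then obtain x t where z: "z = (x, t)" and t: "0 < t" "t < T" by auto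
  have finite: "heat_abs \<phi>' t x < \<infinity>" "duhamel_abs (nonlin u) x t < \<infinity>"
    using heat_abs_le_decay_rate[OF \<phi>'(1) \<phi>'_bound k t, of x] duhamel_abs_nonlin_finite[OF u K u_bound t]
    by (auto intro: le_less_trans)
  have "integrable lebesgue (\<lambda>y. G (x - y) t * \<phi> y)"
    unfolding integrable_lebesgue_heat_integrand_iff[OF \<phi> \<phi>']
    by (rule integrable_heat_integrand[OF \<phi>'(1) t(1) finite(1)])
  moreover note set_integrable_duhamel_integrand[OF jointly_measurable_nonlin[OF u] finite(2)]
  moreover have "u x t = frac_semigroup \<theta> t \<phi> x
      + (LINT s:{0<..<t}|lebesgue. frac_semigroup \<theta> (t - s) (\<lambda>y. nonlin u y s) x)"
    using equation[OF t]
    by (simp add: frac_semigroup_\<phi> set_integral_frac_semigroup[OF jointly_measurable_nonlin[OF u] finite(2)])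
  ultimately show "case z of (x, t) \<Rightarrow> integrable lebesgue (\<lambda>y. G (x - y) t * \<phi> y) \<and>
      set_integrable (lebesgue :: ('a \<times> real) measure) (UNIV \<times> {0<..<t}) (\<lambda>(y, s). G (x - y) (t - s) * nonlin u y s) \<and>
      u x t = frac_semigroup \<theta> t \<phi> x + (LINT s:{0<..<t}|lebesgue. frac_semigroup \<theta> (t - s) (\<lambda>y. nonlin u y s) x)"
    unfolding z prod.case by blast
qed

lemma u_in_ul_space: "0 < t \<Longrightarrow> t < T \<Longrightarrow> (\<lambda>x. u x t) \<in> ul_space 1 N"
  using abs_u_le N_pos by (intro ul_space_bounded) auto

lemma uniform_limit_u:
  assumes t: "0 < t" "t < T"
  shows "uniform_limit UNIV (\<lambda>s x. u x s) (\<lambda>x. u x t) (at t within {0<..<T})"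
proof -
  have "uniform_limit UNIV (\<lambda>s x. heat \<phi>' x s + duhamel (nonlin u) x s)
      (\<lambda>x. heat \<phi>' x t + duhamel (nonlin u) x t) (at t within {0<..<T})"
    by (intro uniform_limit_add heat_uniform_limit[OF \<phi>'(1) local_mass_\<phi>' k t]
        duhamel_uniform_limit[OF nonlin_u_source t])
  moreover have "\<forall>\<^sub>F s in at t within {0<..<T}. \<forall>x\<in>UNIV. u x s = heat \<phi>' x s + duhamel (nonlin u) x s"
    by (auto simp: eventually_at_filter equation)
  ultimately show ?thesis
    by (subst uniform_limit_cong) (auto simp: equation[OF t])
qed

lemma ul_norm_diff_u_tendsto_0:
  "0 < t \<Longrightarrow> t < T \<Longrightarrow> ((\<lambda>s. ul_norm 1 N (\<lambda>x. u x s - u x t)) \<longlongrightarrow> 0) (at t within {0<..<T})"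
  using N_pos by (intro ul_norm_tendsto_0_of_uniform_limit uniform_limit_u) auto

lemma SUP_Linf_norm_less_top:
  assumes ab: "0 < a" "b < T"
  shows "(SUP t\<in>{a..b}. Linf_norm (\<lambda>x. u x t)) < \<infinity>"
proof -
  have "(SUP t\<in>{a..b}. Linf_norm (\<lambda>x. u x t)) \<le> ereal (K * a powr (- N))"
  proof (rule SUP_least)
    fix t assume "t \<in> {a..b}"
    then have t: "0 < t" "t < T" "a \<le> t" using ab by auto
    have "decay_rate t \<le> a powr (- N) * 1"
      unfolding decay_rate_def using t ab N_pos by (intro mult_mono powr_mono2' Lg_powr_minus_le_1) auto
    then have "K * decay_rate t \<le> K * a powr (- N)" using K by simp
    then show "Linf_norm (\<lambda>x. u x t) \<le> ereal (K * a powr (- N))"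
      using abs_u_le[OF t(1,2)] by (intro Linf_norm_le) (auto intro: order_trans)
  qed
  then show ?thesis by (auto intro: le_less_trans)
qed

lemma SUP_triple_norm_less_top: "(SUP t\<in>{0<..<T}. triple_norm 1 N \<rho> (\<lambda>x. u x t)) < \<infinity>"
proof -
  have "(SUP t\<in>{0<..<T}. triple_norm 1 N \<rho> (\<lambda>x. u x t)) \<le> ennreal K"
    using K critical_bound_logD[OF u_bound] by (intro SUP_least) (simp add: triple_norm_le_iff_log_bounded)
  then show ?thesis by (auto intro: le_less_trans)
qed

lemma SUP_weighted_Linf_norm_less_top:
  "(SUP t\<in>{0<..<T}. ereal (t powr N * Lg t powr N) * Linf_norm (\<lambda>x. u x t)) < \<infinity>"
proof -
  have "(SUP t\<in>{0<..<T}. ereal (t powr N * Lg t powr N) * Linf_norm (\<lambda>x. u x t)) \<le> ereal K"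
  proof (rule SUP_least)
    fix t assume "t \<in> {0<..<T}"
    then have t: "0 < t" "t < T" by auto
    have "ereal (t powr N * Lg t powr N) * Linf_norm (\<lambda>x. u x t)
        \<le> ereal (t powr N * Lg t powr N) * ereal (K * decay_rate t)"
      using abs_u_le[OF t] by (intro ereal_mult_left_mono Linf_norm_le) auto
    also have "\<dots> = ereal K"
      using t Lg_pos[OF t(1)] by (simp add: decay_rate_def powr_minus field_simps)
    finally show "ereal (t powr N * Lg t powr N) * Linf_norm (\<lambda>x. u x t) \<le> ereal K" .
  qed
  then show ?thesis by (auto intro: le_less_trans)
qed

lemma ul_norm_diff_frac_semigroup_tendsto_0:
  assumes \<gamma>: "0 \<le> \<gamma>" "\<gamma> < N"
  shows "((\<lambda>t. ul_norm 1 \<gamma> (\<lambda>x. u x t - frac_semigroup \<theta> t \<phi> x)) \<longlongrightarrow> 0) (at_right 0)"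
proof (rule tendsto_sandwich[OF always_eventually _ tendsto_const])
  have "((\<lambda>t. ennreal (trace_const * source_size * Lg t powr (- (N - \<gamma>)))) \<longlongrightarrow> ennreal 0) (at_right 0)"
    using \<gamma> by (intro tendsto_ennrealI tendsto_mult_right_zero Lg_powr_minus_tendsto_0) simp
  then show "((\<lambda>t. ennreal (trace_const * source_size * Lg t powr (- (N - \<gamma>)))) \<longlongrightarrow> 0) (at_right 0)" by simp
  show "\<forall>\<^sub>F t in at_right 0. ul_norm 1 \<gamma> (\<lambda>x. u x t - frac_semigroup \<theta> t \<phi> x)
      \<le> ennreal (trace_const * source_size * Lg t powr (- (N - \<gamma>)))"
    using eventually_at_right_real[OF T(1)]
  proof eventually_elim
    case (elim t)
    then have "(\<lambda>x. u x t - frac_semigroup \<theta> t \<phi> x) = (\<lambda>x. duhamel (nonlin u) x t)"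
      by (simp add: equation frac_semigroup_\<phi>)
    then show ?case
      using ul_norm_duhamel_le[OF nonlin_u_source, of t \<gamma>] elim \<gamma>
      by simp
  qed
qed simp

lemma integral_mult_test_fun:
  assumes \<psi>[measurable]: "\<psi> \<in> borel_measurable borel" and B: "\<And>x. \<bar>\<psi> x\<bar> \<le> B" and supp: "\<And>x. R \<le> norm x \<Longrightarrow> \<psi> x = 0"
    and t: "0 < t" "t < T"
  shows "(\<integral>x. u x t * \<psi> x \<partial>lebesgue) = (\<integral>x. \<psi> x * heat \<phi>' x t \<partial>lborel) + (\<integral>x. \<psi> x * duhamel (nonlin u) x t \<partial>lborel)"
proof -
  note [measurable] = \<phi>'(1)
  have integrable: "integrable lborel (\<lambda>x. \<psi> x * f x)"
    if [measurable]: "f \<in> borel_measurable borel" and C: "local_mass_le \<rho> f (ennreal C)" "0 \<le> C" for f C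
    using local_mass_le_larger_radius[OF _ _ C(1), of R] T(1) C(2) supp
    by (intro integrable_compactly_supported_mult[where z = 0 and R = R
          and M = "real (covering_number TYPE('a) R \<rho>) * C", OF _ \<psi> B])
       (auto simp: local_mass_le_def ennreal_mult ennreal_of_nat_eq_real_of_nat)
  have heat: "local_mass_le \<rho> (\<lambda>x. heat \<phi>' x t) (ennreal (heat_const * k))"
    using critical_bound_logD[OF critical_bound_heat[OF \<phi>'(1) \<phi>'_bound k] t] heat_const_ge_1 k T(1) N_pos
    by (intro local_mass_le_of_log_bounded[where \<gamma> = N]) auto
  have "(\<integral>x. u x t * \<psi> x \<partial>lebesgue) = (\<integral>x. \<psi> x * u x t \<partial>lborel)"
    by (subst integral_completion) (auto simp: mult.commute)
  also have "\<dots> = (\<integral>x. \<psi> x * heat \<phi>' x t + \<psi> x * duhamel (nonlin u) x t \<partial>lborel)"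
    by (simp add: equation[OF t] distrib_left)
  also have "\<dots> = (\<integral>x. \<psi> x * heat \<phi>' x t \<partial>lborel) + (\<integral>x. \<psi> x * duhamel (nonlin u) x t \<partial>lborel)"
    using source_const_pos source_size_nonneg
    by (intro Bochner_Integration.integral_add integrable[OF _ heat]
        integrable[OF _ local_mass_duhamel[OF nonlin_u_source t]])
       (use heat_const_ge_1 k in auto)
  finally show ?thesis .
qed

lemma u_tendsto_distribution:
  assumes \<psi>: "test_fun \<psi>"
  shows "((\<lambda>t. \<integral>x. u x t * \<psi> x \<partial>lebesgue) \<longlongrightarrow> (\<integral>x. \<phi> x * \<psi> x \<partial>lebesgue)) (at_right 0)"
proof -
  note cont = continuous_on_test_fun[OF \<psi>]
  have [measurable]: "\<psi> \<in> borel_measurable borel" by (rule borel_measurable_continuous_onI[OF cont])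
  obtain B R where B: "\<And>x. \<bar>\<psi> x\<bar> \<le> B" and supp: "\<And>x. R \<le> norm x \<Longrightarrow> \<psi> x = 0"
    using test_fun_boundedE[OF \<psi>] by blast
  note [measurable] = \<phi>'(1)
  have "(\<integral>x. \<phi> x * \<psi> x \<partial>lebesgue) = (\<integral>x. \<psi> x * \<phi>' x \<partial>lebesgue)"
    by (intro integral_cong_AE AE_completion borel_measurable_times \<phi> measurable_completion) (use \<phi>'(2) in auto)
  also have "\<dots> = (\<integral>x. \<psi> x * \<phi>' x \<partial>lborel)" by (rule integral_completion) measurable
  finally have initial: "(\<integral>x. \<phi> x * \<psi> x \<partial>lebesgue) = (\<integral>x. \<psi> x * \<phi>' x \<partial>lborel)" .
  have "((\<lambda>t. (\<integral>x. \<psi> x * heat \<phi>' x t \<partial>lborel) + (\<integral>x. \<psi> x * duhamel (nonlin u) x t \<partial>lborel))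
      \<longlongrightarrow> (\<integral>x. \<psi> x * \<phi>' x \<partial>lborel) + 0) (at_right 0)"
    by (intro tendsto_add heat_tendsto_distribution[OF \<phi>'(1) local_mass_\<phi>' k cont B supp]
        duhamel_tendsto_distribution[OF nonlin_u_source _ B supp]) auto
  moreover have "\<forall>\<^sub>F t in at_right 0. (\<integral>x. \<psi> x * heat \<phi>' x t \<partial>lborel) + (\<integral>x. \<psi> x * duhamel (nonlin u) x t \<partial>lborel)
      = (\<integral>x. u x t * \<psi> x \<partial>lebesgue)"
    using eventually_at_right_real[OF T(1)]
    by eventually_elim (simp add: integral_mult_test_fun[OF _ B supp])
  ultimately show ?thesis
    unfolding initial add_0_right by (rule Lim_transform_eventually)
qed

end

context bounded_horizon
begin

definition data_threshold :: real where
  "data_threshold = solution_radius / (2 * heat_const)"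

lemma data_threshold_pos: "0 < data_threshold"
  using solution_radius_pos heat_const_ge_1 by (simp add: data_threshold_def)

lemma heat_const_mult_data_threshold: "heat_const * data_threshold = solution_radius / 2"
  using heat_const_ge_1 by (simp add: data_threshold_def)

end

context critical_problem
begin

lemma mild_solution_of_small_data:
  fixes \<phi> :: "'a \<Rightarrow> real"
  assumes \<phi>: "\<phi> \<in> borel_measurable lebesgue" and small: "triple_norm 1 N \<rho> \<phi> \<le> ennreal data_threshold"
  obtains \<phi>' u where "mild_solution \<theta> N S T \<phi> \<phi>' data_threshold u solution_radius"
proof -
  obtain \<phi>' where \<phi>': "\<phi>' \<in> borel_measurable borel" "AE x in lborel. \<phi> x = \<phi>' x"
    using completion_ex_borel_measurable_real[OF \<phi>] by auto
  have bound: "log_bounded N \<rho> data_threshold \<phi>'"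
    using small data_threshold_pos unfolding triple_norm_cong_AE[OF \<phi>'(2)]
    by (simp add: triple_norm_le_iff_log_bounded)
  have "critical_bound (solution_radius / 2) (heat \<phi>')"
    using critical_bound_heat[OF \<phi>'(1) bound] data_threshold_pos by (simp add: heat_const_mult_data_threshold)
  from mild_solution_exists[OF \<phi>'(1) this] obtain u
    where "jointly_measurable u" "critical_bound solution_radius u"
      "\<And>x t. 0 < t \<Longrightarrow> t < T \<Longrightarrow> u x t = heat \<phi>' x t + duhamel (nonlin u) x t"
    by blast
  then have "mild_solution \<theta> N S T \<phi> \<phi>' data_threshold u solution_radius"
    using \<phi> \<phi>' bound data_threshold_pos solution_radius_pos by unfold_locales auto
  then show ?thesis by (rule that)
qed

end

theorem theorem1p1:
  fixes \<theta> Tstar :: real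
  assumes "0 < \<theta>" "\<theta> \<le> 2" "0 < Tstar"
  defines "n \<equiv> real DIM('a::euclidean_space)"
  defines "p \<equiv> 1 + \<theta> / n"
  shows "\<exists>\<epsilon>>0. \<forall>(\<phi> :: 'a \<Rightarrow> real) T.
    \<phi> \<in> ul_space 1 (n / \<theta>) \<and> 0 < T \<and> T \<le> Tstar \<and>
    triple_norm 1 (n / \<theta>) (T powr (1 / \<theta>)) \<phi> \<le> ennreal \<epsilon> \<longrightarrow>
    (\<exists>u :: 'a \<Rightarrow> real \<Rightarrow> real.
       is_solution \<theta> p \<phi> T u \<and>
       (\<forall>t\<in>{0<..<T}. (\<lambda>x. u x t) \<in> ul_space 1 (n / \<theta>)) \<and>
       (\<forall>t\<in>{0<..<T}. ((\<lambda>s. ul_norm 1 (n / \<theta>) (\<lambda>x. u x s - u x t)) \<longlongrightarrow> 0)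
                          (at t within {0<..<T})) \<and>
       (\<forall>a b. 0 < a \<and> a \<le> b \<and> b < T \<longrightarrow>
          (SUP t\<in>{a..b}. Linf_norm (\<lambda>x. u x t)) < \<infinity>) \<and>
       (SUP t\<in>{0<..<T}. triple_norm 1 (n / \<theta>) (T powr (1 / \<theta>)) (\<lambda>x. u x t)) < \<infinity> \<and>
       (SUP t\<in>{0<..<T}. ereal (t powr (n / \<theta>) * ln (exp 1 + 1 / t) powr (n / \<theta>))
                          * Linf_norm (\<lambda>x. u x t)) < \<infinity> \<and>
       (\<forall>\<gamma>. 0 \<le> \<gamma> \<and> \<gamma> < n / \<theta> \<longrightarrow>
          ((\<lambda>t. ul_norm 1 \<gamma> (\<lambda>x. u x t - frac_semigroup \<theta> t \<phi> x)) \<longlongrightarrow> 0) (at_right 0)) \<and>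
       (\<forall>\<psi>. test_fun \<psi> \<longrightarrow>
          ((\<lambda>t. \<integral>x. u x t * \<psi> x \<partial>lebesgue) \<longlongrightarrow> (\<integral>x. \<phi> x * \<psi> x \<partial>lebesgue))
            (at_right 0)))"
proof -
  define N where "N = n / \<theta>"
  interpret bounded_horizon \<theta> N "TYPE('a)" Tstar
    using assms(1-3) by unfold_locales (auto simp: N_def n_def)
  have p: "p = 1 + 1 / N" by (simp add: p_def N_def)
  show ?thesis
    unfolding N_def[symmetric] p Lg_def[symmetric]
  proof (intro exI[of _ data_threshold] conjI data_threshold_pos allI impI, elim conjE, goal_cases)
    case (1 \<phi> T)
    interpret critical_problem \<theta> N "TYPE('a)" Tstar T
      using 1 by unfold_locales
    obtain \<phi>' u where "mild_solution \<theta> N Tstar T \<phi> \<phi>' data_threshold u solution_radius"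
      using mild_solution_of_small_data 1 by (auto simp: ul_space_def locally_integrable_def)
    then interpret mild_solution \<theta> N "TYPE('a)" Tstar T \<phi> \<phi>' data_threshold u solution_radius .
    show ?case
      by (intro exI[of _ u] conjI ballI allI impI is_solution_u u_in_ul_space ul_norm_diff_u_tendsto_0
          SUP_Linf_norm_less_top SUP_triple_norm_less_top SUP_weighted_Linf_norm_less_top
          ul_norm_diff_frac_semigroup_tendsto_0 u_tendsto_distribution)
        auto
  qed
qed

end
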